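(* Let $\mathcal I=[0,b)$, $X=\{x_n\}_{n=1}^\infty$, $d_n=x_n-x_{n-1}$ with $\sup_nd_n<\infty$ be as in the context. If $$\sum_{n=1}^\infty d_n^2=\infty,$$ then the Hamiltonian $\mathrm H_{X,\alpha}$ is self-adjoint for any $\alpha=\{\alpha_n\}_{n=1}^\infty\subset\mathbb R$.
   Context: Let $\mathcal I=[0,b)$, $0<b\le+\infty$, and $X=\{x_n\}_{n=1}^\infty$, $x_0=0$, with $0=x_0<x_1<x_2<\dots<b$ and $\lim_nx_n=b$; $d_n=x_n-x_{n-1}$, and $d^*=\sup_nd_n<\infty$ is assumed. $W^{2,2}(\mathcal I\setminus X)=\{f\in L^2(\mathcal I): f,f'\in AC_{loc}(\mathcal I\setminus X),\ f''\in L^2(\mathcal I)\}$, and $W^{2,2}_{\mathrm{comp}}(\mathcal I\setminus X)$ is the set of its elements whose support is compact in $\mathcal I=[0,b)$. For $\alpha=\{\alpha_n\}\subset\mathbb R$, $\mathrm H_{X,\alpha}$ is the closure in $L^2(\mathcal I)$ of the symmetric operator $-\mathrm d^2/\mathrm dx^2$ with domain $$\{f\in W^{2,2}_{\mathrm{comp}}(\mathcal I\setminus X): f'(0)=0,\ f(x_n+)=f(x_n-),\ f'(x_n+)-f'(x_n-)=\alpha_nf(x_n),\ n\in\mathbb N\}.$$ *)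

theory Defs
  imports "HOL-Analysis.Analysis"
begin

section \<open>Unbounded operators in \<open>L\<^sup>2\<close>\<close>

text \<open>
  Elements of the complex Hilbert space \<open>L\<^sup>2(M)\<close> are handled through representatives, and an
  operator is given by its graph, a set of pairs of representatives.  Adjoints and closures of
  graphs are automatically saturated under almost-everywhere equality in both components, so that
  they are (preimages of) graphs in the Hilbert space of equivalence classes.
\<close>

definition L2 :: "'a measure \<Rightarrow> ('a \<Rightarrow> complex) set" where
  "L2 M = {f \<in> borel_measurable M. integrable M (\<lambda>x. (cmod (f x))\<^sup>2)}"

definition L2_inner :: "'a measure \<Rightarrow> ('a \<Rightarrow> complex) \<Rightarrow> ('a \<Rightarrow> complex) \<Rightarrow> complex" where
  "L2_inner M f g = (\<integral>x. f x * cnj (g x) \<partial>M)"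

definition L2_dist :: "'a measure \<Rightarrow> ('a \<Rightarrow> complex) \<Rightarrow> ('a \<Rightarrow> complex) \<Rightarrow> real" where
  "L2_dist M f g = sqrt (\<integral>x. (cmod (f x - g x))\<^sup>2 \<partial>M)"

type_synonym 'a graph = "(('a \<Rightarrow> complex) \<times> ('a \<Rightarrow> complex)) set"

definition op_closure :: "'a measure \<Rightarrow> 'a graph \<Rightarrow> 'a graph" where
  "op_closure M T = {(f, g). f \<in> L2 M \<and> g \<in> L2 M \<and>
     (\<exists>F G. (\<forall>k::nat. (F k, G k) \<in> T) \<and>
        (\<lambda>k. L2_dist M (F k) f) \<longlonglongrightarrow> 0 \<and> (\<lambda>k. L2_dist M (G k) g) \<longlonglongrightarrow> 0)}"

definition op_adjoint :: "'a measure \<Rightarrow> 'a graph \<Rightarrow> 'a graph" where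
  "op_adjoint M T = {(u, v). u \<in> L2 M \<and> v \<in> L2 M \<and>
     (\<forall>(f, g) \<in> T. L2_inner M g u = L2_inner M f v)}"

definition densely_defined :: "'a measure \<Rightarrow> 'a graph \<Rightarrow> bool" where
  "densely_defined M T \<longleftrightarrow>
     (\<forall>f \<in> L2 M. \<forall>\<epsilon>>0. \<exists>(g, h) \<in> T. g \<in> L2 M \<and> L2_dist M g f < \<epsilon>)"

text \<open>
  Linearity and (almost-everywhere) single-valuedness of \<open>T\<close> need not be required separately: an
  adjoint is a linear subspace, and the adjoint of a densely defined graph is single-valued.
\<close>

definition self_adjoint :: "'a measure \<Rightarrow> 'a graph \<Rightarrow> bool" where
  "self_adjoint M T \<longleftrightarrow> densely_defined M T \<and> op_adjoint M T = T"


section \<open>Absolute continuity and Sobolev functions off a discrete set\<close>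

text \<open>
  \<open>\<D>\<close> ranges over the finite families of compact subintervals \<open>K = {Inf K..Sup K}\<close> of \<open>{c..d}\<close>
  with pairwise disjoint interiors; they need not cover \<open>{c..d}\<close>.
\<close>

definition AC_on :: "real \<Rightarrow> real \<Rightarrow> (real \<Rightarrow> complex) \<Rightarrow> bool" where
  "AC_on c d f \<longleftrightarrow> (\<forall>\<epsilon>>0. \<exists>\<delta>>0. \<forall>\<D>.
     \<D> division_of \<Union>\<D> \<and> \<Union>\<D> \<subseteq> {c..d} \<and> (\<Sum>K\<in>\<D>. Sup K - Inf K) < \<delta> \<longrightarrow>
       (\<Sum>K\<in>\<D>. cmod (f (Sup K) - f (Inf K))) < \<epsilon>)"

definition AC_loc :: "real set \<Rightarrow> (real \<Rightarrow> complex) \<Rightarrow> bool" where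
  "AC_loc S f \<longleftrightarrow> (\<forall>c d. {c..d} \<subseteq> S \<longrightarrow> AC_on c d f)"

text \<open>
  \<open>W22_derivs I X f f' f''\<close> says that \<open>f \<in> W\<^sup>2\<^sup>,\<^sup>2(I - X)\<close>, with first derivative \<open>f'\<close> on \<open>I - X\<close>
  and second derivative \<open>f''\<close> almost everywhere.  Since \<open>f'\<close> is required to be locally absolutely
  continuous, it is the derivative of \<open>f\<close> at every point of \<open>I - X\<close> (one-sided at an end point of
  \<open>I\<close>).  The values of \<open>f\<close> and \<open>f'\<close> on \<open>X\<close> and outside \<open>I\<close> are immaterial.
\<close>

definition W22_derivs ::
  "real set \<Rightarrow> real set \<Rightarrow> (real \<Rightarrow> complex) \<Rightarrow> (real \<Rightarrow> complex) \<Rightarrow> (real \<Rightarrow> complex) \<Rightarrow> bool" where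
  "W22_derivs I X f f' f'' \<longleftrightarrow>
     f \<in> L2 (lebesgue_on I) \<and> AC_loc (I - X) f \<and> AC_loc (I - X) f' \<and>
     (\<forall>t \<in> I - X. (f has_vector_derivative f' t) (at t within I)) \<and>
     (AE t in lebesgue_on I. (f' has_vector_derivative f'' t) (at t within I)) \<and>
     f'' \<in> L2 (lebesgue_on I)"

definition compactly_supported :: "real set \<Rightarrow> real set \<Rightarrow> (real \<Rightarrow> complex) \<Rightarrow> bool" where
  "compactly_supported I X f \<longleftrightarrow>
     compact (closure {t \<in> I - X. f t \<noteq> 0}) \<and> closure {t \<in> I - X. f t \<noteq> 0} \<subseteq> I"


section \<open>The Hamiltonian with point interactions\<close>

definition half_open :: "ereal \<Rightarrow> real set" where
  "half_open b = {t. 0 \<le> t \<and> ereal t < b}"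

definition interaction_points :: "(nat \<Rightarrow> real) \<Rightarrow> real set" where
  "interaction_points x = x ` {1..}"

definition delta_jump :: "real \<Rightarrow> real \<Rightarrow> (real \<Rightarrow> complex) \<Rightarrow> (real \<Rightarrow> complex) \<Rightarrow> bool" where
  "delta_jump a c f f' \<longleftrightarrow> (\<exists>v p q.
     (f \<longlongrightarrow> v) (at_right c) \<and> (f \<longlongrightarrow> v) (at_left c) \<and>
     (f' \<longlongrightarrow> p) (at_right c) \<and> (f' \<longlongrightarrow> q) (at_left c) \<and> p - q = complex_of_real a * v)"

definition H_pre :: "ereal \<Rightarrow> (nat \<Rightarrow> real) \<Rightarrow> (nat \<Rightarrow> real) \<Rightarrow> real graph" where
  "H_pre b x \<alpha> = {(f, \<lambda>t. - f'' t) | f f' f''.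
     W22_derivs (half_open b) (interaction_points x) f f' f'' \<and>
     compactly_supported (half_open b) (interaction_points x) f \<and>
     f' 0 = 0 \<and> (\<forall>n\<ge>1. delta_jump (\<alpha> n) (x n) f f')}"

definition H_op :: "ereal \<Rightarrow> (nat \<Rightarrow> real) \<Rightarrow> (nat \<Rightarrow> real) \<Rightarrow> real graph" where
  "H_op b x \<alpha> = op_closure (lebesgue_on (half_open b)) (H_pre b x \<alpha>)"

end

theory Submission
  imports Defs
begin

text \<open>
  The minimal operator is symmetric by Green's formula, and its adjoint acts as \<open>- d\<^sup>2/dx\<^sup>2\<close> on all
  \<open>W\<^sup>2\<^sup>,\<^sup>2\<close> functions satisfying the boundary and jump conditions. So it suffices to approximate
  such a function \<open>w\<close> in the graph norm by compactly supported ones. Multiply \<open>w\<close> by cutoffs \<open>\<phi>\<^sub>k\<close>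
  whose derivative vanishes at every \<open>x\<^sub>n\<close>, hence which respect the jump conditions for every \<open>\<alpha>\<close>,
  and which descend from 1 to 0, dropping on the \<open>n\<close>-th gap by \<open>d\<^sub>n\<^sup>2 / S\<^sub>k\<close> where
  \<open>S\<^sub>k = d\<^sub>1\<^sup>2 + \<dots> + d\<^sub>k\<^sup>2\<close>. Then \<open>\<phi>\<^sub>k'' = O(1/S\<^sub>k)\<close> and \<open>\<phi>\<^sub>k' = O(d\<^sub>n/S\<^sub>k)\<close>; an integration by
  parts on each gap, using that \<open>d\<^sub>n\<close> is bounded, bounds \<open>\<phi>\<^sub>k' w'\<close> by the norms of \<open>w\<close> and \<open>w''\<close>
  times \<open>O(1/S\<^sub>k)\<close>. As \<open>S\<^sub>k \<rightarrow> \<infinity>\<close>, the commutator terms vanish.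
\<close>

section \<open>Absolutely continuous functions\<close>

text \<open>The obstacle is that nothing is assumed about the coupling constants. If
  \<open>\<phi>'\<close> did not vanish at the grid points, integrating the derivative of
  \<open>\<phi>'\<^sup>2 w' cnj w\<close> over the gaps would leave, at each site,
  \<open>\<phi>'\<^sup>2\<close> times \<alpha> times the squared modulus of \<open>w\<close>, which
  the norms of \<open>w\<close> and \<open>w''\<close> cannot control uniformly in \<alpha>. The
  zeros of \<open>\<phi>'\<close> remove these terms, and every estimate stays inside one gap. The
  price of these zeros is the hypothesis. A function that descends by \<delta> on an interval of
  length \<open>d\<close> with slope 0 at both ends has a second derivative of size at least
  \<open>4 \<delta> / d\<^sup>2\<close>. A bound \<epsilon> on \<open>\<phi>''\<close> therefore
  allows a descent of at most \<open>\<epsilon> d\<^sup>2 / 4\<close> per gap, and a fall from 1 to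
  0 with arbitrarily small \<open>\<phi>''\<close> is possible only if the squares of the gap
  lengths have infinite sum. Drops proportional to \<open>d\<^sup>2\<close> spend this allowance
  evenly.\<close>

lemma division_length_le_measure:
  fixes \<D> :: "real set set"
  assumes D: "\<D> division_of \<Union>\<D>" and sub: "\<Union>\<D> \<subseteq> T" and T: "T \<in> lmeasurable"
  shows "(\<Sum>K\<in>\<D>. Sup K - Inf K) \<le> measure lebesgue T"
proof -
  \<comment> \<open>The intervals meet only in end points, so their total length is the integral of
    1 over the union. This turns an open cover of small measure into the smallness of lengths that
    \<open>AC_on\<close> asks for.\<close>
  have hi: "((\<lambda>_. 1::real) has_integral (\<Sum>K\<in>\<D>. Sup K - Inf K)) (\<Union>\<D>)"
  proof (rule has_integral_combine_division[OF D])
    fix K assume K: "K \<in> \<D>"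
    obtain u v where uv: "K = cbox u v" "K \<noteq> {}"
      using division_ofD(3,4)[OF D K] by blast
    then show "((\<lambda>_. 1::real) has_integral Sup K - Inf K) K"
      using has_integral_const_real[of "1::real" u v] by simp
  qed
  have "\<Union>\<D> \<in> lmeasurable"
    by (intro lmeasurable_compact compact_Union) (use D division_ofD(1,4)[OF D] in auto)
  then have "(\<Sum>K\<in>\<D>. Sup K - Inf K) = measure lebesgue (\<Union>\<D>)"
    using hi lmeasure_integral by (metis integral_unique)
  also have "\<dots> \<le> measure lebesgue T"
    by (rule measure_mono_fmeasurable[OF sub _ T])
       (use \<open>\<Union>\<D> \<in> lmeasurable\<close> in auto)
  finally show ?thesis .
qed

lemma AC_onD:
  assumes "AC_on a c F" and "\<epsilon> > 0"
  shows "\<exists>\<eta>>0. \<forall>\<D>. \<D> division_of \<Union>\<D> \<and> \<Union>\<D> \<subseteq> {a..c} \<and>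
    (\<Sum>K\<in>\<D>. Sup K - Inf K) < \<eta> \<longrightarrow> (\<Sum>K\<in>\<D>. cmod (F (Sup K) - F (Inf K))) < \<epsilon>"
  using assms(1)[unfolded AC_on_def, THEN spec, THEN mp, OF assms(2)] .

text \<open>
  Tags in the exceptional null set get a gauge inside an open cover of small measure, where absolute
  continuity makes the increments of \<open>F\<close> small; all other tags are handled by the derivative.
\<close>

lemma has_integral_AC_derivative:
  fixes F g :: "real \<Rightarrow> complex"
  assumes "a \<le> c" and AC: "AC_on a c F" and N: "negligible N"
    and der: "\<And>t. t \<in> {a<..<c} - N \<Longrightarrow> (F has_vector_derivative g t) (at t)"
  shows "(g has_integral F c - F a) {a..c}"
proof -
  \<comment> \<open>The derivative is known only inside the open interval, so the ends join the
    exceptional set. With the integrand set to 0 there, a bad tag contributes nothing but an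
    increment of \<open>F\<close>.\<close>
  define N' where "N' = N \<union> {a, c}"
  define h where "h t = (if t \<in> N' then 0 else g t)" for t
  have N': "negligible N'" unfolding N'_def using N by (simp add: negligible_insert)
  have "(h has_integral F c - F a) {a..c}"
    unfolding has_integral_real
  proof (intro allI impI)
    fix e :: real assume e: "e > 0"
    \<comment> \<open>The \<open>+ 1\<close> keeps the denominator nonzero when
      \<open>a = c\<close>.\<close>
    define e1 where "e1 = e / (4 * (c - a + 1))"
    have e1: "e1 > 0" using e \<open>a \<le> c\<close> by (simp add: e1_def)
    have e1le: "e1 * (c - a) < e / 2"
    proof -
      have "e1 * (c - a) \<le> e1 * (c - a + 1)" using e1 by simp
      also have "\<dots> = e / 4" proof -
        have "c - a + 1 \<noteq> 0" using \<open>a \<le> c\<close> by linarith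
        then have "e / (4 * (c - a + 1)) * (c - a + 1) = e / 4"
          by (metis nonzero_divide_mult_cancel_right times_divide_eq_left divide_divide_eq_left' nonzero_mult_div_cancel_right)
        then show ?thesis unfolding e1_def .
      qed
      finally show ?thesis using e by linarith
    qed
    obtain \<eta> where \<eta>: "\<eta> > 0" and AC\<eta>: "\<forall>\<D>. \<D> division_of \<Union>\<D> \<and> \<Union>\<D> \<subseteq> {a..c} \<and>
        (\<Sum>K\<in>\<D>. Sup K - Inf K) < \<eta> \<longrightarrow> (\<Sum>K\<in>\<D>. cmod (F (Sup K) - F (Inf K))) < e / 2"
      using AC_onD[OF AC half_gt_zero[OF e]] by (elim exE conjE)
    have "N' \<in> sets lebesgue" using N' negligible_imp_sets by blast
    then obtain U where U: "open U" "N' \<subseteq> U" "U - N' \<in> lmeasurable" "emeasure lebesgue (U - N') < ennreal \<eta>"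
      using sets_lebesgue_outer_open \<eta> by metis
    have Ulm: "U \<in> lmeasurable"
      using fmeasurable.Un[OF negligible_imp_measurable[OF N'] U(3)] U(2) by (simp add: Un_absorb1)
    have "measure lebesgue U = measure lebesgue (U - N')"
      using measure_negligible_symdiff[OF U(3), of U] negligible_subset[OF N', of "(U - N' - U) \<union> (U - (U - N'))"]
      by auto
    also have "\<dots> < \<eta>"
      using U(3,4) \<eta> by (simp add: emeasure_eq_measure2 ennreal_less_iff)
    finally have Um: "measure lebesgue U < \<eta>" .
    have "\<exists>\<delta>>0. \<forall>y. \<bar>y - t\<bar> < \<delta> \<longrightarrow> cmod (F y - F t - (y - t) *\<^sub>R g t) \<le> e1 * \<bar>y - t\<bar>" if "t \<in> {a..c} - N'" for t
    proof -
      have "(F has_vector_derivative g t) (at t)" using that der by (auto simp: N'_def)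
      then show ?thesis using e1
        unfolding has_vector_derivative_def has_derivative_within_alt
        by (auto simp: abs_minus_commute)
    qed
    then obtain \<delta> where \<delta>: "\<And>t. t \<in> {a..c} - N' \<Longrightarrow> \<delta> t > 0"
      "\<And>t y. t \<in> {a..c} - N' \<Longrightarrow> \<bar>y - t\<bar> < \<delta> t \<Longrightarrow> cmod (F y - F t - (y - t) *\<^sub>R g t) \<le> e1 * \<bar>y - t\<bar>"
      by metis
    define \<gamma> where "\<gamma> t = (if t \<in> N' then U else if t \<in> {a..c} then ball t (\<delta> t) else UNIV)" for t
    have "gauge \<gamma>"
      unfolding gauge_def \<gamma>_def using U \<delta>(1) by (auto simp: subset_iff)
    moreover have "norm (sum (\<lambda>(x,k). measure lborel k *\<^sub>R h x) p - (F c - F a)) < e"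
      if p: "p tagged_division_of {a..c}" and fine: "\<gamma> fine p" for p
    proof -
      have fin: "finite p" using p by blast
      have sub: "K \<subseteq> \<gamma> t" if "(t, K) \<in> p" for t K using fine that unfolding fine_def by blast
      define p1 where "p1 = {z \<in> p. fst z \<in> N'}"
      define p2 where "p2 = {z \<in> p. fst z \<notin> N'}"
      have pu: "p = p1 \<union> p2" "p1 \<inter> p2 = {}" "finite p1" "finite p2"
        using fin by (auto simp: p1_def p2_def)
      have K: "\<exists>u v. K = {u..v} \<and> u \<le> t \<and> t \<le> v \<and> a \<le> u \<and> v \<le> c" if "(t, K) \<in> p" for t K
        using tagged_division_ofD(2,3,4)[OF p that] by (fastforce simp: box_real)
      define w where "w = (\<lambda>(t, K). measure lborel K *\<^sub>R h t - (F (Sup K) - F (Inf K)))"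
      have eq: "sum (\<lambda>(x,k). measure lborel k *\<^sub>R h x) p - (F c - F a) = sum w p1 + sum w p2"
      proof -
        have "sum (\<lambda>(x,k). measure lborel k *\<^sub>R h x) p - (F c - F a) = sum w p"
          unfolding additive_tagged_division_1[OF \<open>a \<le> c\<close> p, of F, symmetric]
          by (simp add: w_def sum_subtractf case_prod_unfold)
        also have "\<dots> = sum w p1 + sum w p2"
          using pu by (metis sum.union_disjoint)
        finally show ?thesis .
      qed
      have "norm (sum w p2) \<le> (\<Sum>(t,K)\<in>p2. e1 * (Sup K - Inf K))"
      proof (rule sum_norm_le, clarify)
        fix t K assume "(t, K) \<in> p2"
        then have tK: "(t, K) \<in> p" "t \<notin> N'" by (auto simp: p2_def)
        obtain u v where uv: "K = {u..v}" "u \<le> t" "t \<le> v" "a \<le> u" "v \<le> c" using K[OF tK(1)] by blast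
        have t: "t \<in> {a..c} - N'" using uv tK by auto
        have "K \<subseteq> ball t (\<delta> t)"
          using sub[OF tK(1)] t unfolding \<gamma>_def by simp
        then have "u \<in> ball t (\<delta> t)" "v \<in> ball t (\<delta> t)" using uv by (metis atLeastAtMost_iff order_trans order_refl subsetD)+
        then have "cmod (F v - F t - (v - t) *\<^sub>R g t) \<le> e1 * \<bar>v - t\<bar>" "cmod (F u - F t - (u - t) *\<^sub>R g t) \<le> e1 * \<bar>u - t\<bar>"
          using \<delta>(2)[OF t, of v] \<delta>(2)[OF t, of u] by (auto simp: dist_real_def abs_minus_commute)
        moreover have "w (t, K) = (F u - F t - (u - t) *\<^sub>R g t) - (F v - F t - (v - t) *\<^sub>R g t)"
          using uv tK by (simp add: w_def h_def algebra_simps)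
        ultimately have "norm (w (t, K)) \<le> e1 * \<bar>u - t\<bar> + e1 * \<bar>v - t\<bar>"
          using norm_triangle_ineq4 order_trans by (smt (verit))
        also have "\<dots> = e1 * (Sup K - Inf K)"
          using uv by (simp add: algebra_simps)
        finally show "norm (w (t, K)) \<le> e1 * (Sup K - Inf K)" .
      qed
      also have "\<dots> \<le> (\<Sum>(t,K)\<in>p. e1 * (Sup K - Inf K))"
      proof (rule sum_mono2[OF fin])
        show "p2 \<subseteq> p" by (auto simp: p2_def)
        show "0 \<le> (case z of (t, K) \<Rightarrow> e1 * (Sup K - Inf K))" if "z \<in> p - p2" for z
        proof -
          obtain t T where z: "z = (t, T)" by fastforce
          then obtain u v where "T = {u..v}" "u \<le> v" using K[of t T] \<open>z \<in> p - p2\<close> by fastforce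
          then show ?thesis using z e1 by simp
        qed
      qed
      also have "\<dots> = e1 * (c - a)"
        using additive_tagged_division_1[OF \<open>a \<le> c\<close> p, of "\<lambda>x. x"]
        by (simp add: sum_distrib_left[symmetric] case_prod_unfold)
      finally have b2: "norm (sum w p2) < e / 2" using e1le by linarith
      have p1pt: "p1 tagged_partial_division_of {a..c}"
        by (rule tagged_partial_division_subset[of p])
          (use p in \<open>auto simp: p1_def tagged_division_of_def\<close>)
      define \<D> where "\<D> = snd ` p1"
      have D: "\<D> division_of \<Union>\<D>" unfolding \<D>_def
        by (rule partial_division_of_tagged_division[OF p1pt])
      have Dsub: "\<Union>\<D> \<subseteq> {a..c}"
        using tagged_partial_division_ofD(3)[OF p1pt] unfolding \<D>_def by fastforce
      have DU: "\<Union>\<D> \<subseteq> U"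
        using sub unfolding \<D>_def p1_def \<gamma>_def by force
      have "(\<Sum>K\<in>\<D>. Sup K - Inf K) < \<eta>"
        using division_length_le_measure[OF D DU Ulm] Um by linarith
      then have lt: "(\<Sum>K\<in>\<D>. cmod (F (Sup K) - F (Inf K))) < e / 2"
        using AC\<eta>[THEN spec, THEN mp, OF conjI[OF D conjI[OF Dsub]]] by simp
      \<comment> \<open>Distinct tags may carry the same degenerate interval, so passing from
        \<open>p1\<close> to its set of intervals requires a summand that is 0 on degenerate ones. A
        single point gives 0 by itself; the \<open>if\<close> settles the empty interval, where
        \<open>Sup\<close> and \<open>Inf\<close> carry no information.\<close>
      have "norm (sum w p1) \<le> (\<Sum>(t,K)\<in>p1. if K = {} then 0 else cmod (F (Sup K) - F (Inf K)))"
      proof (rule sum_norm_le, clarify)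
        fix t K assume "(t, K) \<in> p1"
        then have "h t = 0" "K \<noteq> {}"
          using tagged_division_ofD(2)[OF p, of t K] by (auto simp: p1_def h_def)
        then show "norm (w (t, K)) \<le> (if K = {} then 0 else cmod (F (Sup K) - F (Inf K)))"
          by (simp add: w_def norm_minus_commute)
      qed
      also have "\<dots> = (\<Sum>K\<in>\<D>. if K = {} then 0 else cmod (F (Sup K) - F (Inf K)))"
        unfolding \<D>_def
        by (rule sum.over_tagged_division_lemma[OF tagged_partial_division_of_Union_self[OF p1pt]])
          (auto simp: not_less)
      also have "\<dots> = (\<Sum>K\<in>\<D>. cmod (F (Sup K) - F (Inf K)))"
        by (rule sum.cong) (use D in \<open>auto simp: division_of_def\<close>)
      finally have "norm (sum w p1) < e / 2" using lt by simp
      then show ?thesis unfolding eq using b2 by (intro norm_triangle_lt) linarith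
    qed
    ultimately show "\<exists>\<gamma>. gauge \<gamma> \<and> (\<forall>\<D>. \<D> tagged_division_of {a..c} \<and> \<gamma> fine \<D> \<longrightarrow>
        norm (sum (\<lambda>(x,k). measure lborel k *\<^sub>R h x) \<D> - (F c - F a)) < e)"
      by (intro exI[of _ \<gamma>] conjI allI impI) (auto simp only:)
  qed
  then show ?thesis
    using has_integral_spike[OF N', of "{a..c}" g h] by (simp add: h_def)
qed


section \<open>Closure properties of absolute continuity\<close>

lemma division_Sup_Inf:
  fixes \<D> :: "real set set"
  assumes "\<D> division_of \<Union>\<D>" "\<Union>\<D> \<subseteq> {c..d}" "K \<in> \<D>"
  shows "K = {Inf K..Sup K}" "Inf K \<le> Sup K" "c \<le> Inf K" "Sup K \<le> d"
    "Inf K \<in> {c..d}" "Sup K \<in> {c..d}"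
proof -
  obtain u v where uv: "K = cbox u v" using division_ofD(4)[OF assms(1,3)] by blast
  moreover have "K \<noteq> {}" using division_ofD(3)[OF assms(1,3)] .
  ultimately have *: "u \<le> v" "Inf K = u" "Sup K = v" by auto
  have "K \<subseteq> {c..d}" using assms by blast
  then show "K = {Inf K..Sup K}" "Inf K \<le> Sup K" "c \<le> Inf K" "Sup K \<le> d"
    "Inf K \<in> {c..d}" "Sup K \<in> {c..d}"
    using * uv by auto
qed

lemma AC_onI:
  assumes "\<And>\<epsilon>. \<epsilon> > 0 \<Longrightarrow> \<exists>\<eta>>0. \<forall>\<D>. \<D> division_of \<Union>\<D> \<longrightarrow> \<Union>\<D> \<subseteq> {a..c} \<longrightarrow>
    (\<Sum>K\<in>\<D>. Sup K - Inf K) < \<eta> \<longrightarrow> (\<Sum>K\<in>\<D>. cmod (F (Sup K) - F (Inf K))) < \<epsilon>"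
  shows "AC_on a c F"
  unfolding AC_on_def
proof (intro allI impI)
  fix \<epsilon> :: real assume "\<epsilon> > 0"
  from assms[OF this] show "\<exists>\<eta>>0. \<forall>\<D>. \<D> division_of \<Union>\<D> \<and> \<Union>\<D> \<subseteq> {a..c} \<and>
    (\<Sum>K\<in>\<D>. Sup K - Inf K) < \<eta> \<longrightarrow> (\<Sum>K\<in>\<D>. cmod (F (Sup K) - F (Inf K))) < \<epsilon>"
    by (elim exE conjE) (intro exI conjI allI impI, assumption, simp only:)
qed

text \<open>Sums, products, conjugates, congruence and Lipschitz functions are all handled by
  choosing the dominating terms here; \<open>E * (t - s)\<close> is the Lipschitz part. The
  \<open>+ 1\<close> in the denominators of the proof allows a coefficient to be 0.\<close>

lemma AC_on_dominated:
  assumes "AC_on a c F" "AC_on a c G" "C \<ge> 0" "D \<ge> 0" "E \<ge> 0"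
    and dom: "\<And>s t. a \<le> s \<Longrightarrow> s \<le> t \<Longrightarrow> t \<le> c \<Longrightarrow>
      cmod (H t - H s) \<le> C * cmod (F t - F s) + D * cmod (G t - G s) + E * (t - s)"
  shows "AC_on a c H"
proof (rule AC_onI)
  fix e :: real assume e: "e > 0"
  have e1: "e / (3 * (C + 1)) > 0" "e / (3 * (D + 1)) > 0" "e / (3 * (E + 1)) > 0" using e assms by auto
  obtain p where p: "p > 0" "\<forall>\<D>. \<D> division_of \<Union>\<D> \<and> \<Union>\<D> \<subseteq> {a..c} \<and>
        (\<Sum>K\<in>\<D>. Sup K - Inf K) < p \<longrightarrow> (\<Sum>K\<in>\<D>. cmod (F (Sup K) - F (Inf K))) < e / (3 * (C + 1))"
    using AC_onD[OF assms(1) e1(1)] by (elim exE conjE)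
  obtain q where q: "q > 0" "\<forall>\<D>. \<D> division_of \<Union>\<D> \<and> \<Union>\<D> \<subseteq> {a..c} \<and>
        (\<Sum>K\<in>\<D>. Sup K - Inf K) < q \<longrightarrow> (\<Sum>K\<in>\<D>. cmod (G (Sup K) - G (Inf K))) < e / (3 * (D + 1))"
    using AC_onD[OF assms(2) e1(2)] by (elim exE conjE)
  define r where "r = min (min p q) (e / (3 * (E + 1)))"
  have "(\<Sum>K\<in>\<D>. cmod (H (Sup K) - H (Inf K))) < e"
    if d: "\<D> division_of \<Union>\<D>" and sub: "\<Union>\<D> \<subseteq> {a..c}" and le: "(\<Sum>K\<in>\<D>. Sup K - Inf K) < r" for \<D>
  proof -
    note K = division_Sup_Inf[OF d sub]
    have 1: "(\<Sum>K\<in>\<D>. cmod (F (Sup K) - F (Inf K))) < e / (3 * (C + 1))"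
      using p(2)[THEN spec, THEN mp, OF conjI[OF d conjI[OF sub]]] le by (simp add: r_def)
    have 2: "(\<Sum>K\<in>\<D>. cmod (G (Sup K) - G (Inf K))) < e / (3 * (D + 1))"
      using q(2)[THEN spec, THEN mp, OF conjI[OF d conjI[OF sub]]] le by (simp add: r_def)
    have 3: "(\<Sum>K\<in>\<D>. Sup K - Inf K) < e / (3 * (E + 1))" using le by (simp add: r_def)
    have *: "Z * y < e / 3" if "0 \<le> y" "y < e / (3 * (Z + 1))" "Z \<ge> 0" for y Z
    proof -
      have "Z * y \<le> (Z + 1) * y" using that by (simp add: algebra_simps)
      also have "\<dots> < (Z + 1) * (e / (3 * (Z + 1)))" using that by (intro mult_strict_left_mono) auto
      also have "\<dots> = e / 3" using that by (simp add: divide_simps)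
      finally show ?thesis .
    qed
    have "(\<Sum>K\<in>\<D>. cmod (H (Sup K) - H (Inf K))) \<le>
      (\<Sum>K\<in>\<D>. C * cmod (F (Sup K) - F (Inf K)) + D * cmod (G (Sup K) - G (Inf K)) + E * (Sup K - Inf K))"
      by (intro sum_mono dom K)
    also have "\<dots> = C * (\<Sum>K\<in>\<D>. cmod (F (Sup K) - F (Inf K))) +
      D * (\<Sum>K\<in>\<D>. cmod (G (Sup K) - G (Inf K))) + E * (\<Sum>K\<in>\<D>. Sup K - Inf K)"
      by (simp only: sum.distrib sum_distrib_left)
    also have "\<dots> < e / 3 + e / 3 + e / 3"
      by (intro add_strict_mono *[OF _ 1] *[OF _ 2] *[OF _ 3] sum_nonneg) (use assms(3-5) K(2) in auto)
    finally show ?thesis by simp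
  qed
  moreover have "r > 0" using p q e1 by (simp add: r_def)
  ultimately show "\<exists>\<eta>>0. \<forall>\<D>. \<D> division_of \<Union>\<D> \<longrightarrow> \<Union>\<D> \<subseteq> {a..c} \<longrightarrow>
    (\<Sum>K\<in>\<D>. Sup K - Inf K) < \<eta> \<longrightarrow> (\<Sum>K\<in>\<D>. cmod (H (Sup K) - H (Inf K))) < e"
    by (intro exI[of _ r] conjI allI impI) (simp_all only:)
qed

lemma AC_on_const: "AC_on a c (\<lambda>_. k)"
  by (rule AC_onI) (simp add: exI[of _ 1])

lemma AC_on_lipschitz:
  assumes "E \<ge> 0" "\<And>s t. a \<le> s \<Longrightarrow> s \<le> t \<Longrightarrow> t \<le> c \<Longrightarrow> cmod (H t - H s) \<le> E * (t - s)"
  shows "AC_on a c H"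
  by (rule AC_on_dominated[OF AC_on_const AC_on_const, of 0 0 E]) (use assms in auto)

lemma AC_on_subset:
  assumes "AC_on a c F" "a \<le> a'" "c' \<le> c"
  shows "AC_on a' c' F"
proof (rule AC_onI)
  fix e :: real assume e: "e > 0"
  obtain p where p: "p > 0" "\<forall>\<D>. \<D> division_of \<Union>\<D> \<and> \<Union>\<D> \<subseteq> {a..c} \<and>
        (\<Sum>K\<in>\<D>. Sup K - Inf K) < p \<longrightarrow> (\<Sum>K\<in>\<D>. cmod (F (Sup K) - F (Inf K))) < e"
    using AC_onD[OF assms(1) e] by (elim exE conjE)
  have "{a'..c'} \<subseteq> {a..c}" using assms by auto
  then show "\<exists>\<eta>>0. \<forall>\<D>. \<D> division_of \<Union>\<D> \<longrightarrow> \<Union>\<D> \<subseteq> {a'..c'} \<longrightarrow>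
    (\<Sum>K\<in>\<D>. Sup K - Inf K) < \<eta> \<longrightarrow> (\<Sum>K\<in>\<D>. cmod (F (Sup K) - F (Inf K))) < e"
    using p(2) by (intro exI[of _ p] conjI p(1) allI impI) (rule p(2)[THEN spec, THEN mp], intro conjI, auto)
qed

lemma AC_on_imp_continuous_on:
  assumes "AC_on a c F"
  shows "continuous_on {a..c} F"
proof -
  have *: "\<exists>\<delta>>0. \<forall>s t. a \<le> s \<longrightarrow> s \<le> t \<longrightarrow> t \<le> c \<longrightarrow> t - s < \<delta> \<longrightarrow> cmod (F t - F s) < e" if e: "e > 0" for e
  proof -
    obtain p where p: "p > 0" "\<forall>\<D>. \<D> division_of \<Union>\<D> \<and> \<Union>\<D> \<subseteq> {a..c} \<and>
        (\<Sum>K\<in>\<D>. Sup K - Inf K) < p \<longrightarrow> (\<Sum>K\<in>\<D>. cmod (F (Sup K) - F (Inf K))) < e"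
      using AC_onD[OF assms e] by (elim exE conjE)
    have "cmod (F t - F s) < e" if "a \<le> s" "s \<le> t" "t \<le> c" "t - s < p" for s t
    proof -
      have "{{s..t}} division_of \<Union>{{s..t}}"
        using division_of_self[of s t] that by (simp add: box_real)
      moreover have "\<Union>{{s..t}} \<subseteq> {a..c}" using that by auto
      ultimately have "(\<Sum>K\<in>{{s..t}}. cmod (F (Sup K) - F (Inf K))) < e"
        using p(2)[THEN spec[of _ "{{s..t}}"]] that by (simp del: Union_insert)
      then show ?thesis using that by simp
    qed
    then show ?thesis using p(1) by (intro exI[of _ p] conjI allI impI)
  qed
  show ?thesis unfolding continuous_on_iff
  proof (intro ballI allI impI)
    fix x e :: real assume x: "x \<in> {a..c}" and e: "0 < e"
    obtain \<delta> where d: "\<delta> > 0" "\<forall>s t. a \<le> s \<longrightarrow> s \<le> t \<longrightarrow> t \<le> c \<longrightarrow> t - s < \<delta> \<longrightarrow> cmod (F t - F s) < e"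
      using *[OF e] by (elim exE conjE)
    have "dist (F y) (F x) < e" if "y \<in> {a..c}" "dist y x < \<delta>" for y
      using d(2)[rule_format, of x y] d(2)[rule_format, of y x] x that
      by (cases "x \<le> y") (auto simp: dist_norm norm_minus_commute)
    then show "\<exists>d>0. \<forall>x'\<in>{a..c}. dist x' x < d \<longrightarrow> dist (F x') (F x) < e" using d(1) by (intro exI[of _ \<delta>]) simp
  qed
qed

lemma AC_on_bounded:
  assumes "AC_on a c F"
  obtains B where "B \<ge> 0" "\<And>t. t \<in> {a..c} \<Longrightarrow> cmod (F t) \<le> B"
proof -
  have "bounded (F ` {a..c})"
    by (intro compact_imp_bounded compact_continuous_image AC_on_imp_continuous_on assms) simp
  then obtain B where "\<forall>x\<in>F ` {a..c}. norm x \<le> B" unfolding bounded_iff by blast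
  then show thesis by (intro that[of "max B 0"]) (auto intro: max.coboundedI1)
qed

lemma AC_on_add:
  assumes "AC_on a c F" "AC_on a c G"
  shows "AC_on a c (\<lambda>t. F t + G t)"
proof (rule AC_on_dominated[OF assms, of 1 1 0])
  fix s t
  have "F t + G t - (F s + G s) = (F t - F s) + (G t - G s)" by simp
  then show "cmod (F t + G t - (F s + G s)) \<le> 1 * cmod (F t - F s) + 1 * cmod (G t - G s) + 0 * (t - s)"
    using norm_triangle_ineq[of "F t - F s" "G t - G s"] by (simp only:)
qed auto

lemma AC_on_mult:
  assumes F: "AC_on a c F" and G: "AC_on a c G"
  shows "AC_on a c (\<lambda>t. F t * G t)"
proof -
  obtain B where B: "B \<ge> 0" "\<And>t. t \<in> {a..c} \<Longrightarrow> cmod (F t) \<le> B" using AC_on_bounded[OF F] by blast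
  obtain C where C: "C \<ge> 0" "\<And>t. t \<in> {a..c} \<Longrightarrow> cmod (G t) \<le> C" using AC_on_bounded[OF G] by blast
  show ?thesis
  proof (rule AC_on_dominated[OF F G C(1) B(1), of 0])
    fix s t assume "a \<le> s" "s \<le> t" "t \<le> c"
    then have st: "s \<in> {a..c}" "t \<in> {a..c}" by auto
    have "F t * G t - F s * G s = (F t - F s) * G t + F s * (G t - G s)" by (simp add: algebra_simps)
    then have "cmod (F t * G t - F s * G s) \<le> cmod (F t - F s) * cmod (G t) + cmod (F s) * cmod (G t - G s)"
      by (metis norm_triangle_ineq norm_mult)
    also have "\<dots> \<le> cmod (F t - F s) * C + B * cmod (G t - G s)"
      using B(2)[OF st(1)] C(2)[OF st(2)] by (intro add_mono mult_left_mono mult_right_mono) auto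
    finally show "cmod (F t * G t - F s * G s) \<le> C * cmod (F t - F s) + B * cmod (G t - G s) + 0 * (t - s)"
      by (simp add: mult.commute)
  qed simp
qed

lemma AC_on_cnj: "AC_on a c F \<Longrightarrow> AC_on a c (\<lambda>t. cnj (F t))"
  by (rule AC_on_dominated[of a c F F 1 0 0])
    (auto simp: complex_cnj_diff[symmetric] simp del: complex_cnj_diff)

lemma AC_on_cong:
  assumes "AC_on a c F" "\<And>t. t \<in> {a..c} \<Longrightarrow> G t = F t"
  shows "AC_on a c G"
  by (rule AC_on_dominated[OF assms(1) assms(1), of 1 0 0]) (use assms(2) in auto)

lemma AC_on_C1:
  assumes der: "\<And>t. t \<in> {a..c} \<Longrightarrow> (F has_vector_derivative f t) (at t)"
    and cont: "continuous_on {a..c} f"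
  shows "AC_on a c F"
proof -
  have "bounded (f ` {a..c})"
    by (intro compact_imp_bounded compact_continuous_image cont) simp
  then obtain B where "\<forall>x\<in>f ` {a..c}. norm x \<le> B" unfolding bounded_iff by blast
  then have B: "\<And>t. t \<in> {a..c} \<Longrightarrow> norm (f t) \<le> max B 0" by (auto intro: max.coboundedI1)
  show ?thesis
  proof (rule AC_on_lipschitz[of "max B 0"])
    fix s t assume st: "a \<le> s" "s \<le> t" "t \<le> c"
    have hi: "(f has_integral F t - F s) {s..t}"
      by (rule fundamental_theorem_of_calculus[OF st(2)])
        (use st in \<open>auto intro!: has_vector_derivative_at_within der\<close>)
    have "norm (F t - F s) \<le> max B 0 * measure lborel (cbox s t)"
      by (rule has_integral_bound[of _ f]) (use hi B st in auto)
    then show "cmod (F t - F s) \<le> max B 0 * (t - s)" using st by simp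
  qed simp
qed

section \<open>Square-integrable functions and their primitives\<close>

lemma L2_measurable: "f \<in> L2 M \<Longrightarrow> f \<in> borel_measurable M"
  by (simp add: L2_def)

lemma L2_integrable_square: "f \<in> L2 M \<Longrightarrow> integrable M (\<lambda>x. (cmod (f x))\<^sup>2)"
  by (simp add: L2_def)

lemma L2I_bound:
  assumes "f \<in> borel_measurable M" "integrable M g" "\<And>x. x \<in> space M \<Longrightarrow> (cmod (f x))\<^sup>2 \<le> g x"
  shows "f \<in> L2 M"
  unfolding L2_def mem_Collect_eq
proof (intro conjI assms(1))
  show "integrable M (\<lambda>x. (cmod (f x))\<^sup>2)"
  proof (rule Bochner_Integration.integrable_bound[OF assms(2)])
    show "(\<lambda>x. (cmod (f x))\<^sup>2) \<in> borel_measurable M" using assms(1) by measurable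
    show "AE x in M. norm ((cmod (f x))\<^sup>2) \<le> norm (g x)"
    proof (rule AE_I2)
      fix x assume "x \<in> space M"
      from assms(3)[OF this] show "norm ((cmod (f x))\<^sup>2) \<le> norm (g x)" by simp
    qed
  qed
qed

lemma cmod_add_square_le: "(cmod (x + y))\<^sup>2 \<le> 2 * (cmod x)\<^sup>2 + 2 * (cmod y)\<^sup>2"
proof -
  have "(cmod (x + y))\<^sup>2 \<le> (cmod x + cmod y)\<^sup>2" by (intro power_mono norm_triangle_ineq) auto
  also have "\<dots> \<le> 2 * (cmod x)\<^sup>2 + 2 * (cmod y)\<^sup>2"
    using sum_squares_bound[of "cmod x" "cmod y"] by (simp add: power2_sum)
  finally show ?thesis .
qed

lemma L2_add:
  assumes "f \<in> L2 M" "g \<in> L2 M"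
  shows "(\<lambda>x. f x + g x) \<in> L2 M"
proof (rule L2I_bound)
  show "(\<lambda>x. f x + g x) \<in> borel_measurable M" using assms[THEN L2_measurable] by measurable
  show "integrable M (\<lambda>x. 2 * (cmod (f x))\<^sup>2 + 2 * (cmod (g x))\<^sup>2)"
    using assms[THEN L2_integrable_square] by simp
  show "(cmod (f x + g x))\<^sup>2 \<le> 2 * (cmod (f x))\<^sup>2 + 2 * (cmod (g x))\<^sup>2" for x
    by (rule cmod_add_square_le)
qed

lemma L2_mult_bounded:
  assumes "f \<in> L2 M" and m: "\<phi> \<in> borel_measurable M" and b: "\<And>x. x \<in> space M \<Longrightarrow> cmod (\<phi> x) \<le> C"
  shows "(\<lambda>x. \<phi> x * f x) \<in> L2 M"
proof (rule L2I_bound)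
  show "(\<lambda>x. \<phi> x * f x) \<in> borel_measurable M" using L2_measurable[OF assms(1)] m by measurable
  show "integrable M (\<lambda>x. C\<^sup>2 * (cmod (f x))\<^sup>2)" using L2_integrable_square[OF assms(1)] by simp
  show "(cmod (\<phi> x * f x))\<^sup>2 \<le> C\<^sup>2 * (cmod (f x))\<^sup>2" if "x \<in> space M" for x
    using b[OF that] by (simp add: norm_mult power_mult_distrib mult_right_mono power_mono)
qed

lemma L2_cmult: "f \<in> L2 M \<Longrightarrow> (\<lambda>x. k * f x) \<in> L2 M"
  by (rule L2_mult_bounded[of _ _ _ "cmod k"]) auto

lemma L2_uminus: "f \<in> L2 M \<Longrightarrow> (\<lambda>x. - f x) \<in> L2 M"
  using L2_cmult[of f M "-1"] by simp

lemma L2_diff: "f \<in> L2 M \<Longrightarrow> g \<in> L2 M \<Longrightarrow> (\<lambda>x. f x - g x) \<in> L2 M"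
  using L2_add[of f M "\<lambda>x. - g x"] L2_uminus[of g M] by simp

lemma L2_cnj: "f \<in> L2 M \<Longrightarrow> (\<lambda>x. cnj (f x)) \<in> L2 M"
  unfolding L2_def by (auto intro: borel_measurable_continuous_onI[THEN measurable_compose[rotated]] continuous_intros)

lemma L2_mult_integrable:
  assumes "f \<in> L2 M" "g \<in> L2 M"
  shows "integrable M (\<lambda>x. f x * g x)"
proof (rule Bochner_Integration.integrable_bound)
  show "integrable M (\<lambda>x. (cmod (f x))\<^sup>2 + (cmod (g x))\<^sup>2)"
    using assms[THEN L2_integrable_square] by simp
  show "(\<lambda>x. f x * g x) \<in> borel_measurable M" using assms[THEN L2_measurable] by measurable
  show "AE x in M. norm (f x * g x) \<le> norm ((cmod (f x))\<^sup>2 + (cmod (g x))\<^sup>2)"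
  proof (rule AE_I2)
    fix x
    have "2 * (cmod (f x) * cmod (g x)) \<le> (cmod (f x))\<^sup>2 + (cmod (g x))\<^sup>2"
      using sum_squares_bound[of "cmod (f x)" "cmod (g x)"] by simp
    moreover have "0 \<le> cmod (f x) * cmod (g x)" by simp
    ultimately show "norm (f x * g x) \<le> norm ((cmod (f x))\<^sup>2 + (cmod (g x))\<^sup>2)"
      unfolding norm_mult real_norm_def by linarith
  qed
qed

lemma L2_inner_integrable:
  "f \<in> L2 M \<Longrightarrow> g \<in> L2 M \<Longrightarrow> integrable M (\<lambda>x. f x * cnj (g x))"
  by (intro L2_mult_integrable L2_cnj)

lemma L2_lebesgue_on_subset:
  assumes f: "f \<in> L2 (lebesgue_on S)" and "T \<subseteq> S" "S \<in> sets lebesgue" "T \<in> sets lebesgue"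
  shows "f \<in> L2 (lebesgue_on T)"
proof (rule L2I_bound)
  show "f \<in> borel_measurable (lebesgue_on T)"
    using measurable_restrict_mono[OF L2_measurable[OF f] \<open>T \<subseteq> S\<close>] .
  have "set_integrable lebesgue S (\<lambda>x. (cmod (f x))\<^sup>2)"
    using L2_integrable_square[OF f] assms by (simp add: integrable_restrict_space set_integrable_def)
  then have "set_integrable lebesgue T (\<lambda>x. (cmod (f x))\<^sup>2)"
    by (rule set_integrable_subset) (use assms in auto)
  then show "integrable (lebesgue_on T) (\<lambda>x. (cmod (f x))\<^sup>2)"
    using assms by (simp add: integrable_restrict_space set_integrable_def)
qed simp

lemma L2_cong_space:
  assumes "f \<in> L2 M" "\<And>x. x \<in> space M \<Longrightarrow> g x = f x"
  shows "g \<in> L2 M"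
  using assms unfolding L2_def mem_Collect_eq
  by (metis (no_types, lifting) Bochner_Integration.integrable_cong measurable_cong)

lemma L2_continuous:
  fixes a c :: real
  assumes "continuous_on {a..c} f"
  shows "f \<in> L2 (lebesgue_on {a<..<c})"
proof -
  have "bounded (f ` {a..c})"
    by (intro compact_imp_bounded compact_continuous_image assms) simp
  then obtain B where "\<forall>x\<in>f ` {a..c}. norm x \<le> B" unfolding bounded_iff by blast
  then have B: "\<And>t. t \<in> {a..c} \<Longrightarrow> norm (f t) \<le> B" by auto
  show ?thesis
  proof (rule L2I_bound)
    show "f \<in> borel_measurable (lebesgue_on {a<..<c})"
      by (intro continuous_imp_measurable_on_sets_lebesgue continuous_on_subset[OF assms]) auto
    show "integrable (lebesgue_on {a<..<c}) (\<lambda>_. B\<^sup>2)"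
      by (rule finite_measure.integrable_const) (simp add: finite_measure_lebesgue_on)
    show "(cmod (f x))\<^sup>2 \<le> B\<^sup>2" if "x \<in> space (lebesgue_on {a<..<c})" for x
      using B[of x] that by (intro power_mono) auto
  qed
qed

lemma integrable_lebesgue_on_open_interval:
  fixes f :: "real \<Rightarrow> 'b::euclidean_space"
  assumes "integrable (lebesgue_on {a<..<c}) f"
  shows "f absolutely_integrable_on {a..c}" "integral\<^sup>L (lebesgue_on {a<..<c}) f = integral {a..c} f"
proof -
  have "f absolutely_integrable_on {a<..<c}"
    using assms by (simp add: integrable_restrict_space set_integrable_def)
  then show "f absolutely_integrable_on {a..c}"
    by (rule absolutely_integrable_spike_set) (auto intro: negligible_subset[of "{a,c}"])
  show "integral\<^sup>L (lebesgue_on {a<..<c}) f = integral {a..c} f"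
    using lebesgue_integral_eq_integral[OF assms] integral_open_interval_real[of a c f] by simp
qed

lemma L2_absolutely_integrable:
  fixes a c :: real
  assumes "f \<in> L2 (lebesgue_on {a<..<c})"
  shows "f absolutely_integrable_on {a..c}" "(\<lambda>t. (cmod (f t))\<^sup>2) absolutely_integrable_on {a..c}"
  using integrable_lebesgue_on_open_interval(1)[OF L2_mult_integrable[OF assms L2_continuous[of a c "\<lambda>_. 1"]]]
    integrable_lebesgue_on_open_interval(1)[OF L2_integrable_square[OF assms]] by auto

text \<open>By Young's inequality \<open>cmod (h t) \<le> 1 / (2 * \<rho>) + \<rho> / 2 * (cmod (h
  t))\<^sup>2\<close>, the increments over a family of intervals sum to at most their total length
  over \<open>2 * \<rho>\<close> plus \<open>\<rho> / 2 * J\<close>. The choice of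
  \<open>\<rho>\<close> makes the second term at most \<open>e / 2\<close>, and the threshold
  \<open>e * \<rho>\<close> on the length makes the first one smaller than
  \<open>e / 2\<close>.\<close>

lemma AC_on_integral:
  assumes "h \<in> L2 (lebesgue_on {a<..<c})"
  shows "AC_on a c (\<lambda>t. integral {a..t} h)"
proof (rule AC_onI)
  fix e :: real assume e: "e > 0"
  note h = L2_absolutely_integrable[OF assms]
  have hi: "h integrable_on {a..c}" "(\<lambda>t. (cmod (h t))\<^sup>2) integrable_on {a..c}"
    using h set_lebesgue_integral_eq_integral(1) by blast+
  define J where "J = integral {a..c} (\<lambda>t. (cmod (h t))\<^sup>2)"
  have J: "J \<ge> 0" unfolding J_def by (rule integral_nonneg[OF hi(2)]) simp
  define \<rho> where "\<rho> = e / (J + 1)"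
  have \<rho>: "\<rho> > 0" "\<rho> * J \<le> e" using e J by (auto simp: \<rho>_def field_simps)
  have "(\<Sum>K\<in>\<D>. cmod (integral {a..Sup K} h - integral {a..Inf K} h)) < e"
    if D: "\<D> division_of \<Union>\<D>" and sub: "\<Union>\<D> \<subseteq> {a..c}" and small: "(\<Sum>K\<in>\<D>. Sup K - Inf K) < e * \<rho>" for \<D>
  proof -
    note K = division_Sup_Inf[OF D sub]
    have le: "cmod (integral {a..Sup K} h - integral {a..Inf K} h) \<le>
        (Sup K - Inf K) / (2 * \<rho>) + \<rho> / 2 * integral K (\<lambda>t. (cmod (h t))\<^sup>2)" if "K \<in> \<D>" for K
    proof -
      have sq: "(\<lambda>t. (cmod (h t))\<^sup>2) integrable_on {Inf K..Sup K}"
        by (rule integrable_subinterval_real[OF hi(2)]) (use K(3,4)[OF that] in auto)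
      have hk: "h integrable_on {Inf K..Sup K}"
        by (rule integrable_subinterval_real[OF hi(1)]) (use K(3,4)[OF that] in auto)
      have "integral {a..Inf K} h + integral {Inf K..Sup K} h = integral {a..Sup K} h"
        by (rule Henstock_Kurzweil_Integration.integral_combine) (use K(2-4)[OF that] integrable_subinterval_real[OF hi(1)] in auto)
      then have "cmod (integral {a..Sup K} h - integral {a..Inf K} h) = cmod (integral {Inf K..Sup K} h)"
        by (metis add_diff_cancel_left')
      also have "\<dots> \<le> integral {Inf K..Sup K} (\<lambda>t. 1 / (2 * \<rho>) + \<rho> / 2 * (cmod (h t))\<^sup>2)"
      proof (rule integral_norm_bound_integral[OF hk])
        show "(\<lambda>t. 1 / (2 * \<rho>) + \<rho> / 2 * (cmod (h t))\<^sup>2) integrable_on {Inf K..Sup K}"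
          using sq by (intro integrable_add integrable_const_ivl integrable_on_mult_right) auto
        show "norm (h t) \<le> 1 / (2 * \<rho>) + \<rho> / 2 * (cmod (h t))\<^sup>2" for t
        proof -
          have "0 \<le> (1 - \<rho> * cmod (h t))\<^sup>2 / (2 * \<rho>)" using \<rho> by simp
          also have "\<dots> = 1 / (2 * \<rho>) + \<rho> / 2 * (cmod (h t))\<^sup>2 - cmod (h t)"
            using \<rho> by (simp add: power2_eq_square field_simps)
          finally show ?thesis by simp
        qed
      qed
      also have "\<dots> = (Sup K - Inf K) / (2 * \<rho>) + \<rho> / 2 * integral {Inf K..Sup K} (\<lambda>t. (cmod (h t))\<^sup>2)"
        using sq K(2)[OF that] by (subst integral_add) (auto intro: integrable_on_mult_right)
      finally show ?thesis using K(1)[OF that] by simp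
    qed
    have U: "(\<lambda>t. (cmod (h t))\<^sup>2) integrable_on \<Union>\<D>"
      using integrable_on_subdivision[OF D hi(2) sub] .
    have "(\<Sum>K\<in>\<D>. integral K (\<lambda>t. (cmod (h t))\<^sup>2)) = integral (\<Union>\<D>) (\<lambda>t. (cmod (h t))\<^sup>2)"
      using integral_combine_division_topdown[OF U D] by simp
    also have "\<dots> \<le> J" unfolding J_def
      by (rule integral_subset_le[OF sub U hi(2)]) simp
    finally have s: "(\<Sum>K\<in>\<D>. integral K (\<lambda>t. (cmod (h t))\<^sup>2)) \<le> J" .
    have "(\<Sum>K\<in>\<D>. cmod (integral {a..Sup K} h - integral {a..Inf K} h)) \<le>
      (\<Sum>K\<in>\<D>. (Sup K - Inf K) / (2 * \<rho>) + \<rho> / 2 * integral K (\<lambda>t. (cmod (h t))\<^sup>2))"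
      by (rule sum_mono) (rule le)
    also have "\<dots> = (\<Sum>K\<in>\<D>. Sup K - Inf K) / (2 * \<rho>) + \<rho> / 2 * (\<Sum>K\<in>\<D>. integral K (\<lambda>t. (cmod (h t))\<^sup>2))"
      by (simp only: sum.distrib sum_distrib_left sum_divide_distrib)
    also have "\<dots> < e * \<rho> / (2 * \<rho>) + \<rho> / 2 * J"
      using s small \<rho> by (intro add_less_le_mono mult_left_mono divide_strict_right_mono) auto
    also have "\<dots> \<le> e" using \<rho> by simp
    finally show ?thesis .
  qed
  moreover have "e * \<rho> > 0" using e \<rho> by simp
  ultimately show "\<exists>\<eta>>0. \<forall>\<D>. \<D> division_of \<Union>\<D> \<longrightarrow> \<Union>\<D> \<subseteq> {a..c} \<longrightarrow>
    (\<Sum>K\<in>\<D>. Sup K - Inf K) < \<eta> \<longrightarrow> (\<Sum>K\<in>\<D>. cmod (integral {a..Sup K} h - integral {a..Inf K} h)) < e"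
    by (intro exI[of _ "e * \<rho>"] conjI allI impI) (simp_all only:)
qed

text \<open>Lebesgue differentiation in the form \<open>integrable_ccontinuous_explicit\<close>
  concerns averages over intervals that start at the point. Averages to the left are obtained by
  applying it to the reflected function and reflecting the exceptional set back. Extension by 0
  provides integrability on every interval.\<close>

lemma integral_ae_derivative:
  fixes h :: "real \<Rightarrow> complex"
  assumes h: "h integrable_on {a..c}"
  obtains N where "negligible N"
    "\<And>t. t \<in> {a<..<c} - N \<Longrightarrow> ((\<lambda>t. integral {a..t} h) has_vector_derivative h t) (at t)"
proof -
  define f where "f t = (if t \<in> {a..c} then h t else 0)" for t
  have fU: "f integrable_on UNIV"
    unfolding f_def using h by (simp only: integrable_restrict_UNIV)
  have f: "f integrable_on cbox u v" for u v
    by (rule integrable_on_subcbox[OF fU]) simp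
  have f': "(\<lambda>t. f (- t)) integrable_on cbox u v" for u v
    using Henstock_Kurzweil_Integration.integrable_reflect_real[where f = f and a = "-v" and b = "-u"] f[of "-v" "-u"] by (simp add: box_real)
  obtain N1 where N1: "negligible N1" "\<And>x e. \<lbrakk>x \<notin> N1; 0 < e\<rbrakk> \<Longrightarrow>
     \<exists>d>0. \<forall>k. 0 < k \<and> k < d \<longrightarrow> norm (integral (cbox x (x + k *\<^sub>R One)) f /\<^sub>R k ^ DIM(real) - f x) < e"
    using integrable_ccontinuous_explicit[of f] f by metis
  obtain N2 where N2: "negligible N2" "\<And>x e. \<lbrakk>x \<notin> N2; 0 < e\<rbrakk> \<Longrightarrow>
     \<exists>d>0. \<forall>k. 0 < k \<and> k < d \<longrightarrow> norm (integral (cbox x (x + k *\<^sub>R One)) (\<lambda>t. f (- t)) /\<^sub>R k ^ DIM(real) - f (- x)) < e"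
    using integrable_ccontinuous_explicit[of "\<lambda>t. f (- t)"] f' by metis
  define N where "N = N1 \<union> uminus ` N2"
  have "negligible (uminus ` N2)"
    by (rule negligible_differentiable_image_negligible) (auto simp: N2 intro!: derivative_intros)
  then have "negligible N" using N1 by (simp add: N_def)
  moreover have "((\<lambda>t. integral {a..t} h) has_vector_derivative h t) (at t)" if t: "t \<in> {a<..<c} - N" for t
    unfolding has_vector_derivative_def has_derivative_within_alt
  proof (intro conjI allI impI bounded_linear_scaleR_left)
    fix e :: real assume e: "e > 0"
    have "t \<notin> N1" "- t \<notin> N2" using t by (auto simp: N_def image_iff)
    obtain d1 where d1: "d1 > 0" "\<And>k. 0 < k \<Longrightarrow> k < d1 \<Longrightarrow> norm (integral {t..t + k} f /\<^sub>R k - f t) < e"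
      using N1(2)[OF \<open>t \<notin> N1\<close> e] by (auto simp: box_real)
    obtain d2 where d2: "d2 > 0" "\<And>k. 0 < k \<Longrightarrow> k < d2 \<Longrightarrow> norm (integral {-t..-t + k} (\<lambda>t. f (- t)) /\<^sub>R k - f t) < e"
      using N2(2)[OF \<open>- t \<notin> N2\<close> e] by (auto simp: box_real)
    have d2': "norm (integral {t - k..t} f /\<^sub>R k - f t) < e" if "0 < k" "k < d2" for k
      using d2(2)[OF that] Henstock_Kurzweil_Integration.integral_reflect_real[where f = f and a = "t - k" and b = t] by simp
    define d where "d = min (min d1 d2) (min (t - a) (c - t))"
    have "d > 0" using d1 d2 t by (auto simp: d_def)
    have ft: "f t = h t" using t by (simp add: f_def)
    have feq: "integral {u..v} f = integral {u..v} h" if "a \<le> u" "v \<le> c" for u v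
      by (rule integral_cong) (use that in \<open>auto simp: f_def\<close>)
    have scale: "norm (z - k *\<^sub>R w) \<le> e * k" if "norm (z /\<^sub>R k - w) < e" "k > 0" for z w :: complex and k
    proof -
      have "z - k *\<^sub>R w = k *\<^sub>R (z /\<^sub>R k - w)" using that by (simp add: scaleR_diff_right)
      then have "norm (z - k *\<^sub>R w) = k * norm (z /\<^sub>R k - w)" using that by (metis norm_scaleR abs_of_pos)
      then show ?thesis using that by (simp add: mult.commute)
    qed
    have "norm (integral {a..y} h - integral {a..t} h - (y - t) *\<^sub>R h t) \<le> e * norm (y - t)" if y: "norm (y - t) < d" for y
    proof (cases y t rule: linorder_cases)
      case equal then show ?thesis by simp
    next
      case greater
      have "integral {a..t} h + integral {t..y} h = integral {a..y} h"
        by (rule Henstock_Kurzweil_Integration.integral_combine) (use t y greater integrable_subinterval_real[OF h] in \<open>auto simp: d_def\<close>)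
      moreover have "norm (integral {t..t + (y - t)} f /\<^sub>R (y - t) - f t) < e"
        by (rule d1(2)) (use greater y in \<open>auto simp: d_def\<close>)
      then have "norm (integral {t..y} h - (y - t) *\<^sub>R h t) \<le> e * (y - t)"
        using scale[where z = "integral {t..y} f" and k = "y - t" and w = "h t"] greater ft feq[of t y] t y by (auto simp: d_def)
      moreover have "integral {a..y} h - integral {a..t} h - (y - t) *\<^sub>R h t = integral {t..y} h - (y - t) *\<^sub>R h t"
        using calculation(1) by (simp add: algebra_simps)
      ultimately show ?thesis using greater by simp
    next
      case less
      have "integral {a..y} h + integral {y..t} h = integral {a..t} h"
        by (rule Henstock_Kurzweil_Integration.integral_combine) (use t y less integrable_subinterval_real[OF h] in \<open>auto simp: d_def\<close>)
      moreover have "norm (integral {t - (t - y)..t} f /\<^sub>R (t - y) - f t) < e"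
        by (rule d2') (use less y in \<open>auto simp: d_def\<close>)
      then have "norm (integral {y..t} h - (t - y) *\<^sub>R h t) \<le> e * (t - y)"
        using scale[where z = "integral {y..t} f" and k = "t - y" and w = "h t"] less ft feq[of y t] t y by (auto simp: d_def)
      moreover have "integral {a..y} h - integral {a..t} h - (y - t) *\<^sub>R h t = - (integral {y..t} h - (t - y) *\<^sub>R h t)"
        using calculation(1) by (simp add: algebra_simps)
      ultimately show ?thesis using less by (simp only: norm_minus_cancel) simp
    qed
    then show "\<exists>d>0. \<forall>y\<in>UNIV. norm (y - t) < d \<longrightarrow>
        norm (integral {a..y} h - integral {a..t} h - (y - t) *\<^sub>R h t) \<le> e * norm (y - t)"
      using \<open>d > 0\<close> by blast
  qed
  ultimately show thesis using that by blast
qed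

text \<open>Local absolute continuity in the open interval says nothing at the ends, so the
  fundamental theorem is applied between interior points, with the midpoint as base. Since
  \<open>g\<close> is integrable up to the ends, this representation forces \<open>F\<close> to have
  limits there.\<close>

lemma AC_loc_eq_integral:
  fixes F g :: "real \<Rightarrow> complex"
  assumes "a < c" and AC: "AC_loc {a<..<c} F" and N: "negligible N"
    and der: "\<And>t. t \<in> {a<..<c} - N \<Longrightarrow> (F has_vector_derivative g t) (at t)"
    and g: "g integrable_on {a..c}"
  obtains K where "\<And>t. t \<in> {a<..<c} \<Longrightarrow> F t = K + integral {a..t} g"
proof -
  have *: "F t - F s = integral {a..t} g - integral {a..s} g" if "a < s" "s \<le> t" "t < c" for s t
  proof -
    have "(g has_integral F t - F s) {s..t}"
      by (rule has_integral_AC_derivative[OF \<open>s \<le> t\<close> _ N der])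
        (use that in \<open>auto intro!: AC[unfolded AC_loc_def, rule_format]\<close>)
    moreover have "integral {a..s} g + integral {s..t} g = integral {a..t} g"
      by (rule Henstock_Kurzweil_Integration.integral_combine) (use that integrable_subinterval_real[OF g] in auto)
    ultimately show ?thesis by (metis add_diff_cancel_left' integral_unique)
  qed
  define m where "m = (a + c) / 2"
  have m: "a < m" "m < c" using \<open>a < c\<close> by (auto simp: m_def)
  show thesis
  proof (rule that[of "F m - integral {a..m} g"])
    fix t assume "t \<in> {a<..<c}"
    then show "F t = F m - integral {a..m} g + integral {a..t} g"
      using *[of t m] *[of m t] m by (cases "t \<le> m") (auto simp: algebra_simps)
  qed
qed

lemma tendsto_integral_ends:
  fixes F g :: "real \<Rightarrow> complex"
  assumes "a < c" and g: "g integrable_on {a..c}" and F: "\<And>t. t \<in> {a<..<c} \<Longrightarrow> F t = K + integral {a..t} g"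
  shows "(F \<longlongrightarrow> K) (at_right a)" "(F \<longlongrightarrow> K + integral {a..c} g) (at_left c)"
proof -
  have cont: "continuous_on {a..c} (\<lambda>t. K + integral {a..t} g)"
    by (intro continuous_intros indefinite_integral_continuous_1 g)
  have "((\<lambda>t. K + integral {a..t} g) \<longlongrightarrow> K + integral {a..a} g) (at_right a)"
    using continuous_on_Icc_at_rightD[OF cont \<open>a < c\<close>] .
  moreover have "\<forall>\<^sub>F t in at_right a. K + integral {a..t} g = F t"
    using eventually_at_right_real[OF \<open>a < c\<close>] by eventually_elim (simp add: F)
  ultimately show "(F \<longlongrightarrow> K) (at_right a)" by (simp add: tendsto_cong)
  have "((\<lambda>t. K + integral {a..t} g) \<longlongrightarrow> K + integral {a..c} g) (at_left c)"
    using continuous_on_Icc_at_leftD[OF cont \<open>a < c\<close>] .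
  moreover have "\<forall>\<^sub>F t in at_left c. K + integral {a..t} g = F t"
    using eventually_at_left_real[OF \<open>a < c\<close>] by eventually_elim (simp add: F)
  ultimately show "(F \<longlongrightarrow> K + integral {a..c} g) (at_left c)" by (simp add: tendsto_cong)
qed

text \<open>A function on an open gap has no meaningful end point values, so one-sided limits take
  their place. In this form the fundamental theorem serves both Green's formula and the weighted
  derivative bound.\<close>

lemma has_integral_AC_loc_derivative:
  fixes F g :: "real \<Rightarrow> complex"
  assumes "a < c" and AC: "AC_loc {a<..<c} F" and N: "negligible N"
    and der: "\<And>t. t \<in> {a<..<c} - N \<Longrightarrow> (F has_vector_derivative g t) (at t)"
    and g: "g integrable_on {a..c}"
    and lim: "(F \<longlongrightarrow> A) (at_right a)" "(F \<longlongrightarrow> B) (at_left c)"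
  shows "(g has_integral B - A) {a..c}"
proof -
  obtain K where K: "\<And>t. t \<in> {a<..<c} \<Longrightarrow> F t = K + integral {a..t} g"
    using AC_loc_eq_integral[OF assms(1-5)] by blast
  note l = tendsto_integral_ends[OF \<open>a < c\<close> g K]
  have "A = K" using tendsto_unique[OF _ lim(1) l(1)] by simp
  moreover have "B = K + integral {a..c} g" using tendsto_unique[OF _ lim(2) l(2)] by simp
  ultimately show ?thesis using integrable_integral[OF g] by simp
qed

section \<open>Sobolev functions on a single gap\<close>

text \<open>Local absolute continuity of \<open>f\<close> itself is automatic, since \<open>f'\<close> is continuous.\<close>

definition W22_gap :: "real \<Rightarrow> real \<Rightarrow> (real \<Rightarrow> complex) \<Rightarrow> (real \<Rightarrow> complex) \<Rightarrow> (real \<Rightarrow> complex) \<Rightarrow> bool" where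
  "W22_gap a c f f' f'' \<longleftrightarrow> AC_loc {a<..<c} f' \<and>
     (\<forall>t\<in>{a<..<c}. (f has_vector_derivative f' t) (at t)) \<and>
     (\<exists>N. negligible N \<and> (\<forall>t\<in>{a<..<c} - N. (f' has_vector_derivative f'' t) (at t))) \<and>
     f'' \<in> L2 (lebesgue_on {a<..<c})"

lemma AC_locD: "AC_loc S f \<Longrightarrow> {c..d} \<subseteq> S \<Longrightarrow> AC_on c d f"
  by (simp add: AC_loc_def)

lemma AC_loc_mult: "AC_loc S f \<Longrightarrow> AC_loc S g \<Longrightarrow> AC_loc S (\<lambda>t. f t * g t)"
  by (simp add: AC_loc_def AC_on_mult)

lemma AC_loc_add: "AC_loc S f \<Longrightarrow> AC_loc S g \<Longrightarrow> AC_loc S (\<lambda>t. f t + g t)"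
  by (simp add: AC_loc_def AC_on_add)

lemma AC_loc_const: "AC_loc S (\<lambda>_. k)"
  by (simp add: AC_loc_def AC_on_const)

lemma AC_loc_diff: "AC_loc S f \<Longrightarrow> AC_loc S g \<Longrightarrow> AC_loc S (\<lambda>t. f t - g t)"
  using AC_loc_add[OF _ AC_loc_mult[OF AC_loc_const[of S "-1"]], of f g] by simp

lemma AC_loc_cnj: "AC_loc S f \<Longrightarrow> AC_loc S (\<lambda>t. cnj (f t))"
  by (simp add: AC_loc_def AC_on_cnj)

lemma AC_loc_C1:
  assumes "\<And>t. t \<in> S \<Longrightarrow> (F has_vector_derivative f t) (at t)" "continuous_on S f"
  shows "AC_loc S F"
  unfolding AC_loc_def
  by (intro allI impI AC_on_C1[of _ _ F f] assms(1) continuous_on_subset[OF assms(2)]) auto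

lemma AC_loc_imp_continuous_on:
  assumes "AC_loc {a<..<c} f"
  shows "continuous_on {a<..<c} f"
proof (rule continuous_at_imp_continuous_on, rule ballI)
  fix t assume t: "t \<in> {a<..<c}"
  define u where "u = (a + t) / 2"
  define v where "v = (t + c) / 2"
  have uv: "a < u" "u < t" "t < v" "v < c" using t by (auto simp: u_def v_def)
  have "continuous_on {u..v} f"
    by (rule AC_on_imp_continuous_on, rule AC_locD[OF assms]) (use uv in auto)
  then show "isCont f t" using continuous_on_interior[of "{u..v}" f t] uv by simp
qed

lemma W22_gapD:
  assumes "W22_gap a c f f' f''"
  shows "AC_loc {a<..<c} f" "AC_loc {a<..<c} f'"
    "\<And>t. t \<in> {a<..<c} \<Longrightarrow> (f has_vector_derivative f' t) (at t)"
    "f'' \<in> L2 (lebesgue_on {a<..<c})"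
  using assms AC_loc_C1[of "{a<..<c}" f f'] AC_loc_imp_continuous_on[of a c f'] unfolding W22_gap_def by auto

lemma W22_gap_ae:
  assumes "W22_gap a c f f' f''"
  obtains N where "negligible N" "\<And>t. t \<in> {a<..<c} - N \<Longrightarrow> (f' has_vector_derivative f'' t) (at t)"
  using assms unfolding W22_gap_def by blast

lemma W22_gapI:
  assumes "AC_loc {a<..<c} f'" "\<And>t. t \<in> {a<..<c} \<Longrightarrow> (f has_vector_derivative f' t) (at t)"
    "negligible N" "\<And>t. t \<in> {a<..<c} - N \<Longrightarrow> (f' has_vector_derivative f'' t) (at t)"
    "f'' \<in> L2 (lebesgue_on {a<..<c})"
  shows "W22_gap a c f f' f''"
  using assms unfolding W22_gap_def by blast

lemma continuous_on_Icc_tendsto_ends: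
  fixes g f :: "real \<Rightarrow> complex"
  assumes "a < c" "continuous_on {a..c} g" "\<And>t. t \<in> {a<..<c} \<Longrightarrow> f t = g t"
  shows "(f \<longlongrightarrow> g a) (at_right a)" "(f \<longlongrightarrow> g c) (at_left c)"
proof -
  have "\<forall>\<^sub>F t in at_right a. g t = f t"
    using eventually_at_right_real[OF \<open>a < c\<close>] by eventually_elim (simp add: assms)
  then show "(f \<longlongrightarrow> g a) (at_right a)"
    using continuous_on_Icc_at_rightD[OF assms(2,1)] tendsto_cong by blast
  have "\<forall>\<^sub>F t in at_left c. g t = f t"
    using eventually_at_left_real[OF \<open>a < c\<close>] by eventually_elim (simp add: assms)
  then show "(f \<longlongrightarrow> g c) (at_left c)"
    using continuous_on_Icc_at_leftD[OF assms(2,1)] tendsto_cong by blast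
qed

text \<open>A square-integrable \<open>f''\<close> is integrable on the bounded gap, so
  \<open>f'\<close> and then \<open>f\<close> agree with primitives that are continuous up to the
  ends. One-sided limits, boundedness and square-integrability on the gap are read off from these
  extensions.\<close>

lemma W22_gap_extension:
  assumes "a < c" "W22_gap a c f f' f''"
  obtains g g' where "continuous_on {a..c} g" "continuous_on {a..c} g'"
    "\<And>t. t \<in> {a<..<c} \<Longrightarrow> f t = g t" "\<And>t. t \<in> {a<..<c} \<Longrightarrow> f' t = g' t"
    "\<And>t. t \<in> {a..c} \<Longrightarrow> g t = g a + integral {a..t} g'"
    "\<And>t. t \<in> {a..c} \<Longrightarrow> g' t = g' a + integral {a..t} f''"
proof -
  note D = W22_gapD[OF assms(2)]
  obtain N where N: "negligible N" "\<And>t. t \<in> {a<..<c} - N \<Longrightarrow> (f' has_vector_derivative f'' t) (at t)"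
    using W22_gap_ae[OF assms(2)] by blast
  have i: "f'' integrable_on {a..c}"
    using L2_absolutely_integrable(1)[OF D(4)] set_lebesgue_integral_eq_integral(1) by blast
  obtain K' where K': "\<And>t. t \<in> {a<..<c} \<Longrightarrow> f' t = K' + integral {a..t} f''"
    using AC_loc_eq_integral[OF assms(1) D(2) N i] by blast
  define g' where "g' t = K' + integral {a..t} f''" for t
  have g': "continuous_on {a..c} g'"
    unfolding g'_def by (intro continuous_intros indefinite_integral_continuous_1 i)
  then have i': "g' integrable_on {a..c}" by (rule integrable_continuous_real)
  obtain K where K: "\<And>t. t \<in> {a<..<c} \<Longrightarrow> f t = K + integral {a..t} g'"
    using AC_loc_eq_integral[OF assms(1) D(1) negligible_empty _ i', of thesis] D(3) K' unfolding g'_def by auto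
  define g where "g t = K + integral {a..t} g'" for t
  have g: "continuous_on {a..c} g"
    unfolding g_def by (intro continuous_intros indefinite_integral_continuous_1 i')
  show thesis
    by (rule that[OF g g']) (auto simp: g_def K, auto simp: g'_def K')
qed

lemma W22_gap_limits:
  assumes "a < c" "W22_gap a c f f' f''"
  obtains A A' B B' where "(f \<longlongrightarrow> A) (at_right a)" "(f' \<longlongrightarrow> A') (at_right a)"
    "(f \<longlongrightarrow> B) (at_left c)" "(f' \<longlongrightarrow> B') (at_left c)"
proof -
  obtain g g' where *: "continuous_on {a..c} g" "continuous_on {a..c} g'"
    "\<And>t. t \<in> {a<..<c} \<Longrightarrow> f t = g t" "\<And>t. t \<in> {a<..<c} \<Longrightarrow> f' t = g' t"
    using W22_gap_extension[OF assms] by metis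
  from continuous_on_Icc_tendsto_ends[OF \<open>a < c\<close> *(1,3)] continuous_on_Icc_tendsto_ends[OF \<open>a < c\<close> *(2,4)]
  show thesis using that by blast
qed

lemma W22_gap_bounded:
  assumes "a < c" "W22_gap a c f f' f''"
  obtains C where "\<And>t. t \<in> {a<..<c} \<Longrightarrow> cmod (f t) \<le> C" "\<And>t. t \<in> {a<..<c} \<Longrightarrow> cmod (f' t) \<le> C"
proof -
  obtain g g' where *: "continuous_on {a..c} g" "continuous_on {a..c} g'"
    "\<And>t. t \<in> {a<..<c} \<Longrightarrow> f t = g t" "\<And>t. t \<in> {a<..<c} \<Longrightarrow> f' t = g' t"
    using W22_gap_extension[OF assms] by metis
  have "bounded (g ` {a..c} \<union> g' ` {a..c})"
    by (intro compact_imp_bounded compact_Un compact_continuous_image *) auto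
  then obtain B where B: "\<forall>x\<in>g ` {a..c} \<union> g' ` {a..c}. norm x \<le> B" unfolding bounded_iff by blast
  show thesis by (rule that[of B]) (use B *(3,4) in auto)
qed

lemma W22_gap_L2:
  assumes "a < c" "W22_gap a c f f' f''"
  shows "f \<in> L2 (lebesgue_on {a<..<c})" "f' \<in> L2 (lebesgue_on {a<..<c})"
proof -
  obtain g g' where *: "continuous_on {a..c} g" "continuous_on {a..c} g'"
    "\<And>t. t \<in> {a<..<c} \<Longrightarrow> f t = g t" "\<And>t. t \<in> {a<..<c} \<Longrightarrow> f' t = g' t"
    using W22_gap_extension[OF assms] by metis
  show "f \<in> L2 (lebesgue_on {a<..<c})" "f' \<in> L2 (lebesgue_on {a<..<c})"
    by (rule L2_cong_space[OF L2_continuous[OF *(1)]], simp add: *,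
      rule L2_cong_space[OF L2_continuous[OF *(2)]], simp add: *)
qed

lemma W22_gap_cong:
  assumes "W22_gap a c f f' f''" "\<And>t. t \<in> {a<..<c} \<Longrightarrow> g t = f t" "\<And>t. t \<in> {a<..<c} \<Longrightarrow> g' t = f' t"
    "\<And>t. t \<in> {a<..<c} \<Longrightarrow> g'' t = f'' t"
  shows "W22_gap a c g g' g''"
proof -
  note D = W22_gapD[OF assms(1)]
  obtain N where N: "negligible N" "\<And>t. t \<in> {a<..<c} - N \<Longrightarrow> (f' has_vector_derivative f'' t) (at t)"
    using W22_gap_ae[OF assms(1)] by blast
  show ?thesis
  proof (rule W22_gapI)
    show "AC_loc {a<..<c} g'"
      unfolding AC_loc_def
    proof (intro allI impI)
      fix u v assume s: "{u..v} \<subseteq> {a<..<c}"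
      show "AC_on u v g'"
        by (rule AC_on_cong[OF AC_locD[OF D(2) s]]) (use assms(3) s in blast)
    qed
    show "(g has_vector_derivative g' t) (at t)" if "t \<in> {a<..<c}" for t
      using has_vector_derivative_transform_within_open[OF D(3)[OF that] _ that, of g] assms(2,3) that by simp
    show "(g' has_vector_derivative g'' t) (at t)" if "t \<in> {a<..<c} - N" for t
      using has_vector_derivative_transform_within_open[OF N(2)[OF that], of "{a<..<c}" g'] assms(3,4) that by simp
    show "g'' \<in> L2 (lebesgue_on {a<..<c})"
      by (rule L2_cong_space[OF D(4)]) (use assms(4) in simp)
  qed (rule N)
qed

lemma L2_prod_integrable_on:
  fixes a c :: real
  assumes "f \<in> L2 (lebesgue_on {a<..<c})" "g \<in> L2 (lebesgue_on {a<..<c})"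
  shows "(\<lambda>t. f t * g t) integrable_on {a..c}"
  using integrable_lebesgue_on_open_interval(1)[OF L2_mult_integrable[OF assms]]
    set_lebesgue_integral_eq_integral(1) by blast

lemma L2_gap_mult:
  assumes "a < c" "W22_gap a c f f' f''" "g \<in> L2 (lebesgue_on {a<..<c})"
  shows "(\<lambda>t. f t * g t) \<in> L2 (lebesgue_on {a<..<c})" "(\<lambda>t. f' t * g t) \<in> L2 (lebesgue_on {a<..<c})"
proof -
  obtain C where C: "\<And>t. t \<in> {a<..<c} \<Longrightarrow> cmod (f t) \<le> C" "\<And>t. t \<in> {a<..<c} \<Longrightarrow> cmod (f' t) \<le> C"
    using W22_gap_bounded[OF assms(1,2)] by blast
  show "(\<lambda>t. f t * g t) \<in> L2 (lebesgue_on {a<..<c})" "(\<lambda>t. f' t * g t) \<in> L2 (lebesgue_on {a<..<c})"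
    by (rule L2_mult_bounded[OF assms(3) L2_measurable[OF W22_gap_L2(1)[OF assms(1,2)]], of C], simp add: C,
       rule L2_mult_bounded[OF assms(3) L2_measurable[OF W22_gap_L2(2)[OF assms(1,2)]], of C], simp add: C)
qed

lemma W22_gap_mult:
  assumes "a < c" and f: "W22_gap a c f f' f''" and g: "W22_gap a c g g' g''"
  shows "W22_gap a c (\<lambda>t. f t * g t) (\<lambda>t. f t * g' t + f' t * g t)
    (\<lambda>t. f t * g'' t + 2 * (f' t * g' t) + f'' t * g t)"
proof -
  note F = W22_gapD[OF f] and G = W22_gapD[OF g]
  obtain N where N: "negligible N" "\<And>t. t \<in> {a<..<c} - N \<Longrightarrow> (f' has_vector_derivative f'' t) (at t)"
    using W22_gap_ae[OF f] by blast
  obtain M where M: "negligible M" "\<And>t. t \<in> {a<..<c} - M \<Longrightarrow> (g' has_vector_derivative g'' t) (at t)"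
    using W22_gap_ae[OF g] by blast
  show ?thesis
  proof (rule W22_gapI)
    show "AC_loc {a<..<c} (\<lambda>t. f t * g' t + f' t * g t)"
      by (intro AC_loc_add AC_loc_mult F G)
    show "((\<lambda>t. f t * g t) has_vector_derivative f t * g' t + f' t * g t) (at t)" if "t \<in> {a<..<c}" for t
      by (intro has_vector_derivative_mult F G that)
    show "negligible (N \<union> M)" using N M by simp
    show "((\<lambda>t. f t * g' t + f' t * g t) has_vector_derivative
        f t * g'' t + 2 * (f' t * g' t) + f'' t * g t) (at t)" if "t \<in> {a<..<c} - (N \<union> M)" for t
    proof -
      have "((\<lambda>t. f t * g' t + f' t * g t) has_vector_derivative
        (f t * g'' t + f' t * g' t) + (f' t * g' t + f'' t * g t)) (at t)"
        by (intro has_vector_derivative_mult has_vector_derivative_add F G N M) (use that in auto)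
      then show ?thesis by (simp add: algebra_simps)
    qed
    have "(\<lambda>t. g t * f'' t) \<in> L2 (lebesgue_on {a<..<c})" by (rule L2_gap_mult[OF \<open>a < c\<close> g F(4)])
    then show "(\<lambda>t. f t * g'' t + 2 * (f' t * g' t) + f'' t * g t) \<in> L2 (lebesgue_on {a<..<c})"
      by (intro L2_add L2_cmult L2_gap_mult[OF \<open>a < c\<close> f] G W22_gap_L2[OF \<open>a < c\<close> g]) (simp add: mult.commute)
  qed
qed

lemma W22_gap_C2:
  assumes "\<And>t. (p has_vector_derivative p' t) (at t)" "\<And>t. (p' has_vector_derivative p'' t) (at t)"
    "continuous_on UNIV p''"
  shows "W22_gap a c p p' p''"
proof (rule W22_gapI[of _ _ _ _ "{}"])
  show "AC_loc {a<..<c} p'"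
    by (rule AC_loc_C1[of _ _ p'']) (use assms continuous_on_subset in blast)+
  show "p'' \<in> L2 (lebesgue_on {a<..<c})"
    by (rule L2_continuous) (use assms continuous_on_subset in blast)
qed (use assms in auto)

text \<open>Integrating twice solves \<open>g'' = h\<close> with initial data at the left end. It
  supplies both the particular solution and the test function in the regularity argument for weak
  solutions.\<close>

lemma W22_gap_integral:
  fixes A B :: complex
  assumes "a < c" and h: "h \<in> L2 (lebesgue_on {a<..<c})"
  defines "g' \<equiv> \<lambda>t. B + integral {a..t} h"
  defines "g \<equiv> \<lambda>t. A + B * of_real (t - a) + integral {a..t} (\<lambda>s. integral {a..s} h)"
  shows "W22_gap a c g g' h" "(g \<longlongrightarrow> A) (at_right a)" "(g' \<longlongrightarrow> B) (at_right a)"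
proof -
  have i: "h integrable_on {a..c}"
    using L2_absolutely_integrable(1)[OF h] set_lebesgue_integral_eq_integral(1) by blast
  obtain N where N: "negligible N"
    "\<And>t. t \<in> {a<..<c} - N \<Longrightarrow> ((\<lambda>t. integral {a..t} h) has_vector_derivative h t) (at t)"
    using integral_ae_derivative[OF i] by blast
  have cI: "continuous_on {a..c} (\<lambda>t. integral {a..t} h)"
    by (rule indefinite_integral_continuous_1[OF i])
  have cg': "continuous_on {a..c} g'" unfolding g'_def by (intro continuous_intros cI)
  have cg: "continuous_on {a..c} g" unfolding g_def
    by (intro continuous_intros indefinite_integral_continuous_1 integrable_continuous_real cI)
  show "W22_gap a c g g' h"
  proof (rule W22_gapI[OF _ _ N(1)])
    show "AC_loc {a<..<c} g'" unfolding AC_loc_def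
    proof (intro allI impI)
      fix u v assume "{u..v} \<subseteq> {a<..<c}"
      show "AC_on u v g'"
      proof (cases "u \<le> v")
        case True
        then have "u \<in> {u..v}" "v \<in> {u..v}" by auto
        then have "a \<le> u" "v \<le> c" using \<open>{u..v} \<subseteq> {a<..<c}\<close> by fastforce+
        then show ?thesis unfolding g'_def
          by (intro AC_on_add AC_on_const AC_on_subset[OF AC_on_integral[OF h]])
      next
        case False then show ?thesis by (intro AC_on_lipschitz[of 0]) auto
      qed
    qed
    show "(g has_vector_derivative g' t) (at t)" if t: "t \<in> {a<..<c}" for t
    proof -
      have "((\<lambda>t. integral {a..t} (\<lambda>s. integral {a..s} h)) has_vector_derivative integral {a..t} h) (at t within {a..c})"
        by (rule integral_has_vector_derivative[OF cI]) (use t in auto)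
      then have "((\<lambda>t. integral {a..t} (\<lambda>s. integral {a..s} h)) has_vector_derivative integral {a..t} h) (at t)"
        using t by (simp add: at_within_Icc_at)
      moreover have "((\<lambda>t. A + B * of_real (t - a)) has_vector_derivative B) (at t)"
        by (auto intro!: derivative_eq_intros)
      ultimately show ?thesis
        unfolding g_def g'_def by (intro has_vector_derivative_add)
    qed
    show "(g' has_vector_derivative h t) (at t)" if "t \<in> {a<..<c} - N" for t
      using has_vector_derivative_add[OF has_vector_derivative_const N(2)[OF that], of B] by (simp add: g'_def)
    show "h \<in> L2 (lebesgue_on {a<..<c})" by (rule h)
  qed
  show "(g \<longlongrightarrow> A) (at_right a)"
    using continuous_on_Icc_tendsto_ends(1)[OF \<open>a < c\<close> cg, of g] by (simp add: g_def)
  show "(g' \<longlongrightarrow> B) (at_right a)"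
    using continuous_on_Icc_tendsto_ends(1)[OF \<open>a < c\<close> cg', of g'] by (simp add: g'_def)
qed

section \<open>Green's formula and the weighted bound for the first derivative\<close>

lemma has_vector_derivative_cnj: "(f has_vector_derivative f') F \<Longrightarrow> ((\<lambda>t. cnj (f t)) has_vector_derivative cnj f') F"
  by (rule bounded_linear.has_vector_derivative[OF bounded_linear_cnj])

text \<open>The integrand is the derivative of \<open>f' * cnj g - f * cnj g'\<close>, in which the
  products \<open>f' * cnj g'\<close> cancel. The limits are explicit parameters so that those of
  neighbouring gaps can be matched through the jump conditions.\<close>

lemma green_gap:
  assumes "a < c" and f: "W22_gap a c f f' f''" and g: "W22_gap a c g g' g''"
    and lf: "(f \<longlongrightarrow> A) (at_right a)" "(f' \<longlongrightarrow> A') (at_right a)" "(f \<longlongrightarrow> B) (at_left c)" "(f' \<longlongrightarrow> B') (at_left c)"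
    and lg: "(g \<longlongrightarrow> C) (at_right a)" "(g' \<longlongrightarrow> C') (at_right a)" "(g \<longlongrightarrow> D) (at_left c)" "(g' \<longlongrightarrow> D') (at_left c)"
  shows "((\<lambda>t. f'' t * cnj (g t) - f t * cnj (g'' t)) has_integral
    (B' * cnj D - B * cnj D') - (A' * cnj C - A * cnj C')) {a..c}"
proof -
  note F = W22_gapD[OF f] and G = W22_gapD[OF g]
  obtain N where N: "negligible N" "\<And>t. t \<in> {a<..<c} - N \<Longrightarrow> (f' has_vector_derivative f'' t) (at t)"
    using W22_gap_ae[OF f] by blast
  obtain M where M: "negligible M" "\<And>t. t \<in> {a<..<c} - M \<Longrightarrow> (g' has_vector_derivative g'' t) (at t)"
    using W22_gap_ae[OF g] by blast
  show ?thesis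
  proof (rule has_integral_AC_loc_derivative[OF \<open>a < c\<close>])
    show "AC_loc {a<..<c} (\<lambda>t. f' t * cnj (g t) - f t * cnj (g' t))"
      by (intro AC_loc_diff AC_loc_mult AC_loc_cnj F G)
    show "negligible (N \<union> M)" using N M by simp
    show "((\<lambda>t. f' t * cnj (g t) - f t * cnj (g' t)) has_vector_derivative
        f'' t * cnj (g t) - f t * cnj (g'' t)) (at t)" if "t \<in> {a<..<c} - (N \<union> M)" for t
    proof -
      have "((\<lambda>t. f' t * cnj (g t) - f t * cnj (g' t)) has_vector_derivative
        (f' t * cnj (g' t) + f'' t * cnj (g t)) - (f t * cnj (g'' t) + f' t * cnj (g' t))) (at t)"
        by (intro has_vector_derivative_mult has_vector_derivative_diff has_vector_derivative_cnj F G N M) (use that in auto)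
      then show ?thesis by (simp add: algebra_simps)
    qed
    show "(\<lambda>t. f'' t * cnj (g t) - f t * cnj (g'' t)) integrable_on {a..c}"
      by (intro integrable_diff L2_prod_integrable_on L2_cnj F G W22_gap_L2[OF \<open>a < c\<close> f] W22_gap_L2[OF \<open>a < c\<close> g])
    show "((\<lambda>t. f' t * cnj (g t) - f t * cnj (g' t)) \<longlongrightarrow> A' * cnj C - A * cnj C') (at_right a)"
      by (intro tendsto_intros lf lg)
    show "((\<lambda>t. f' t * cnj (g t) - f t * cnj (g' t)) \<longlongrightarrow> B' * cnj D - B * cnj D') (at_left c)"
      by (intro tendsto_intros lf lg)
  qed
qed

text \<open>
  Obtained by integrating the derivative of \<open>\<psi>\<^sup>2 f' cnj f\<close>; it replaces an interpolation inequality
  with constants depending on the length of the gap.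
\<close>

lemma weighted_derivative_bound:
  assumes "a < c" and f: "W22_gap a c f f' f''"
    and \<psi>: "\<And>t. (\<psi> has_real_derivative \<psi>' t) (at t)" "continuous_on UNIV \<psi>'" "\<psi> a = 0" "\<psi> c = 0"
    and b: "\<And>t. t \<in> {a..c} \<Longrightarrow> \<bar>\<psi> t\<bar> \<le> P" "\<And>t. t \<in> {a..c} \<Longrightarrow> \<bar>\<psi>' t\<bar> \<le> Q"
  shows "(\<lambda>t. (\<psi> t)\<^sup>2 * (cmod (f' t))\<^sup>2) integrable_on {a..c}"
    "integral {a..c} (\<lambda>t. (\<psi> t)\<^sup>2 * (cmod (f' t))\<^sup>2) \<le>
      integral {a..c} (\<lambda>t. (4 * Q\<^sup>2 + 1) * (cmod (f t))\<^sup>2 + P ^ 4 * (cmod (f'' t))\<^sup>2)"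
proof -
  note F = W22_gapD[OF f]
  obtain N where N: "negligible N" "\<And>t. t \<in> {a<..<c} - N \<Longrightarrow> (f' has_vector_derivative f'' t) (at t)"
    using W22_gap_ae[OF f] by blast
  define p where "p t = complex_of_real ((\<psi> t)\<^sup>2)" for t
  define p' where "p' t = complex_of_real (2 * \<psi> t * \<psi>' t)" for t
  have c\<psi>: "continuous_on S \<psi>" for S
    using \<psi>(1) by (meson DERIV_isCont continuous_at_imp_continuous_on)
  have dp: "(p has_vector_derivative p' t) (at t)" for t
  proof -
    have "((\<lambda>t. (\<psi> t)\<^sup>2) has_real_derivative 2 * \<psi> t * \<psi>' t) (at t)"
      by (auto intro!: derivative_eq_intros \<psi>(1))
    then show ?thesis unfolding p_def p'_def
      by (intro has_vector_derivative_of_real) (simp add: has_real_derivative_iff_has_vector_derivative)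
  qed
  have cp': "continuous_on UNIV p'" unfolding p'_def by (intro continuous_intros c\<psi> \<psi>)
  have cp: "continuous_on {a..c} p" unfolding p_def by (intro continuous_intros c\<psi>)
  have ACp: "AC_loc {a<..<c} p"
    by (rule AC_loc_C1[of _ p p']) (auto intro: dp continuous_on_subset[OF cp'])
  define g where "g t = p t * (f' t * cnj (f' t) + f'' t * cnj (f t)) + p' t * (f' t * cnj (f t))" for t
  note fL2 = W22_gap_L2[OF \<open>a < c\<close> f]
  have pL2: "(\<lambda>t. q t * h t) \<in> L2 (lebesgue_on {a<..<c})"
    if q: "continuous_on {a..c} q" and h: "h \<in> L2 (lebesgue_on {a<..<c})" for q h
  proof -
    have "bounded (q ` {a..c})" by (intro compact_imp_bounded compact_continuous_image q) simp
    then obtain B where B: "\<forall>x\<in>q ` {a..c}. norm x \<le> B" unfolding bounded_iff by blast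
    show ?thesis
      by (rule L2_mult_bounded[OF h L2_measurable[OF L2_continuous[OF q]], of B]) (use B in auto)
  qed
  have gi: "g integrable_on {a..c}"
  proof -
    have "(\<lambda>t. (p t * f' t) * cnj (f' t) + (p t * f'' t) * cnj (f t) + (p' t * f' t) * cnj (f t)) integrable_on {a..c}"
      by (intro integrable_add L2_prod_integrable_on L2_cnj pL2 cp continuous_on_subset[OF cp'] fL2 F) auto
    then show ?thesis by (simp add: g_def[abs_def] algebra_simps)
  qed
  obtain A A' B B' where l: "(f \<longlongrightarrow> A) (at_right a)" "(f' \<longlongrightarrow> A') (at_right a)"
    "(f \<longlongrightarrow> B) (at_left c)" "(f' \<longlongrightarrow> B') (at_left c)" using W22_gap_limits[OF \<open>a < c\<close> f] by metis
  have lp: "(p \<longlongrightarrow> 0) (at_right a)" "(p \<longlongrightarrow> 0) (at_left c)"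
    using continuous_on_Icc_tendsto_ends[OF \<open>a < c\<close> cp, of p] \<psi>(3,4) by (simp_all add: p_def)
  have "(g has_integral 0 * (B' * cnj B) - 0 * (A' * cnj A)) {a..c}"
  proof (rule has_integral_AC_loc_derivative[OF \<open>a < c\<close> _ N(1) _ gi])
    show "AC_loc {a<..<c} (\<lambda>t. p t * (f' t * cnj (f t)))"
      by (intro AC_loc_mult AC_loc_cnj F ACp)
    show "((\<lambda>t. p t * (f' t * cnj (f t))) has_vector_derivative g t) (at t)" if "t \<in> {a<..<c} - N" for t
      unfolding g_def by (intro has_vector_derivative_mult has_vector_derivative_cnj dp F N) (use that in auto)
    show "((\<lambda>t. p t * (f' t * cnj (f t))) \<longlongrightarrow> 0 * (A' * cnj A)) (at_right a)"
      by (intro tendsto_intros lp l)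
    show "((\<lambda>t. p t * (f' t * cnj (f t))) \<longlongrightarrow> 0 * (B' * cnj B)) (at_left c)"
      by (intro tendsto_intros lp l)
  qed
  then have g0: "((\<lambda>t. Re (g t)) has_integral 0) {a..c}"
    using has_integral_linear[OF _ bounded_linear_Re, of g 0 "{a..c}"] by (simp add: o_def)
  have pf: "(\<lambda>t. complex_of_real (\<psi> t) * f' t) \<in> L2 (lebesgue_on {a<..<c})"
    by (intro pL2 fL2 continuous_intros c\<psi>)
  show int: "(\<lambda>t. (\<psi> t)\<^sup>2 * (cmod (f' t))\<^sup>2) integrable_on {a..c}"
    using L2_absolutely_integrable(2)[OF pf] set_lebesgue_integral_eq_integral(1)
    by (force simp: norm_mult power_mult_distrib)
  have sq: "(\<lambda>t. (cmod (f t))\<^sup>2) integrable_on {a..c}" "(\<lambda>t. (cmod (f'' t))\<^sup>2) integrable_on {a..c}"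
    using L2_absolutely_integrable(2)[OF fL2(1)] L2_absolutely_integrable(2)[OF F(4)]
      set_lebesgue_integral_eq_integral(1) by blast+
  define R where "R t = (4 * Q\<^sup>2 + 1) * (cmod (f t))\<^sup>2 + P ^ 4 * (cmod (f'' t))\<^sup>2" for t
  have Ri: "R integrable_on {a..c}"
    unfolding R_def by (intro integrable_add integrable_on_mult_right sq)
  \<comment> \<open>With \<open>y = \<bar>\<psi> t\<bar> * cmod (f' t)\<close>, the term containing
    \<open>\<psi>'\<close> is split by Young's inequality into \<open>y\<^sup>2 / 2\<close>, which
    is absorbed on the left, and \<open>2 * Q\<^sup>2 * (cmod (f t))\<^sup>2\<close>. Doubling the
    result gives the constants \<open>4 * Q\<^sup>2 + 1\<close> and \<open>P ^ 4\<close>; the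
    remaining \<open>Re (g t)\<close> integrates to 0.\<close>
  have pw: "(\<psi> t)\<^sup>2 * (cmod (f' t))\<^sup>2 \<le> 2 * Re (g t) + R t" if t: "t \<in> {a..c}" for t
  proof -
    define y where "y = \<bar>\<psi> t\<bar> * cmod (f' t)"
    have e1: "\<bar>Re (p' t * (f' t * cnj (f t)))\<bar> \<le> 2 * (Q * (y * cmod (f t)))"
    proof -
      have "\<bar>Re (p' t * (f' t * cnj (f t)))\<bar> \<le> cmod (p' t * (f' t * cnj (f t)))" by (rule abs_Re_le_cmod)
      also have "\<dots> = 2 * (\<bar>\<psi>' t\<bar> * (y * cmod (f t)))" by (simp add: p'_def norm_mult y_def abs_mult)
      also have "\<dots> \<le> 2 * (Q * (y * cmod (f t)))"
        using b(2)[OF t] by (intro mult_left_mono mult_right_mono) (auto simp: y_def)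
      finally show ?thesis .
    qed
    have e2: "\<bar>Re (p t * (f'' t * cnj (f t)))\<bar> \<le> P\<^sup>2 * cmod (f'' t) * cmod (f t)"
    proof -
      have "\<bar>Re (p t * (f'' t * cnj (f t)))\<bar> \<le> cmod (p t * (f'' t * cnj (f t)))" by (rule abs_Re_le_cmod)
      also have "\<dots> = \<bar>\<psi> t\<bar>\<^sup>2 * (cmod (f'' t) * cmod (f t))" by (simp add: p_def norm_mult norm_power)
      also have "\<dots> \<le> P\<^sup>2 * (cmod (f'' t) * cmod (f t))"
        using b(1)[OF t] by (intro mult_right_mono power_mono) auto
      finally show ?thesis by (simp add: mult.assoc)
    qed
    have e3: "Re (p t * (f' t * cnj (f' t))) = y\<^sup>2"
      unfolding complex_norm_square[symmetric] p_def y_def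
      by (simp add: power_mult_distrib flip: of_real_mult)
    have "Re (g t) = y\<^sup>2 + Re (p t * (f'' t * cnj (f t))) + Re (p' t * (f' t * cnj (f t)))"
      unfolding e3[symmetric] g_def by (simp only: distrib_left plus_complex.sel)
    then have "y\<^sup>2 \<le> Re (g t) + 2 * (Q * (y * cmod (f t))) + P\<^sup>2 * cmod (f'' t) * cmod (f t)"
      using e1 e2 by linarith
    moreover have "2 * (Q * (y * cmod (f t))) \<le> y\<^sup>2 / 2 + 2 * Q\<^sup>2 * (cmod (f t))\<^sup>2"
      using sum_squares_bound[of y "2 * Q * cmod (f t)"] by (simp add: power_mult_distrib algebra_simps)
    moreover have "P\<^sup>2 * cmod (f'' t) * cmod (f t) \<le> (P ^ 4 * (cmod (f'' t))\<^sup>2 + (cmod (f t))\<^sup>2) / 2"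
      using sum_squares_bound[of "P\<^sup>2 * cmod (f'' t)" "cmod (f t)"] by (simp add: power_mult_distrib flip: power_mult)
    ultimately have "y\<^sup>2 \<le> 2 * Re (g t) + R t" unfolding R_def by (simp add: algebra_simps)
    then show ?thesis by (simp add: y_def power_mult_distrib)
  qed
  have "((\<lambda>t. 2 * Re (g t) + R t) has_integral 2 * 0 + integral {a..c} R) {a..c}"
    by (intro has_integral_add has_integral_mult_right g0 integrable_integral Ri)
  then have "integral {a..c} (\<lambda>t. (\<psi> t)\<^sup>2 * (cmod (f' t))\<^sup>2) \<le> integral {a..c} R"
    using integral_le[OF int _ pw] by (simp add: integral_unique has_integral_integrable)
  then show "integral {a..c} (\<lambda>t. (\<psi> t)\<^sup>2 * (cmod (f' t))\<^sup>2) \<le>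
      integral {a..c} (\<lambda>t. (4 * Q\<^sup>2 + 1) * (cmod (f t))\<^sup>2 + P ^ 4 * (cmod (f'' t))\<^sup>2)"
    unfolding R_def .
qed

section \<open>Weak solutions on a single gap\<close>

lemma L2_gap_zero_ae:
  fixes a c :: real
  assumes h: "h \<in> L2 (lebesgue_on {a<..<c})" and z: "integral {a..c} (\<lambda>t. h t * cnj (h t)) = 0"
  shows "negligible {t \<in> {a<..<c}. h t \<noteq> 0}"
proof -
  have hi: "integrable (lebesgue_on {a<..<c}) (\<lambda>t. h t * cnj (h t))"
    by (rule L2_inner_integrable[OF h h])
  have eq: "h t * cnj (h t) = complex_of_real ((cmod (h t))\<^sup>2)" for t
    by (simp only: complex_norm_square)
  have "integral\<^sup>L (lebesgue_on {a<..<c}) (\<lambda>t. complex_of_real ((cmod (h t))\<^sup>2)) = 0"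
    using integrable_lebesgue_on_open_interval(2)[OF hi] z by (simp only: eq)
  then have "integral\<^sup>L (lebesgue_on {a<..<c}) (\<lambda>t. (cmod (h t))\<^sup>2) = 0"
    using integral_complex_of_real[of "lebesgue_on {a<..<c}" "\<lambda>t. (cmod (h t))\<^sup>2"] by simp
  then have "AE t in lebesgue_on {a<..<c}. (cmod (h t))\<^sup>2 = 0"
    using integral_nonneg_eq_0_iff_AE[OF L2_integrable_square[OF h]] by simp
  then have "AE t in lebesgue. t \<in> {a<..<c} \<longrightarrow> h t = 0"
    by (simp add: AE_restrict_space_iff)
  then obtain N where "N \<in> null_sets lebesgue" "{t. \<not> (t \<in> {a<..<c} \<longrightarrow> h t = 0)} \<subseteq> N"
    by (auto simp: eventually_ae_filter)
  moreover have "{t \<in> {a<..<c}. h t \<noteq> 0} \<subseteq> {t. \<not> (t \<in> {a<..<c} \<longrightarrow> h t = 0)}" by auto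
  ultimately show ?thesis
    using negligible_iff_null_sets negligible_subset by (metis (no_types, lifting) order_trans)
qed

text \<open>
  Let \<open>w0'' = - v\<close>. Subtracting from \<open>u - w0\<close> its projection to the affine functions gives \<open>h\<close>
  orthogonal to \<open>1\<close> and \<open>t\<close>, so \<open>h = f''\<close> for an admissible test function \<open>f\<close>; testing yields \<open>h = 0\<close>.
\<close>

lemma weak_solution_regular:
  assumes "a < c" and u: "u \<in> L2 (lebesgue_on {a<..<c})" and v: "v \<in> L2 (lebesgue_on {a<..<c})"
    and weak: "\<And>f f' f''. \<lbrakk>W22_gap a c f f' f'';
      (f \<longlongrightarrow> 0) (at_right a); (f' \<longlongrightarrow> 0) (at_right a); (f \<longlongrightarrow> 0) (at_left c); (f' \<longlongrightarrow> 0) (at_left c)\<rbrakk> \<Longrightarrow>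
      integral {a..c} (\<lambda>t. - f'' t * cnj (u t)) = integral {a..c} (\<lambda>t. f t * cnj (v t))"
  obtains w w' where "W22_gap a c w w' (\<lambda>t. - v t)" "negligible {t \<in> {a<..<c}. w t \<noteq> u t}"
proof -
  define V where "V t = integral {a..t} (\<lambda>s. - v s)" for t
  define w0 where "w0 t = integral {a..t} V" for t
  have v': "(\<lambda>t. - v t) \<in> L2 (lebesgue_on {a<..<c})" by (rule L2_uminus[OF v])
  have w0: "W22_gap a c w0 V (\<lambda>t. - v t)"
    using W22_gap_integral(1)[OF \<open>a < c\<close> v', where A = 0 and B = 0] by (simp add: w0_def[abs_def] V_def[abs_def])
  have w0L2: "w0 \<in> L2 (lebesgue_on {a<..<c})" by (rule W22_gap_L2[OF \<open>a < c\<close> w0])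
  \<comment> \<open>Centring at the midpoint makes \<open>s\<close> orthogonal to 1, so the two
    projection coefficients \<open>\<alpha>\<close> and \<open>\<beta>\<close> below are computed
    independently; \<open>T\<close> is the squared norm of \<open>s\<close>.\<close>
  define m where "m = (a + c) / 2"
  define s where "s t = complex_of_real (t - m)" for t
  have cs: "continuous_on S s" for S unfolding s_def by (intro continuous_intros)
  have ds: "(s has_vector_derivative 1) (at t within S)" for t S
    unfolding s_def by (auto intro!: derivative_eq_intros)
  have s1: "(s has_integral 0) {a..c}"
  proof -
    have "(s has_integral (s c * s c / 2 - s a * s a / 2)) {a..c}"
    proof (rule fundamental_theorem_of_calculus)
      show "((\<lambda>t. s t * s t / 2) has_vector_derivative s t) (at t within {a..c})" for t
        using has_vector_derivative_mult_right[OF has_vector_derivative_mult[OF ds[of t "{a..c}"] ds], of "1/2"]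
        by (simp add: field_simps)
    qed (use \<open>a < c\<close> in simp)
    moreover have "s c = - s a" by (simp add: s_def m_def field_simps)
    ultimately show ?thesis by simp
  qed
  define T where "T = complex_of_real ((c - a) ^ 3 / 12)"
  have s2: "((\<lambda>t. s t * s t) has_integral T) {a..c}"
  proof -
    have "((\<lambda>t. s t * s t) has_integral (s c ^ 3 / 3 - s a ^ 3 / 3)) {a..c}"
    proof (rule fundamental_theorem_of_calculus)
      show "((\<lambda>t. s t ^ 3 / 3) has_vector_derivative s t * s t) (at t within {a..c})" for t
        using has_vector_derivative_mult_right[OF has_vector_derivative_mult[OF ds[of t "{a..c}"] has_vector_derivative_mult[OF ds ds]], of "1/3"]
        by (simp add: field_simps power3_eq_cube)
    qed (use \<open>a < c\<close> in simp)
    moreover have "s c ^ 3 / 3 - s a ^ 3 / 3 = T"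
    proof -
    have "s c = of_real ((c - a) / 2)" "s a = of_real (- (c - a) / 2)"
      by (simp_all add: s_def m_def field_simps)
    then have "s c ^ 3 / 3 - s a ^ 3 / 3 = of_real (((c - a) / 2) ^ 3 / 3 - (- (c - a) / 2) ^ 3 / 3)"
      by (simp only: of_real_diff of_real_divide of_real_power of_real_numeral)
    moreover have "((c - a) / 2) ^ 3 / 3 - (- (c - a) / 2) ^ 3 / 3 = (c - a) ^ 3 / 12"
      by (simp add: power3_eq_cube field_simps)
    ultimately show ?thesis by (simp only: T_def)
    qed
    ultimately show ?thesis by simp
  qed
  have T0: "T \<noteq> 0" "of_real (c - a) \<noteq> (0::complex)" using \<open>a < c\<close> by (auto simp: T_def)
  define k where "k t = u t - w0 t" for t
  have kL2: "k \<in> L2 (lebesgue_on {a<..<c})" unfolding k_def by (intro L2_diff u w0L2)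
  have oneL2: "(\<lambda>_. 1) \<in> L2 (lebesgue_on {a<..<c})" by (rule L2_continuous) (intro continuous_intros)
  have sL2: "s \<in> L2 (lebesgue_on {a<..<c})" by (rule L2_continuous) (rule cs)
  have ki: "k integrable_on {a..c}" using L2_prod_integrable_on[OF kL2 oneL2] by simp
  have ksi: "(\<lambda>t. k t * s t) integrable_on {a..c}" by (rule L2_prod_integrable_on[OF kL2 sL2])
  define \<alpha> where "\<alpha> = integral {a..c} k / of_real (c - a)"
  define \<beta> where "\<beta> = integral {a..c} (\<lambda>t. k t * s t) / T"
  define h where "h t = k t - (\<alpha> + \<beta> * s t)" for t
  have hL2: "h \<in> L2 (lebesgue_on {a<..<c})" unfolding h_def
    by (intro L2_diff kL2 L2_continuous continuous_intros cs)
  have h1: "(h has_integral 0) {a..c}"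
  proof -
    have "(h has_integral integral {a..c} k - ((c - a) *\<^sub>R \<alpha> + \<beta> * 0)) {a..c}"
      unfolding h_def by (intro has_integral_diff has_integral_add has_integral_mult_right s1 integrable_integral ki)
        (use has_integral_const_real[of \<alpha> a c] \<open>a < c\<close> in simp)
    then show ?thesis using T0 by (simp add: \<alpha>_def scaleR_conv_of_real)
  qed
  have h2: "((\<lambda>t. h t * s t) has_integral 0) {a..c}"
  proof -
    have "((\<lambda>t. k t * s t - (\<alpha> * s t + \<beta> * (s t * s t))) has_integral integral {a..c} (\<lambda>t. k t * s t) - (\<alpha> * 0 + \<beta> * T)) {a..c}"
      by (intro has_integral_diff has_integral_add has_integral_mult_right s1 s2 integrable_integral ksi)
    then show ?thesis using T0 by (simp add: \<beta>_def h_def algebra_simps)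
  qed
  define f' where "f' t = integral {a..t} h" for t
  define f where "f t = integral {a..t} f'" for t
  have f: "W22_gap a c f f' h" and fa: "(f \<longlongrightarrow> 0) (at_right a)" "(f' \<longlongrightarrow> 0) (at_right a)"
    using W22_gap_integral(1,2)[OF \<open>a < c\<close> hL2, where A = 0 and B = 0] W22_gap_integral(3)[OF \<open>a < c\<close> hL2, where B = 0]
    by (simp_all add: f_def[abs_def] f'_def[abs_def])
  obtain B B' where fc: "(f \<longlongrightarrow> B) (at_left c)" "(f' \<longlongrightarrow> B') (at_left c)"
    using W22_gap_limits[OF \<open>a < c\<close> f] by metis
  have g1: "W22_gap a c (\<lambda>_. 1) (\<lambda>_. 0) (\<lambda>_. 0)" by (rule W22_gap_C2) (auto intro!: derivative_eq_intros)
  have gs: "W22_gap a c s (\<lambda>_. 1) (\<lambda>_. 0)" by (rule W22_gap_C2) (auto intro!: derivative_eq_intros ds)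
  \<comment> \<open>Green's formula against 1 and against \<open>s\<close> turns the two
    orthogonality relations of \<open>h\<close> into the vanishing of \<open>f'\<close> and then of
    \<open>f\<close> at the right end. Together with the zero data at the left end this makes
    \<open>f\<close> admissible in \<open>weak\<close>.\<close>
  have "((\<lambda>t. h t * cnj 1 - f t * cnj 0) has_integral (B' * cnj 1 - B * cnj 0) - (0 * cnj 1 - 0 * cnj 0)) {a..c}"
    by (rule green_gap[OF \<open>a < c\<close> f g1 fa fc]) auto
  then have "(h has_integral B') {a..c}" by simp
  then have B': "B' = 0" using h1 by (rule has_integral_unique)
  have sl: "(s \<longlongrightarrow> s a) (at_right a)" "(s \<longlongrightarrow> s c) (at_left c)"
    using continuous_on_Icc_tendsto_ends[OF \<open>a < c\<close> cs] by auto
  have cnjs: "cnj (s t) = s t" for t by (simp add: s_def)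
  have "((\<lambda>t. h t * cnj (s t) - f t * cnj 0) has_integral (B' * cnj (s c) - B * cnj 1) - (0 * cnj (s a) - 0 * cnj 1)) {a..c}"
    by (rule green_gap[OF \<open>a < c\<close> f gs fa fc sl(1) _ sl(2)]) auto
  then have "((\<lambda>t. h t * s t) has_integral - B) {a..c}" by (simp add: cnjs B')
  then have "- B = 0" using h2 by (rule has_integral_unique)
  then have B: "B = 0" by simp
  note fc = fc[unfolded B B']
  have w: "integral {a..c} (\<lambda>t. - h t * cnj (u t)) = integral {a..c} (\<lambda>t. f t * cnj (v t))"
    by (rule weak[OF f fa fc])
  obtain C C' D D' where l0: "(w0 \<longlongrightarrow> C) (at_right a)" "(V \<longlongrightarrow> C') (at_right a)"
    "(w0 \<longlongrightarrow> D) (at_left c)" "(V \<longlongrightarrow> D') (at_left c)" using W22_gap_limits[OF \<open>a < c\<close> w0] by metis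
  have gr: "((\<lambda>t. h t * cnj (w0 t) + f t * cnj (v t)) has_integral 0) {a..c}"
    using green_gap[OF \<open>a < c\<close> f w0 fa fc l0] by simp
  have fL2: "f \<in> L2 (lebesgue_on {a<..<c})" by (rule W22_gap_L2[OF \<open>a < c\<close> f])
  have ihu: "(\<lambda>t. h t * cnj (u t)) integrable_on {a..c}" and ihw: "(\<lambda>t. h t * cnj (w0 t)) integrable_on {a..c}"
    and ifv: "(\<lambda>t. f t * cnj (v t)) integrable_on {a..c}" 
    by (intro L2_prod_integrable_on L2_cnj hL2 u w0L2 fL2 v)+
  have e1: "integral {a..c} (\<lambda>t. h t * cnj (w0 t)) + integral {a..c} (\<lambda>t. f t * cnj (v t)) = 0"
    using integral_unique[OF gr] integral_add[OF ihw ifv] by simp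
  have e2: "- integral {a..c} (\<lambda>t. h t * cnj (u t)) = integral {a..c} (\<lambda>t. f t * cnj (v t))"
    using w by (simp add: integral_neg)
  have e3: "integral {a..c} (\<lambda>t. h t * cnj (u t)) - integral {a..c} (\<lambda>t. h t * cnj (w0 t)) = 0"
    using e1 unfolding e2[symmetric] by (simp add: algebra_simps)
  \<comment> \<open>The integrand is \<open>h t * cnj (h t)\<close> written out: testing gives that
    \<open>h\<close> is orthogonal to \<open>u - w0\<close>, and by construction it is orthogonal to
    the affine functions.\<close>
  have "((\<lambda>t. (h t * cnj (u t) - h t * cnj (w0 t)) - (cnj \<alpha> * h t + cnj \<beta> * (h t * s t))) has_integral
      (integral {a..c} (\<lambda>t. h t * cnj (u t)) - integral {a..c} (\<lambda>t. h t * cnj (w0 t))) - (cnj \<alpha> * 0 + cnj \<beta> * 0)) {a..c}"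
    by (intro has_integral_diff has_integral_add has_integral_mult_right h1 h2 integrable_integral ihu ihw)
  then have "((\<lambda>t. h t * cnj (h t)) has_integral 0) {a..c}"
    unfolding e3 by (simp add: h_def k_def cnjs algebra_simps)
  then have neg: "negligible {t \<in> {a<..<c}. h t \<noteq> 0}"
    using L2_gap_zero_ae[OF hL2] integral_unique by blast
  \<comment> \<open>This is the value of the affine projection at \<open>a\<close>; it rewrites
    \<open>\<alpha> + \<beta> * s t\<close> as \<open>A + \<beta> * of_real (t - a)\<close>, the
    form produced by \<open>W22_gap_integral\<close>.\<close>
  define A where "A = \<alpha> + \<beta> * s a"
  have wreg: "W22_gap a c (\<lambda>t. A + \<beta> * of_real (t - a) + w0 t) (\<lambda>t. \<beta> + V t) (\<lambda>t. - v t)"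
    using W22_gap_integral(1)[OF \<open>a < c\<close> v', where A = A and B = \<beta>] by (simp add: w0_def[abs_def] V_def[abs_def])
  show thesis
  proof (rule that[OF wreg])
    have "A + \<beta> * of_real (t - a) + w0 t = u t - h t" for t
      by (simp add: A_def h_def k_def s_def algebra_simps)
    then show "negligible {t \<in> {a<..<c}. A + \<beta> * of_real (t - a) + w0 t \<noteq> u t}"
      using neg by simp
  qed
qed

section \<open>Sobolev functions on a grid of gaps\<close>

locale point_grid =
  fixes b :: ereal and x :: "nat \<Rightarrow> real"
  assumes x0: "x 0 = 0" and mono: "strict_mono x" and below: "\<And>n. ereal (x n) < b"
    and lim: "(\<lambda>n. ereal (x n)) \<longlonglongrightarrow> b"
begin

abbreviation I where "I \<equiv> half_open b"
abbreviation X where "X \<equiv> interaction_points x"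
abbreviation M where "M \<equiv> lebesgue_on I"

lemma x_less: "x n < x (Suc n)"
  using mono by (simp add: strict_mono_def)

lemma x_mono: "m \<le> n \<Longrightarrow> x m \<le> x n"
  using mono by (simp add: strict_mono_less_eq)

lemma x_nonneg: "0 \<le> x n"
  using x_mono[of 0 n] x0 by simp

lemma x_in_I: "x n \<in> I"
  using x_nonneg below by (simp add: half_open_def)

lemma Icc_subset_I: "{0..x n} \<subseteq> I"
  using below[of n] by (auto simp: half_open_def intro: le_less_trans[of "ereal _" "ereal (x n)"])

lemma gap_subset_I: "{x n..x (Suc n)} \<subseteq> I"
  using Icc_subset_I[of "Suc n"] x_nonneg[of n] by auto

lemma I_nonneg: "t \<in> I \<Longrightarrow> 0 \<le> t"
  by (simp add: half_open_def)

lemma I_sets [measurable, simp]: "I \<in> sets lebesgue"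
proof -
  have "I = {0..} \<inter> ereal -` {..<b}" by (auto simp: half_open_def)
  moreover have "ereal -` {..<b} \<in> sets borel"
    using measurable_sets[OF borel_measurable_ereal[OF measurable_ident_sets[OF refl]], of "{..<b}"] by simp
  ultimately show ?thesis by (metis sets.Int atLeast_borel sets_completionI_sets sets_lborel)
qed

section \<open>Position of points and intervals relative to the grid\<close>

definition idx :: "real \<Rightarrow> nat" where "idx t = (LEAST n. t < x (Suc n))"

lemma idx_eqI: "x n \<le> t \<Longrightarrow> t < x (Suc n) \<Longrightarrow> idx t = n"
  unfolding idx_def
proof (rule Least_equality)
  fix m assume "x n \<le> t" "t < x (Suc m)"
  then have "\<not> Suc m \<le> n" using x_mono[of "Suc m" n] by linarith
  then show "n \<le> m" by simp
qed

lemma exists_gap: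
  assumes "t \<in> I"
  shows "x (idx t) \<le> t" "t < x (Suc (idx t))"
proof -
  have "ereal t < b" using assms by (simp add: half_open_def)
  then have "\<forall>\<^sub>F n in sequentially. ereal t < ereal (x n)" by (rule order_tendstoD(1)[OF lim])
  then obtain n where "t < x n" by (auto simp: eventually_sequentially)
  then have "t < x (Suc n)" using x_less[of n] by simp
  then show *: "t < x (Suc (idx t))" unfolding idx_def by (rule LeastI)
  show "x (idx t) \<le> t"
  proof (cases "idx t")
    case 0 then show ?thesis using x0 I_nonneg[OF assms] by simp
  next
    case (Suc m)
    then have "\<not> t < x (Suc m)" using not_less_Least[of m "\<lambda>n. t < x (Suc n)"] by (simp add: idx_def)
    then show ?thesis using Suc by simp
  qed
qed

lemma mem_X_iff: "t \<in> X \<longleftrightarrow> (\<exists>n. t = x (Suc n))"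
  unfolding interaction_points_def by (auto simp: image_iff) (metis Suc_le_D)

lemma gap_disjoint_X: "{x n<..<x (Suc n)} \<inter> range x = {}"
proof -
  have False if "x n < x m" "x m < x (Suc n)" for m
    using that mono by (simp add: strict_mono_less)
  then show ?thesis by auto
qed

lemma gap_subset: "{x n<..<x (Suc n)} \<subseteq> I - X"
proof -
  have "X \<subseteq> range x" by (auto simp: mem_X_iff)
  then show ?thesis using gap_disjoint_X[of n] gap_subset_I[of n] by fastforce
qed

lemma I_minus_cases:
  assumes "t \<in> I - range x"
  obtains n where "t \<in> {x n<..<x (Suc n)}"
proof (rule that[of "idx t"])
  have "t \<noteq> x (idx t)" using assms by auto
  then show "t \<in> {x (idx t)<..<x (Suc (idx t))}" using exists_gap[of t] assms by auto
qed

text \<open>The point \<open>x 0 = 0\<close> is the left end of the first gap but no interaction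
  point. Hence \<open>W22_derivs\<close> demands regularity up to 0, whereas at the other grid
  points only one-sided limits are involved; this is the source of the separate treatment of 0
  below.\<close>

lemma zero_in: "0 \<in> I - X"
proof -
  have "0 \<noteq> x (Suc n)" for n using x_less[of n] x_nonneg[of n] by linarith
  then show ?thesis using x_in_I[of 0] x0 by (auto simp: mem_X_iff)
qed

lemma negligible_range_x: "negligible (range x)"
proof -
  have "negligible (\<Union>n. {x n})" by (rule negligible_countable_Union) auto
  then show ?thesis by (simp only: UNION_singleton_eq_range)
qed

lemma at_within_gap: "t \<in> {x n<..<x (Suc n)} \<Longrightarrow> at t within I = at t"
  by (rule at_within_open_subset[of _ "{x n<..<x (Suc n)}"]) (use gap_subset in auto)

text \<open>An interval that avoids \<open>X\<close> cannot cross the right end of the gap in which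
  it starts. It therefore stays in one gap, whose left end it can contain only at 0; this reduces
  local absolute continuity on \<open>I - X\<close> to the gaps.\<close>

lemma subset_gap:
  assumes "{u..v} \<subseteq> I - X" "u \<le> v"
  shows "x (idx u) \<le> u" "v < x (Suc (idx u))" "u = 0 \<or> x (idx u) < u"
proof -
  have u: "u \<in> I - X" using assms by auto
  show *: "x (idx u) \<le> u" using exists_gap[of u] u by simp
  show "v < x (Suc (idx u))"
  proof (rule ccontr)
    assume "\<not> v < x (Suc (idx u))"
    then have "x (Suc (idx u)) \<in> {u..v}" using exists_gap[of u] u by auto
    then have "x (Suc (idx u)) \<notin> X" using assms by blast
    then show False by (auto simp: mem_X_iff)
  qed
  show "u = 0 \<or> x (idx u) < u"
  proof (cases "idx u")
    case 0 then show ?thesis using * x0 by auto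
  next
    case (Suc m)
    then have "u \<noteq> x (idx u)" using u by (auto simp: mem_X_iff)
    then show ?thesis using * by simp
  qed
qed

lemma W22_derivs_gap:
  assumes "W22_derivs I X f f' f''"
  shows "W22_gap (x n) (x (Suc n)) f f' f''"
proof -
  have "AE t in lebesgue. t \<in> I \<longrightarrow> (f' has_vector_derivative f'' t) (at t within I)"
    using assms by (simp add: W22_derivs_def AE_restrict_space_iff)
  then obtain N where N: "N \<in> null_sets lebesgue" "{t. \<not> (t \<in> I \<longrightarrow> (f' has_vector_derivative f'' t) (at t within I))} \<subseteq> N"
    by (auto simp: eventually_ae_filter)
  have sub: "{x n<..<x (Suc n)} \<subseteq> I - X" by (rule gap_subset)
  show ?thesis
  proof (rule W22_gapI)
    show "AC_loc {x n<..<x (Suc n)} f'"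
      using assms sub unfolding W22_derivs_def AC_loc_def by blast
    show "negligible N" using N negligible_iff_null_sets by blast
    show "(f has_vector_derivative f' t) (at t)" if "t \<in> {x n<..<x (Suc n)}" for t
      using assms sub that at_within_gap[OF that] unfolding W22_derivs_def by (metis subsetD)
    show "(f' has_vector_derivative f'' t) (at t)" if "t \<in> {x n<..<x (Suc n)} - N" for t
    proof -
      have "t \<in> I" using sub that by blast
      then have "(f' has_vector_derivative f'' t) (at t within I)" using N(2) that by blast
      then show ?thesis using at_within_gap[of t n] that by simp
    qed
    show "f'' \<in> L2 (lebesgue_on {x n<..<x (Suc n)})"
      by (rule L2_lebesgue_on_subset[of _ I]) (use assms sub in \<open>auto simp: W22_derivs_def\<close>)
  qed
qed

lemma L2_gap: "f \<in> L2 M \<Longrightarrow> f \<in> L2 (lebesgue_on {x n<..<x (Suc n)})"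
  by (rule L2_lebesgue_on_subset[of _ I]) (use gap_subset in auto)

text \<open>Since 0 belongs to \<open>I - X\<close>, \<open>f'\<close> is absolutely continuous up
  to 0. This converts the pointwise boundary condition \<open>f' 0 = 0\<close> of
  \<open>H_pre\<close> into a condition on a one-sided limit.\<close>

lemma W22_derivs_at_0:
  assumes "W22_derivs I X f f' f''"
  shows "(f' \<longlongrightarrow> f' 0) (at_right 0)"
proof -
  define c where "c = x 1 / 2"
  have c: "0 < c" "c < x 1" using x_less[of 0] x0 by (auto simp: c_def)
  have "{0..c} \<subseteq> I - X"
  proof
    fix t assume t: "t \<in> {0..c}"
    show "t \<in> I - X"
    proof (cases "t = 0")
      case False
      then have "t \<in> {x 0<..<x (Suc 0)}" using t c x0 by auto
      then show ?thesis using gap_subset by blast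
    qed (use zero_in in simp)
  qed
  then have "AC_on 0 c f'" using assms unfolding W22_derivs_def AC_loc_def by blast
  then show ?thesis
    using continuous_on_Icc_at_rightD[OF AC_on_imp_continuous_on c(1)] by blast
qed

text \<open>Regularity on the open gaps is silent about 0, so right-continuity of \<open>f\<close>
  and \<open>f'\<close> there is assumed. It identifies \<open>f\<close> and \<open>f'\<close> on
  the first gap with their continuous extensions, which give absolute continuity up to 0 and the
  one-sided derivative at 0.\<close>

lemma W22_derivsI:
  assumes gap: "\<And>n. W22_gap (x n) (x (Suc n)) f f' f''"
    and l0: "(f \<longlongrightarrow> f 0) (at_right 0)" "(f' \<longlongrightarrow> f' 0) (at_right 0)"
    and L2: "f \<in> L2 M" "f'' \<in> L2 M"
  shows "W22_derivs I X f f' f''"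
proof -
  have c: "0 < x 1" using x_less[of 0] x0 by auto
  have gap0: "W22_gap 0 (x 1) f f' f''" using gap[of 0] x0 by simp
  obtain g g' where g: "continuous_on {0..x 1} g" "continuous_on {0..x 1} g'"
    "\<And>t. t \<in> {0<..<x 1} \<Longrightarrow> f t = g t" "\<And>t. t \<in> {0<..<x 1} \<Longrightarrow> f' t = g' t"
    "\<And>t. t \<in> {0..x 1} \<Longrightarrow> g t = g 0 + integral {0..t} g'"
    "\<And>t. t \<in> {0..x 1} \<Longrightarrow> g' t = g' 0 + integral {0..t} f''"
    using W22_gap_extension[OF c gap0] by metis
  have "f 0 = g 0" "f' 0 = g' 0"
    using tendsto_unique[OF _ l0(1) continuous_on_Icc_tendsto_ends(1)[OF c g(1,3)]]
      tendsto_unique[OF _ l0(2) continuous_on_Icc_tendsto_ends(1)[OF c g(2,4)]] by simp_all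
  then have eq: "f t = g t" "f' t = g' t" if "0 \<le> t" "t < x 1" for t
    using g(3,4)[of t] that by (cases "t = 0"; simp)+
  have ACg: "AC_on 0 (x 1) g"
    by (rule AC_on_cong[OF AC_on_add[OF AC_on_const AC_on_integral[OF L2_continuous[OF g(2)]]] g(5)])
  have ACg': "AC_on 0 (x 1) g'"
    by (rule AC_on_cong[OF AC_on_add[OF AC_on_const AC_on_integral[OF W22_gapD(4)[OF gap0]]] g(6)])
  have AC: "AC_on u v f \<and> AC_on u v f'" if s: "{u..v} \<subseteq> I - X" for u v
  proof (cases "u \<le> v")
    case False then show ?thesis by (auto intro: AC_on_lipschitz[of 0])
  next
    case True
    note s' = subset_gap[OF s True]
    show ?thesis
    proof (cases "u = 0")
      case True
      then have v: "v < x 1" using s' idx_eqI[of 0 0] x0 c by simp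
      have 1: "AC_on 0 v g" "AC_on 0 v g'" using AC_on_subset[OF ACg] AC_on_subset[OF ACg'] v by auto
      show ?thesis unfolding True
        by (intro conjI AC_on_cong[OF 1(1)] AC_on_cong[OF 1(2)] eq) (use v in auto)
    next
      case False
      then have "{u..v} \<subseteq> {x (idx u)<..<x (Suc (idx u))}" using s' by auto
      then show ?thesis using W22_gapD(1,2)[OF gap[of "idx u"]] by (auto dest: AC_locD)
    qed
  qed
  obtain N where N: "\<And>n. negligible (N n)"
    "\<And>n t. t \<in> {x n<..<x (Suc n)} - N n \<Longrightarrow> (f' has_vector_derivative f'' t) (at t)"
    using gap unfolding W22_gap_def by metis
  have "negligible (\<Union>n. N n)" by (rule negligible_countable_Union) (use N in auto)
  then have neg: "negligible (range x \<union> (\<Union>n. N n))" using negligible_range_x by simp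
  show ?thesis unfolding W22_derivs_def
  proof (intro conjI L2 ballI)
    show "AC_loc (I - X) f" "AC_loc (I - X) f'" using AC by (auto simp: AC_loc_def)
    show "AE t in M. (f' has_vector_derivative f'' t) (at t within I)"
    proof -
      have "t \<in> I \<longrightarrow> (f' has_vector_derivative f'' t) (at t within I)" if t: "t \<notin> range x \<union> (\<Union>n. N n)" for t
      proof
        assume "t \<in> I"
        then obtain n where n: "t \<in> {x n<..<x (Suc n)}" using t by (blast intro: I_minus_cases)
        then show "(f' has_vector_derivative f'' t) (at t within I)"
          using N(2)[of t n] t at_within_gap[OF n] by auto
      qed
      then have "{t \<in> space lebesgue. \<not> (t \<in> I \<longrightarrow> (f' has_vector_derivative f'' t) (at t within I))} \<subseteq> range x \<union> (\<Union>n. N n)"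
        by auto
      then have "AE t in lebesgue. t \<in> I \<longrightarrow> (f' has_vector_derivative f'' t) (at t within I)"
        using neg by (intro AE_I') (auto simp: negligible_iff_null_sets)
      then show ?thesis by (simp add: AE_restrict_space_iff)
    qed
    fix t assume t: "t \<in> I - X"
    show "(f has_vector_derivative f' t) (at t within I)"
    proof (cases "t = 0")
      case False
      have "t \<notin> range x" 
      proof
        assume "t \<in> range x"
        then obtain n where "t = x n" by blast
        then show False using False t x0 by (cases n) (auto simp: mem_X_iff)
      qed
      then obtain n where n: "t \<in> {x n<..<x (Suc n)}" using t by (blast intro: I_minus_cases)
      then show ?thesis using W22_gapD(3)[OF gap n] at_within_gap[OF n] by simp
    next
      case True
      have "((\<lambda>t. integral {0..t} g') has_vector_derivative g' 0) (at 0 within {0..x 1})"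
        by (rule integral_has_vector_derivative[OF g(2)]) (use c in auto)
      from has_vector_derivative_add[OF has_vector_derivative_const this, of "g 0"]
      have "((\<lambda>t. g 0 + integral {0..t} g') has_vector_derivative g' 0) (at 0 within {0..x 1})" by simp
      moreover have fe: "g 0 + integral {0..t} g' = f t" if "t \<in> {0..x 1}" "dist t 0 < x 1" for t
        using eq(1)[of t] g(5)[OF that(1), symmetric] that by auto
      ultimately have "(f has_vector_derivative g' 0) (at 0 within {0..x 1})"
        using has_vector_derivative_transform_within[of "\<lambda>t. g 0 + integral {0..t} g'" "g' 0" 0 "{0..x 1}" "x 1" f] c by simp
      moreover have "at 0 within I = at 0 within {0..x 1}"
      proof (rule at_within_nhd[of _ "{..<x 1}"])
        show "I \<inter> {..<x 1} - {0} = {0..x 1} \<inter> {..<x 1} - {0}"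
          using Icc_subset_I[of 1] I_nonneg by auto
      qed (use c in auto)
      ultimately show ?thesis using eq(2)[of 0] c True by simp
    qed
  qed
qed

text \<open>Every function integrated gap by gap vanishes almost everywhere beyond some grid point,
  so finite additivity over adjacent intervals is enough and no infinite series of integrals
  arises.\<close>

lemma has_integral_gaps:
  fixes g :: "real \<Rightarrow> 'b::euclidean_space"
  assumes "\<And>n. n < N \<Longrightarrow> (g has_integral i n) {x n..x (Suc n)}"
    and Z: "negligible Z" and z: "\<And>t. t \<in> I - Z \<Longrightarrow> x N < t \<Longrightarrow> g t = 0"
  shows "(g has_integral (\<Sum>n<N. i n)) I"
proof -
  have "n \<le> N \<Longrightarrow> (g has_integral (\<Sum>k<n. i k)) {0..x n}" for n
  proof (induction n)
    case 0 then show ?case using x0 by (simp add: has_integral_refl)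
  next
    case (Suc n)
    then have "(g has_integral (\<Sum>k<n. i k)) {0..x n}" "(g has_integral i n) {x n..x (Suc n)}" using assms by auto
    then show ?case using has_integral_combine[of 0 "x n" "x (Suc n)" g] x_nonneg x_less[of n] by simp
  qed
  then have "((\<lambda>t. if t \<in> {0..x N} then g t else 0) has_integral (\<Sum>n<N. i n)) I"
    unfolding has_integral_restrict[OF Icc_subset_I] by simp
  then show ?thesis
    by (rule has_integral_spike[OF Z, rotated]) (use z I_nonneg in auto)
qed

lemma L2_inner_gaps:
  assumes f: "f \<in> L2 M" and v: "v \<in> L2 M" and Z: "negligible Z" and z: "\<And>t. t \<in> I - Z \<Longrightarrow> x N < t \<Longrightarrow> f t = 0"
  shows "L2_inner M f v = (\<Sum>n<N. integral {x n..x (Suc n)} (\<lambda>t. f t * cnj (v t)))"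
proof -
  have "L2_inner M f v = integral I (\<lambda>t. f t * cnj (v t))"
    unfolding L2_inner_def by (rule lebesgue_integral_eq_integral[OF L2_inner_integrable[OF f v]]) simp
  also have "((\<lambda>t. f t * cnj (v t)) has_integral (\<Sum>n<N. integral {x n..x (Suc n)} (\<lambda>t. f t * cnj (v t)))) I"
    by (rule has_integral_gaps[OF _ Z])
      (auto intro!: integrable_integral L2_prod_integrable_on L2_cnj L2_gap f v simp: z)
  then have "integral I (\<lambda>t. f t * cnj (v t)) = (\<Sum>n<N. integral {x n..x (Suc n)} (\<lambda>t. f t * cnj (v t)))"
    by (rule integral_unique)
  finally show ?thesis .
qed

lemma measurable_gaps:
  fixes f :: "real \<Rightarrow> complex"
  assumes "\<And>n. f \<in> borel_measurable (lebesgue_on {x n<..<x (Suc n)})"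
  shows "f \<in> borel_measurable M"
proof -
  have null: "range x \<in> null_sets M"
    using negligible_range_x x_in_I
    by (auto simp: negligible_iff_null_sets null_sets_restrict_space)
  have "f \<in> borel_measurable (lebesgue_on (I - range x))"
  proof (rule measurable_piecewise_restrict[of "range (\<lambda>n. {x n<..<x (Suc n)})"])
    show "\<Omega> \<inter> space (lebesgue_on (I - range x)) \<in> sets (lebesgue_on (I - range x))"
      if "\<Omega> \<in> range (\<lambda>n. {x n<..<x (Suc n)})" for \<Omega>
    proof -
      have "\<Omega> \<in> sets lebesgue" using that by auto
      then have "(I - range x) \<inter> \<Omega> \<in> sets (lebesgue_on (I - range x))"
        unfolding sets_restrict_space by (rule imageI)
      then show ?thesis by (simp add: Int_commute)
    qed
    show "space (lebesgue_on (I - range x)) \<subseteq> \<Union> (range (\<lambda>n. {x n<..<x (Suc n)}))"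
    proof
      fix t assume "t \<in> space (lebesgue_on (I - range x))"
      then have "t \<in> I - range x" by simp
      then obtain n where "t \<in> {x n<..<x (Suc n)}" by (rule I_minus_cases)
      then show "t \<in> \<Union> (range (\<lambda>n. {x n<..<x (Suc n)}))" by blast
    qed
    show "f \<in> borel_measurable (restrict_space (lebesgue_on (I - range x)) \<Omega>)"
      if om: "\<Omega> \<in> range (\<lambda>n. {x n<..<x (Suc n)})" for \<Omega>
    proof -
      obtain n where n: "\<Omega> = {x n<..<x (Suc n)}" using om by blast
      have "(I - range x) \<inter> \<Omega> = \<Omega>" using gap_subset[of n] gap_disjoint_X[of n] n by blast
      moreover have "I - range x \<in> sets lebesgue"
        using negligible_range_x by (auto intro: negligible_imp_sets)
      ultimately show ?thesis using assms[of n] n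
        by (simp add: restrict_restrict_space)
    qed
  qed auto
  then show ?thesis by (rule borel_measurable_diff_null[OF null I_sets, THEN iffD1])
qed

lemma L2_gaps:
  assumes L: "\<And>n. f \<in> L2 (lebesgue_on {x n<..<x (Suc n)})" and z: "\<And>t. t \<in> I \<Longrightarrow> x N < t \<Longrightarrow> f t = 0"
  shows "f \<in> L2 M"
  unfolding L2_def mem_Collect_eq
proof
  show "f \<in> borel_measurable M" by (intro measurable_gaps L2_measurable L)
  have "((\<lambda>t. (cmod (f t))\<^sup>2) has_integral (\<Sum>n<N. integral {x n..x (Suc n)} (\<lambda>t. (cmod (f t))\<^sup>2))) I"
    by (rule has_integral_gaps[OF _ negligible_empty])
      (use L2_absolutely_integrable(2)[OF L] set_lebesgue_integral_eq_integral(1) z in \<open>auto intro!: integrable_integral\<close>)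
  then have "(\<lambda>t. (cmod (f t))\<^sup>2) absolutely_integrable_on I"
    by (subst absolutely_integrable_on_iff_nonneg) (auto simp: has_integral_integrable)
  then show "integrable M (\<lambda>t. (cmod (f t))\<^sup>2)"
    by (rule absolutely_integrable_imp_integrable) simp
qed

text \<open>
  The sequences \<open>R, R'\<close> (\<open>L, L'\<close>) are the one-sided limits of \<open>f, f'\<close> at the left
  (right) end of the \<open>n\<close>-th gap.
\<close>

definition delta_dom :: "(nat \<Rightarrow> real) \<Rightarrow> (real \<Rightarrow> complex) \<Rightarrow> (real \<Rightarrow> complex) \<Rightarrow> (real \<Rightarrow> complex) \<Rightarrow>
    (nat \<Rightarrow> complex) \<Rightarrow> (nat \<Rightarrow> complex) \<Rightarrow> (nat \<Rightarrow> complex) \<Rightarrow> (nat \<Rightarrow> complex) \<Rightarrow> bool" where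
  "delta_dom \<alpha> f f' f'' R R' L L' \<longleftrightarrow>
    (\<forall>n. W22_gap (x n) (x (Suc n)) f f' f'' \<and>
      (f \<longlongrightarrow> R n) (at_right (x n)) \<and> (f' \<longlongrightarrow> R' n) (at_right (x n)) \<and>
      (f \<longlongrightarrow> L n) (at_left (x (Suc n))) \<and> (f' \<longlongrightarrow> L' n) (at_left (x (Suc n))) \<and>
      R (Suc n) = L n \<and> R' (Suc n) - L' n = complex_of_real (\<alpha> (Suc n)) * L n) \<and> R' 0 = 0"

lemma delta_domD:
  assumes "delta_dom \<alpha> f f' f'' R R' L L'"
  shows "W22_gap (x n) (x (Suc n)) f f' f''"
    "(f \<longlongrightarrow> R n) (at_right (x n))" "(f' \<longlongrightarrow> R' n) (at_right (x n))"
    "(f \<longlongrightarrow> L n) (at_left (x (Suc n)))" "(f' \<longlongrightarrow> L' n) (at_left (x (Suc n)))"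
    "R (Suc n) = L n" "R' (Suc n) = L' n + complex_of_real (\<alpha> (Suc n)) * L n" "R' 0 = 0"
  using assms unfolding delta_dom_def by (auto simp: algebra_simps)

text \<open>\<open>delta_dom\<close> reads only open gaps and one-sided limits, while
  \<open>H_pre\<close> also reads \<open>f' 0\<close> and needs continuity at 0. The values at 0 can
  therefore be corrected afterwards.\<close>

lemma delta_dom_upd_0:
  assumes "delta_dom \<alpha> f f' f'' R R' L L'"
  shows "delta_dom \<alpha> (f(0 := p)) (f'(0 := q)) f'' R R' L L'"
proof -
  note D = delta_domD[OF assms]
  have nz: "t \<noteq> 0" if "t \<in> {x n<..<x (Suc n)}" for t n using that x_nonneg[of n] by auto
  have r: "\<forall>\<^sub>F t in at_right (x n). t \<noteq> 0" for n
    using eventually_at_right_real[OF x_less[of n]] by eventually_elim (use nz in auto)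
  have l: "\<forall>\<^sub>F t in at_left (x (Suc n)). t \<noteq> 0" for n
    using eventually_at_left_real[OF x_less[of n]] by eventually_elim (use nz in auto)
  have "W22_gap (x n) (x (Suc n)) (f(0 := p)) (f'(0 := q)) f''" for n
    by (rule W22_gap_cong[OF D(1)]) (use nz in auto)
  moreover have "(h(0 := p) \<longlongrightarrow> k) (at_right (x n)) \<longleftrightarrow> (h \<longlongrightarrow> k) (at_right (x n))"
    "(h(0 := p) \<longlongrightarrow> k) (at_left (x (Suc n))) \<longleftrightarrow> (h \<longlongrightarrow> k) (at_left (x (Suc n)))" for h :: "real \<Rightarrow> complex" and k p n
    by (rule tendsto_cong, use r[of n] in \<open>eventually_elim, simp\<close>, rule tendsto_cong, use l[of n] in \<open>eventually_elim, simp\<close>)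
  ultimately show ?thesis using assms unfolding delta_dom_def by simp
qed

text \<open>The update at 0 restores continuity there, which \<open>W22_derivs\<close> requires and
  \<open>delta_dom\<close> leaves open. Vanishing of \<open>f''\<close> is a separate assumption
  because \<open>f''\<close> is a chosen representative, and it puts \<open>f''\<close> into
  \<open>L2\<close> by a finite sum over gaps.\<close>

lemma H_preI:
  assumes "delta_dom \<alpha> f f' f'' R R' L L'"
    and supp: "\<And>t. t \<in> I \<Longrightarrow> x N < t \<Longrightarrow> f t = 0" "\<And>t. t \<in> I \<Longrightarrow> x N < t \<Longrightarrow> f'' t = 0"
  shows "(f(0 := R 0), \<lambda>t. - f'' t) \<in> H_pre b x \<alpha>"
proof -
  note dd = delta_dom_upd_0[OF assms(1), of "R 0" 0]
  note D = delta_domD[OF dd]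
  have s0: "\<not> x N < 0" using x_nonneg[of N] by simp
  have L2: "f(0 := R 0) \<in> L2 M" "f'' \<in> L2 M"
    by (rule L2_gaps[of _ N], rule W22_gap_L2[OF x_less D(1)], use s0 supp in auto)
      (rule L2_gaps[of _ N], rule W22_gapD(4)[OF D(1)], simp add: supp)
  have W: "W22_derivs I X (f(0 := R 0)) (f'(0 := 0)) f''"
    by (rule W22_derivsI[OF D(1) _ _ L2]) (use D(2,3)[of 0] D(8) x0 in auto)
  have S: "{t \<in> I - X. (f(0 := R 0)) t \<noteq> 0} \<subseteq> {0..x N}"
    using supp(1) I_nonneg x_nonneg by (auto simp: not_less[symmetric] split: if_splits)
  then have "closure {t \<in> I - X. (f(0 := R 0)) t \<noteq> 0} \<subseteq> {0..x N}" by (rule closure_minimal) simp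
  then have "compactly_supported I X (f(0 := R 0))"
    unfolding compactly_supported_def
    using Icc_subset_I[of N] bounded_subset[OF _ S] by (auto simp: compact_closure simp del: fun_upd_apply)
  moreover have "delta_jump (\<alpha> n) (x n) (f(0 := R 0)) (f'(0 := 0))" if n1: "n \<ge> 1" for n
  proof -
    obtain m where n: "n = Suc m" using n1 not0_implies_Suc[of n] by auto
    show ?thesis unfolding delta_jump_def n
      by (rule exI[of _ "L m"], rule exI[of _ "R' (Suc m)"], rule exI[of _ "L' m"])
        (use D(2,3)[of "Suc m"] D(4-7)[of m] in auto)
  qed
  moreover have "(f'(0 := 0)) 0 = (0::complex)" by simp
  ultimately show ?thesis unfolding H_pre_def using W by blast
qed

text \<open>Compactness of the support inside \<open>I\<close> keeps it away from \<open>b\<close>,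
  so some grid point lies beyond it. Since the support ignores \<open>X\<close> and
  \<open>f''\<close> is determined only almost everywhere, vanishing is recorded off a null set
  \<open>Z\<close>. The limits \<open>R N\<close> and \<open>R' N\<close> vanish outright, which
  removes the far boundary term in Green's formula.\<close>

lemma H_preE:
  assumes "(f, g) \<in> H_pre b x \<alpha>"
  obtains f' f'' R R' L L' N Z where "g = (\<lambda>t. - f'' t)" "delta_dom \<alpha> f f' f'' R R' L L'"
    "f \<in> L2 M" "f'' \<in> L2 M" "negligible Z"
    "\<forall>t\<in>I - Z. x N < t \<longrightarrow> f t = 0 \<and> f'' t = 0" "R N = 0" "R' N = 0"
proof -
  obtain f' f'' where g: "g = (\<lambda>t. - f'' t)" and W: "W22_derivs I X f f' f''"
    and cs: "compactly_supported I X f" and f'0: "f' 0 = 0"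
    and jump: "\<And>n. n \<ge> 1 \<Longrightarrow> delta_jump (\<alpha> n) (x n) f f'"
    using assms unfolding H_pre_def by blast
  note gap = W22_derivs_gap[OF W]
  have L2: "f \<in> L2 M" "f'' \<in> L2 M" using W by (auto simp: W22_derivs_def)
  have "\<exists>A A' B B'. (f \<longlongrightarrow> A) (at_right (x n)) \<and> (f' \<longlongrightarrow> A') (at_right (x n)) \<and>
    (f \<longlongrightarrow> B) (at_left (x (Suc n))) \<and> (f' \<longlongrightarrow> B') (at_left (x (Suc n)))" for n
    using W22_gap_limits[OF x_less gap[of n]] by metis
  then obtain R R' L L' where l: "\<And>n. (f \<longlongrightarrow> R n) (at_right (x n))" "\<And>n. (f' \<longlongrightarrow> R' n) (at_right (x n))"
    "\<And>n. (f \<longlongrightarrow> L n) (at_left (x (Suc n)))" "\<And>n. (f' \<longlongrightarrow> L' n) (at_left (x (Suc n)))"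
    by metis
  have j: "R (Suc n) = L n \<and> R' (Suc n) - L' n = complex_of_real (\<alpha> (Suc n)) * L n" for n
  proof -
    obtain v p q where "(f \<longlongrightarrow> v) (at_right (x (Suc n)))" "(f \<longlongrightarrow> v) (at_left (x (Suc n)))"
      "(f' \<longlongrightarrow> p) (at_right (x (Suc n)))" "(f' \<longlongrightarrow> q) (at_left (x (Suc n)))" "p - q = complex_of_real (\<alpha> (Suc n)) * v"
      using jump[of "Suc n"] unfolding delta_jump_def by auto
    then show ?thesis
      using tendsto_unique[OF _ l(1)[of "Suc n"]] tendsto_unique[OF _ l(2)[of "Suc n"]]
        tendsto_unique[OF _ l(3)[of n]] tendsto_unique[OF _ l(4)[of n]] by force
  qed
  have "R' 0 = 0" using tendsto_unique[OF _ l(2)[of 0]] W22_derivs_at_0[OF W] f'0 x0 by force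
  then have dd: "delta_dom \<alpha> f f' f'' R R' L L'" unfolding delta_dom_def using gap l j by blast
  obtain N where N: "\<And>t. t \<in> I - X \<Longrightarrow> x N < t \<Longrightarrow> f t = 0"
  proof (cases "{t \<in> I - X. f t \<noteq> 0} = {}")
    case True then show ?thesis by (intro that[of 0]) auto
  next
    case False
    define K where "K = closure {t \<in> I - X. f t \<noteq> 0}"
    have K: "compact K" "K \<subseteq> I" "K \<noteq> {}" using cs False by (auto simp: compactly_supported_def K_def)
    obtain m where m: "m \<in> K" "\<And>t. t \<in> K \<Longrightarrow> t \<le> m" using compact_attains_sup[OF K(1,3)] by blast
    have mm: "m < x (Suc (idx m))" using exists_gap[of m] m K by blast
    show ?thesis
    \<comment> \<open>The support has a largest point \<open>m\<close>; the right end of the gap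
      containing \<open>m\<close> lies strictly beyond it.\<close>
    proof (rule that[of "Suc (idx m)"], rule ccontr)
      fix t assume t: "t \<in> I - X" "x (Suc (idx m)) < t" "f t \<noteq> 0"
      then have "t \<in> K" unfolding K_def by (intro subsetD[OF closure_subset]) simp
      then show False using m(2) mm t by force
    qed
  qed
  have f'z: "f' t = 0" if t: "t \<in> {x n<..<x (Suc n)}" and n: "N \<le> n" for t n
  proof -
    have "f s = 0" if "s \<in> {x n<..<x (Suc n)}" for s
      using N[of s] gap_subset[of n] x_mono[OF n] that by auto
    then have "(f has_vector_derivative 0) (at t)"
      by (intro has_vector_derivative_transform_within_open[OF has_vector_derivative_const[of 0] _ t]) auto
    then show ?thesis using W22_gapD(3)[OF gap t] vector_derivative_unique_at by blast
  qed
  obtain Y where Y: "\<And>n. negligible (Y n)"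
    "\<And>n t. t \<in> {x n<..<x (Suc n)} - Y n \<Longrightarrow> (f' has_vector_derivative f'' t) (at t)"
    using gap unfolding W22_gap_def by metis
  define Z where "Z = range x \<union> (\<Union>n. Y n)"
  have "negligible (\<Union>n. Y n)" by (rule negligible_countable_Union) (use Y in auto)
  then have Z: "negligible Z" using negligible_range_x by (simp add: Z_def)
  have zero: "f t = 0 \<and> f'' t = 0" if t: "t \<in> I - Z" "x N < t" for t
  proof -
    have "t \<in> I - range x" using t by (auto simp: Z_def)
    then obtain n where n: "t \<in> {x n<..<x (Suc n)}" by (rule I_minus_cases)
    have Nn: "N \<le> n"
    proof (rule ccontr)
      assume "\<not> N \<le> n"
      then have "x (Suc n) \<le> x N" by (intro x_mono) simp
      then show False using n t by simp
    qed
    have "(f' has_vector_derivative 0) (at t)"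
      by (intro has_vector_derivative_transform_within_open[OF has_vector_derivative_const[of 0] _ n])
        (use f'z[OF _ Nn] in auto)
    moreover have "(f' has_vector_derivative f'' t) (at t)" using Y(2)[of t n] n t by (auto simp: Z_def)
    ultimately have "f'' t = 0" using vector_derivative_unique_at by blast
    moreover have "f t = 0" using N[of t] t gap_subset[of n] n by blast
    ultimately show ?thesis by simp
  qed
  have ev: "\<forall>\<^sub>F t in at_right (x N). t \<in> {x N<..<x (Suc N)}" by (rule eventually_at_right_real[OF x_less])
  have "\<forall>\<^sub>F t in at_right (x N). f t = 0" using ev
    by eventually_elim (use N gap_subset[of N] in auto)
  then have RN: "R N = 0" using l(1)[of N] tendsto_eventually tendsto_unique trivial_limit_at_right_real by metis
  have "\<forall>\<^sub>F t in at_right (x N). f' t = 0" using ev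
    by eventually_elim (use f'z[of _ N] in auto)
  then have R'N: "R' N = 0" using l(2)[of N] tendsto_eventually tendsto_unique trivial_limit_at_right_real by metis
  show thesis by (rule that[OF g dd L2 Z _ RN R'N]) (use zero in blast)
qed

text \<open>The boundary expression \<open>B\<close> is continuous across each site: the
  contributions of the jumps cancel because \<alpha> is real. The sum over gaps thus telescopes; at
  0 both slopes vanish, and at \<open>x N\<close> both limits of \<open>f\<close> do.\<close>

lemma green_grid:
  assumes "delta_dom \<alpha> f f' f'' R R' L L'" "delta_dom \<alpha> g g' g'' S S' T T'" "R N = 0" "R' N = 0"
  shows "(\<Sum>n<N. integral {x n..x (Suc n)} (\<lambda>t. f'' t * cnj (g t) - f t * cnj (g'' t))) = 0"
proof -
  note F = delta_domD[OF assms(1)] and G = delta_domD[OF assms(2)]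
  define B where "B n = R' n * cnj (S n) - R n * cnj (S' n)" for n
  have "integral {x n..x (Suc n)} (\<lambda>t. f'' t * cnj (g t) - f t * cnj (g'' t)) = B (Suc n) - B n" for n
    using integral_unique[OF green_gap[OF x_less F(1) G(1) F(2-5) G(2-5), of n]]
    by (simp add: B_def F(6,7) G(6,7) algebra_simps)
  then have "(\<Sum>n<N. integral {x n..x (Suc n)} (\<lambda>t. f'' t * cnj (g t) - f t * cnj (g'' t))) = B N - B 0"
    by (simp add: sum_lessThan_telescope)
  then show ?thesis using F(8) G(8) assms(3,4) by (simp add: B_def)
qed

lemma H_pre_L2: "(f, g) \<in> H_pre b x \<alpha> \<Longrightarrow> f \<in> L2 M \<and> g \<in> L2 M"
  by (erule H_preE) (auto intro: L2_uminus)

lemma H_pre_symmetric: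
  assumes "(f, g) \<in> H_pre b x \<alpha>" "(f2, g2) \<in> H_pre b x \<alpha>"
  shows "L2_inner M g f2 = L2_inner M f g2"
proof -
  obtain f' f'' R R' L L' N Z where f: "g = (\<lambda>t. - f'' t)" "delta_dom \<alpha> f f' f'' R R' L L'"
    "f \<in> L2 M" "f'' \<in> L2 M" "negligible Z"
    "\<forall>t\<in>I - Z. x N < t \<longrightarrow> f t = 0 \<and> f'' t = 0" "R N = 0" "R' N = 0"
    by (rule H_preE[OF assms(1)]) (rule that)
  obtain k' k'' S S' T T' where k: "g2 = (\<lambda>t. - k'' t)" "delta_dom \<alpha> f2 k' k'' S S' T T'"
    "f2 \<in> L2 M" "k'' \<in> L2 M"
    by (rule H_preE[OF assms(2)]) (rule that)
  have i: "(\<lambda>t. f'' t * cnj (f2 t)) integrable_on {x n..x (Suc n)}"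
    "(\<lambda>t. f t * cnj (k'' t)) integrable_on {x n..x (Suc n)}" for n
    by (intro L2_prod_integrable_on L2_cnj L2_gap f k)+
  have "L2_inner M g f2 = (\<Sum>n<N. integral {x n..x (Suc n)} (\<lambda>t. - f'' t * cnj (f2 t)))"
    using L2_inner_gaps[OF L2_uminus[OF f(4)] k(3) f(5), of N] f(6) unfolding f(1) by auto
  also have "\<dots> = (\<Sum>n<N. integral {x n..x (Suc n)} (\<lambda>t. f t * cnj (- k'' t)))"
  proof -
    have "integral {x n..x (Suc n)} (\<lambda>t. - f'' t * cnj (f2 t)) = integral {x n..x (Suc n)} (\<lambda>t. f t * cnj (- k'' t))
      - integral {x n..x (Suc n)} (\<lambda>t. f'' t * cnj (f2 t) - f t * cnj (k'' t))" for n
      by (simp add: integral_diff[OF i] integral_neg)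
    then show ?thesis
      using green_grid[OF f(2) k(2) f(7,8)] by (simp only: sum_subtractf) simp
  qed
  also have "\<dots> = L2_inner M f g2"
    using L2_inner_gaps[OF f(3) L2_uminus[OF k(4)] f(5), of N] f(6) unfolding k(1) by auto
  finally show ?thesis .
qed

end

section \<open>The adjoint of the minimal operator\<close>

lemma norm_prod_integral_le:
  assumes f: "f \<in> L2 M" and g: "g \<in> L2 M"
  shows "(\<integral>x. cmod (f x) * cmod (g x) \<partial>M) \<le> L2_dist M f (\<lambda>_. 0) * L2_dist M g (\<lambda>_. 0)"
proof -
  define a where "a = L2_dist M f (\<lambda>_. 0)"
  define c where "c = L2_dist M g (\<lambda>_. 0)"
  have a: "a \<ge> 0" "a\<^sup>2 = (\<integral>x. (cmod (f x))\<^sup>2 \<partial>M)" and c: "c \<ge> 0" "c\<^sup>2 = (\<integral>x. (cmod (g x))\<^sup>2 \<partial>M)"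
    by (simp_all add: a_def c_def L2_dist_def)
  note i = L2_integrable_square[OF f] L2_integrable_square[OF g]
  have ifg: "integrable M (\<lambda>x. cmod (f x) * cmod (g x))"
    using integrable_norm[OF L2_mult_integrable[OF f g]] by (simp add: norm_mult)
  have main: "2 * (\<integral>x. cmod (f x) * cmod (g x) \<partial>M) \<le> s * a\<^sup>2 + c\<^sup>2 / s" if "s > 0" for s
  proof -
    have "(\<integral>x. 2 * (cmod (f x) * cmod (g x)) \<partial>M) \<le> (\<integral>x. s * (cmod (f x))\<^sup>2 + (cmod (g x))\<^sup>2 / s \<partial>M)"
    proof (rule integral_mono)
      show "2 * (cmod (f x) * cmod (g x)) \<le> s * (cmod (f x))\<^sup>2 + (cmod (g x))\<^sup>2 / s" for x
      proof -
        have "0 \<le> (s * cmod (f x) - cmod (g x))\<^sup>2 / s" using that by simp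
        also have "\<dots> = s * (cmod (f x))\<^sup>2 + (cmod (g x))\<^sup>2 / s - 2 * (cmod (f x) * cmod (g x))"
          using that by (simp add: power2_eq_square field_simps)
        finally show ?thesis by simp
      qed
    qed (use i ifg in auto)
    then show ?thesis using i ifg by (simp add: a c)
  qed
  have "2 * (\<integral>x. cmod (f x) * cmod (g x) \<partial>M) \<le> 2 * (a * c) + e" if e: "e > 0" for e
  proof -
    \<comment> \<open>The optimal weight in \<open>main\<close> is \<open>s = c / a\<close>, which
      fails to be positive when one of the norms is 0. Adding \<open>\<delta>\<close> to both norms
      repairs this at the cost of an error \<open>\<delta> * (a + c)\<close>, hence the
      denominator.\<close>
    define \<delta> where "\<delta> = e / (a + c + 1)"
    have \<delta>: "\<delta> > 0" using e a c by (simp add: \<delta>_def)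
    have \<delta>e: "\<delta> * (a + c) \<le> e" using e a c by (simp add: \<delta>_def field_simps)
    have pos: "a + \<delta> > 0" "c + \<delta> > 0" using a c \<delta> by auto
    have 1: "(c + \<delta>) / (a + \<delta>) * a\<^sup>2 \<le> (c + \<delta>) * a"
    proof -
      have "a / (a + \<delta>) \<le> 1" using pos \<delta> by simp
      then have "(c + \<delta>) * a * (a / (a + \<delta>)) \<le> (c + \<delta>) * a * 1" using a c \<delta> by (intro mult_left_mono) auto
      then show ?thesis by (simp add: power2_eq_square)
    qed
    have 2: "c\<^sup>2 / ((c + \<delta>) / (a + \<delta>)) \<le> (a + \<delta>) * c"
    proof -
      have "c / (c + \<delta>) \<le> 1" using pos \<delta> by simp
      then have "(a + \<delta>) * c * (c / (c + \<delta>)) \<le> (a + \<delta>) * c * 1" using a c \<delta> by (intro mult_left_mono) auto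
      then show ?thesis by (simp add: power2_eq_square ac_simps)
    qed
    have "2 * (\<integral>x. cmod (f x) * cmod (g x) \<partial>M) \<le> (c + \<delta>) * a + (a + \<delta>) * c"
      using main[of "(c + \<delta>) / (a + \<delta>)"] 1 2 pos by simp
    also have "\<dots> = 2 * (a * c) + \<delta> * (a + c)" by (simp add: algebra_simps)
    finally show ?thesis using \<delta>e by linarith
  qed
  then have "2 * (\<integral>x. cmod (f x) * cmod (g x) \<partial>M) \<le> 2 * (a * c)" by (rule field_le_epsilon)
  then show ?thesis by (simp add: a_def c_def)
qed

lemma L2_inner_le:
  assumes "f \<in> L2 M" "g \<in> L2 M"
  shows "cmod (L2_inner M f g) \<le> L2_dist M f (\<lambda>_. 0) * L2_dist M g (\<lambda>_. 0)"
proof -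
  have "cmod (L2_inner M f g) \<le> (\<integral>x. cmod (f x * cnj (g x)) \<partial>M)"
    unfolding L2_inner_def by (rule integral_norm_bound)
  also have "\<dots> = (\<integral>x. cmod (f x) * cmod (g x) \<partial>M)" by (simp add: norm_mult)
  finally show ?thesis using norm_prod_integral_le[OF assms] by linarith
qed

lemma L2_dist_nonneg: "0 \<le> L2_dist M f g"
  by (simp add: L2_dist_def)

lemma L2_dist_diff: "L2_dist M f g = L2_dist M (\<lambda>x. f x - g x) (\<lambda>_. 0)"
  by (simp add: L2_dist_def)

lemma L2_norm_add:
  assumes f: "f \<in> L2 M" and g: "g \<in> L2 M"
  shows "L2_dist M (\<lambda>x. f x + g x) (\<lambda>_. 0) \<le> L2_dist M f (\<lambda>_. 0) + L2_dist M g (\<lambda>_. 0)"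
proof -
  define a where "a = L2_dist M f (\<lambda>_. 0)"
  define c where "c = L2_dist M g (\<lambda>_. 0)"
  have a: "a \<ge> 0" "a\<^sup>2 = (\<integral>x. (cmod (f x))\<^sup>2 \<partial>M)" and c: "c \<ge> 0" "c\<^sup>2 = (\<integral>x. (cmod (g x))\<^sup>2 \<partial>M)"
    by (simp_all add: a_def c_def L2_dist_def)
  note i = L2_integrable_square[OF f] L2_integrable_square[OF g]
  have ifg: "integrable M (\<lambda>x. cmod (f x) * cmod (g x))"
    using integrable_norm[OF L2_mult_integrable[OF f g]] by (simp add: norm_mult)
  have "(\<integral>x. (cmod (f x + g x))\<^sup>2 \<partial>M) \<le> (\<integral>x. (cmod (f x))\<^sup>2 + (cmod (g x))\<^sup>2 + 2 * (cmod (f x) * cmod (g x)) \<partial>M)"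
  proof (rule integral_mono)
    show "integrable M (\<lambda>x. (cmod (f x + g x))\<^sup>2)" by (rule L2_integrable_square[OF L2_add[OF f g]])
    show "integrable M (\<lambda>x. (cmod (f x))\<^sup>2 + (cmod (g x))\<^sup>2 + 2 * (cmod (f x) * cmod (g x)))" using i ifg by simp
    show "(cmod (f x + g x))\<^sup>2 \<le> (cmod (f x))\<^sup>2 + (cmod (g x))\<^sup>2 + 2 * (cmod (f x) * cmod (g x))" for x
      using power_mono[OF norm_triangle_ineq[of "f x" "g x"] norm_ge_zero, of 2] by (simp add: power2_sum mult.assoc)
  qed
  also have "\<dots> = a\<^sup>2 + c\<^sup>2 + 2 * (\<integral>x. cmod (f x) * cmod (g x) \<partial>M)" using i ifg by (simp add: a c)
  also have "\<dots> \<le> (a + c)\<^sup>2"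
    using norm_prod_integral_le[OF f g] by (simp add: power2_sum a_def c_def)
  finally show ?thesis
    unfolding a_def[symmetric] c_def[symmetric] using a c by (simp add: L2_dist_def real_le_lsqrt)
qed

lemma L2_dist_triangle:
  assumes "f \<in> L2 M" "g \<in> L2 M" "h \<in> L2 M"
  shows "L2_dist M f h \<le> L2_dist M f g + L2_dist M g h"
  using L2_norm_add[OF L2_diff[OF assms(1,2)] L2_diff[OF assms(2,3)]]
  by (simp add: L2_dist_diff[of M f h] L2_dist_diff[of M f g] L2_dist_diff[of M g h])

lemma L2_inner_diff:
  assumes "f \<in> L2 M" "g \<in> L2 M" "h \<in> L2 M"
  shows "L2_inner M (\<lambda>x. f x - g x) h = L2_inner M f h - L2_inner M g h"
    "L2_inner M h (\<lambda>x. f x - g x) = L2_inner M h f - L2_inner M h g"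
  using L2_inner_integrable[OF assms(1,3)] L2_inner_integrable[OF assms(2,3)]
    L2_inner_integrable[OF assms(3,1)] L2_inner_integrable[OF assms(3,2)]
  by (simp_all add: L2_inner_def algebra_simps)

lemma L2_inner_tendsto:
  assumes F: "\<And>k. F k \<in> L2 M" and G: "\<And>k. G k \<in> L2 M" and f: "f \<in> L2 M" and g: "g \<in> L2 M"
    and "(\<lambda>k. L2_dist M (F k) f) \<longlonglongrightarrow> 0" "(\<lambda>k. L2_dist M (G k) g) \<longlonglongrightarrow> 0"
  shows "(\<lambda>k. L2_inner M (F k) (G k)) \<longlonglongrightarrow> L2_inner M f g"
proof -
  let ?n = "\<lambda>f. L2_dist M f (\<lambda>_. 0)"
  have b: "cmod (L2_inner M (F k) (G k) - L2_inner M f g) \<le>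
    L2_dist M (F k) f * (L2_dist M (G k) g + ?n g) + ?n f * L2_dist M (G k) g" for k
  proof -
    have "L2_inner M (F k) (G k) - L2_inner M f g =
      L2_inner M (\<lambda>x. F k x - f x) (G k) + L2_inner M f (\<lambda>x. G k x - g x)"
      by (simp add: L2_inner_diff F G f g)
    then have "cmod (L2_inner M (F k) (G k) - L2_inner M f g) \<le>
      cmod (L2_inner M (\<lambda>x. F k x - f x) (G k)) + cmod (L2_inner M f (\<lambda>x. G k x - g x))"
      by (metis norm_triangle_ineq)
    also have "\<dots> \<le> ?n (\<lambda>x. F k x - f x) * ?n (G k) + ?n f * ?n (\<lambda>x. G k x - g x)"
      by (intro add_mono L2_inner_le L2_diff F G f g)
    also have "\<dots> = L2_dist M (F k) f * ?n (G k) + ?n f * L2_dist M (G k) g"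
      by (simp only: L2_dist_diff[of M "F k" f] L2_dist_diff[of M "G k" g])
    also have "\<dots> \<le> L2_dist M (F k) f * (L2_dist M (G k) g + ?n g) + ?n f * L2_dist M (G k) g"
      using L2_dist_triangle[OF G[of k] g, of "\<lambda>_. 0"] L2_diff[OF f f]
      by (intro add_mono mult_left_mono L2_dist_nonneg) auto
    finally show ?thesis .
  qed
  have "(\<lambda>k. L2_dist M (F k) f * (L2_dist M (G k) g + ?n g) + ?n f * L2_dist M (G k) g) \<longlonglongrightarrow> 0 * (0 + ?n g) + ?n f * 0"
    by (intro tendsto_intros assms)
  then have "(\<lambda>k. L2_inner M (F k) (G k) - L2_inner M f g) \<longlonglongrightarrow> 0"
    using Lim_null_comparison[OF always_eventually[OF allI[OF b]]] by simp
  then show ?thesis by (simp add: LIM_zero_iff)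
qed

lemma op_closure_extends: "T \<subseteq> L2 M \<times> L2 M \<Longrightarrow> T \<subseteq> op_closure M T"
  unfolding op_closure_def
  by (auto intro!: exI[of _ "\<lambda>_. _"] simp: L2_dist_def)

text \<open>Taking adjoints reverses inclusions, so the adjoint of the closure lies in that of
  \<open>T\<close>, which lies in the closure by \<open>adj\<close>. The opposite inclusion is the
  symmetry of \<open>T\<close> carried to limits by continuity of the inner product.\<close>

lemma self_adjoint_op_closureI:
  assumes L: "T \<subseteq> L2 M \<times> L2 M" and dense: "densely_defined M T"
    and sym: "\<And>f g f2 g2. (f, g) \<in> T \<Longrightarrow> (f2, g2) \<in> T \<Longrightarrow> L2_inner M g f2 = L2_inner M f g2"
    and adj: "op_adjoint M T \<subseteq> op_closure M T"
  shows "self_adjoint M (op_closure M T)"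
  unfolding self_adjoint_def
proof (intro conjI equalityI)
  note ext = op_closure_extends[OF L]
  show "densely_defined M (op_closure M T)"
    using dense ext unfolding densely_defined_def by blast
  have "op_adjoint M (op_closure M T) \<subseteq> op_adjoint M T"
    using ext unfolding op_adjoint_def by blast
  then show "op_adjoint M (op_closure M T) \<subseteq> op_closure M T" using adj by blast
  show "op_closure M T \<subseteq> op_adjoint M (op_closure M T)"
  proof (clarify)
    fix u v assume uv: "(u, v) \<in> op_closure M T"
    then obtain U V where U: "\<And>k::nat. (U k, V k) \<in> T" "(\<lambda>k. L2_dist M (U k) u) \<longlonglongrightarrow> 0" "(\<lambda>k. L2_dist M (V k) v) \<longlonglongrightarrow> 0"
      and u: "u \<in> L2 M" "v \<in> L2 M" by (auto simp: op_closure_def)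
    have "L2_inner M g u = L2_inner M f v" if fg: "(f, g) \<in> op_closure M T" for f g
    proof -
      obtain F G where F: "\<And>k::nat. (F k, G k) \<in> T" "(\<lambda>k. L2_dist M (F k) f) \<longlonglongrightarrow> 0" "(\<lambda>k. L2_dist M (G k) g) \<longlonglongrightarrow> 0"
        and f: "f \<in> L2 M" "g \<in> L2 M" using fg by (auto simp: op_closure_def)
      have 1: "(\<lambda>k. L2_inner M (G k) (U k)) \<longlonglongrightarrow> L2_inner M g u"
        by (rule L2_inner_tendsto) (use F U u f L in blast)+
      have 2: "(\<lambda>k. L2_inner M (F k) (V k)) \<longlonglongrightarrow> L2_inner M f v"
        by (rule L2_inner_tendsto) (use F U u f L in blast)+
      have "(\<lambda>k. L2_inner M (G k) (U k)) = (\<lambda>k. L2_inner M (F k) (V k))" using sym F(1) U(1) by blast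
      then show ?thesis using 1 2 LIMSEQ_unique by metis
    qed
    then show "(u, v) \<in> op_adjoint M (op_closure M T)" using u unfolding op_adjoint_def by blast
  qed
qed

text \<open>Provides test functions with arbitrary values and slopes at both ends of a gap. The
  coefficient \<open>E\<close> adjusts the value at \<open>c\<close>; the cubic term with
  \<open>G\<close> has a double zero at \<open>a\<close> and a simple one at \<open>c\<close>, so it
  adjusts the last slope without disturbing the other three data.\<close>

lemma hermite_interpolation:
  fixes A A' B B' :: complex
  assumes "a < (c::real)"
  obtains p p' p'' where "\<And>t. (p has_vector_derivative p' t) (at t)" "\<And>t. (p' has_vector_derivative p'' t) (at t)"
    "continuous_on UNIV p''" "p a = A" "p' a = A'" "p c = B" "p' c = B'"
proof -
  define d where "d = complex_of_real (c - a)"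
  have d: "d \<noteq> 0" using assms by (simp add: d_def)
  define s where "s t = complex_of_real (t - a)" for t
  have ds: "(s has_vector_derivative 1) (at t)" for t
    unfolding s_def by (auto intro!: derivative_eq_intros)
  have s: "s a = 0" "s c = d" by (simp_all add: s_def d_def)
  define E where "E = (B - A - A' * d) / d\<^sup>2"
  define G where "G = (B' - A' - 2 * E * d) / d\<^sup>2"
  define p where "p t = A + A' * s t + E * (s t * s t) + G * (s t * s t * (s t - d))" for t
  define p' where "p' t = A' + 2 * E * s t + G * (3 * (s t * s t) - 2 * d * s t)" for t
  define p'' where "p'' t = 2 * E + G * (6 * s t - 2 * d)" for t
  have dm: "((\<lambda>t. h t * k t) has_vector_derivative h t * k' + h' * k t) (at t)"
    if "(h has_vector_derivative h') (at t)" "(k has_vector_derivative k') (at t)" for h k :: "real \<Rightarrow> complex" and h' k' t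
    using has_vector_derivative_mult[OF that] .
  have "(p has_vector_derivative (0 + (A' * 1 + 0 * s t) + (E * (s t * 1 + 1 * s t) + 0 * (s t * s t)) +
      (G * (s t * s t * (1 - 0) + (s t * 1 + 1 * s t) * (s t - d)) + 0 * (s t * s t * (s t - d))))) (at t)" for t
    unfolding p_def by (intro has_vector_derivative_add has_vector_derivative_diff dm has_vector_derivative_const ds)
  then have 1: "(p has_vector_derivative p' t) (at t)" for t
    by (rule has_vector_derivative_eq_rhs) (simp add: p'_def algebra_simps)
  have "(p' has_vector_derivative (0 + (2 * E * 1 + 0 * s t) +
      (G * ((3 * (s t * 1 + 1 * s t) + 0 * (s t * s t)) - (2 * d * 1 + 0 * s t)) + 0 * (3 * (s t * s t) - 2 * d * s t)))) (at t)" for t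
    unfolding p'_def by (intro has_vector_derivative_add has_vector_derivative_diff dm has_vector_derivative_const ds)
  then have 2: "(p' has_vector_derivative p'' t) (at t)" for t
    by (rule has_vector_derivative_eq_rhs) (simp add: p''_def algebra_simps)
  have 3: "continuous_on UNIV p''" unfolding p''_def s_def by (intro continuous_intros)
  have Ed: "E * (d * d) = B - A - A' * d" using d by (simp add: E_def power2_eq_square)
  have Gd: "G * (d * d) = B' - A' - 2 * E * d" using d by (simp add: G_def power2_eq_square)
  have "p a = A" "p' a = A'" "p c = B" by (simp_all add: p_def p'_def s Ed)
  moreover have "p' c = B'"
  proof -
    have "p' c = A' + 2 * E * d + G * (d * d)" by (simp add: p'_def s algebra_simps)
    then show ?thesis by (simp add: Gd)
  qed
  ultimately show thesis by (intro that[of p p' p''] 1 2 3)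
qed

section \<open>Gluing test functions and identifying the domain of the adjoint\<close>

context point_grid
begin

definition glue :: "(nat \<Rightarrow> real \<Rightarrow> complex) \<Rightarrow> real \<Rightarrow> complex" where "glue P t = P (idx t) t"

lemma glue_eq: "t \<in> {x n..<x (Suc n)} \<Longrightarrow> glue P t = P n t"
  using idx_eqI[of n t] by (simp add: glue_def)

lemma glue_vanish: "(\<And>n. n \<ge> N \<Longrightarrow> P n t = 0) \<Longrightarrow> t \<in> I \<Longrightarrow> x N < t \<Longrightarrow> glue P t = 0"
  using exists_gap(2)[of t] x_mono[of "Suc (idx t)" N] unfolding glue_def by (cases "N \<le> idx t") auto

lemma glue_tendsto:
  "(P n \<longlongrightarrow> k) (at_right (x n)) \<Longrightarrow> (glue P \<longlongrightarrow> k) (at_right (x n))"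
  "(P n \<longlongrightarrow> k) (at_left (x (Suc n))) \<Longrightarrow> (glue P \<longlongrightarrow> k) (at_left (x (Suc n)))"
proof -
  have "\<forall>\<^sub>F t in at_right (x n). glue P t = P n t"
    using eventually_at_right_real[OF x_less[of n]] by eventually_elim (rule glue_eq, simp)
  then show "(P n \<longlongrightarrow> k) (at_right (x n)) \<Longrightarrow> (glue P \<longlongrightarrow> k) (at_right (x n))"
    by (simp add: tendsto_cong)
  have "\<forall>\<^sub>F t in at_left (x (Suc n)). glue P t = P n t"
    using eventually_at_left_real[OF x_less[of n]] by eventually_elim (rule glue_eq, simp)
  then show "(P n \<longlongrightarrow> k) (at_left (x (Suc n))) \<Longrightarrow> (glue P \<longlongrightarrow> k) (at_left (x (Suc n)))"
    by (simp add: tendsto_cong)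
qed

lemma delta_dom_glue:
  assumes "\<And>n. W22_gap (x n) (x (Suc n)) (P n) (P' n) (P'' n)"
    "\<And>n. (P n \<longlongrightarrow> R n) (at_right (x n))" "\<And>n. (P' n \<longlongrightarrow> R' n) (at_right (x n))"
    "\<And>n. (P n \<longlongrightarrow> L n) (at_left (x (Suc n)))" "\<And>n. (P' n \<longlongrightarrow> L' n) (at_left (x (Suc n)))"
    "\<And>n. R (Suc n) = L n" "\<And>n. R' (Suc n) - L' n = complex_of_real (\<alpha> (Suc n)) * L n" "R' 0 = 0"
  shows "delta_dom \<alpha> (glue P) (glue P') (glue P'') R R' L L'"
  unfolding delta_dom_def
  by (intro conjI allI W22_gap_cong[OF assms(1)] glue_tendsto assms) (simp_all add: glue_eq)

text \<open>Writes the adjoint relation as a finite sum over gaps for \<open>f\<close> itself: the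
  correction at 0 made by \<open>H_preI\<close> concerns a null set and disappears under the
  integrals.\<close>

lemma adjoint_test:
  assumes uv: "(u, v) \<in> op_adjoint M (H_pre b x \<alpha>)" and f: "delta_dom \<alpha> f f' f'' R R' L L'"
    and supp: "\<And>t. t \<in> I \<Longrightarrow> x N < t \<Longrightarrow> f t = 0" "\<And>t. t \<in> I \<Longrightarrow> x N < t \<Longrightarrow> f'' t = 0"
  shows "(\<Sum>n<N. integral {x n..x (Suc n)} (\<lambda>t. f'' t * cnj (u t) + f t * cnj (v t))) = 0"
proof -
  define f0 where "f0 = f(0 := R 0)"
  have T: "(f0, \<lambda>t. - f'' t) \<in> H_pre b x \<alpha>" unfolding f0_def by (rule H_preI[OF f supp])
  have L: "f0 \<in> L2 M" "(\<lambda>t. - f'' t) \<in> L2 M" "u \<in> L2 M" "v \<in> L2 M"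
    using H_pre_L2[OF T] uv by (auto simp: op_adjoint_def)
  have f''L: "f'' \<in> L2 M" using L2_uminus[OF L(2)] by simp
  have z0: "f0 t = 0" if "t \<in> I" "x N < t" for t
    using supp(1)[OF that] that x_nonneg[of N] by (auto simp: f0_def)
  have fg: "integral {x n..x (Suc n)} (\<lambda>t. f0 t * cnj (v t)) = integral {x n..x (Suc n)} (\<lambda>t. f t * cnj (v t))"
    for n by (rule integral_spike[of "{0}"]) (auto simp: f0_def)
  have i1: "(\<lambda>t. f'' t * cnj (u t)) integrable_on {x n..x (Suc n)}" for n
    by (intro L2_prod_integrable_on L2_cnj L2_gap L f''L)
  have i2: "(\<lambda>t. f t * cnj (v t)) integrable_on {x n..x (Suc n)}" for n
    by (intro L2_prod_integrable_on L2_cnj L2_gap L W22_gap_L2[OF x_less delta_domD(1)[OF f]])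
  have "L2_inner M (\<lambda>t. - f'' t) u = L2_inner M f0 v"
    using uv T unfolding op_adjoint_def by blast
  moreover have "L2_inner M (\<lambda>t. - f'' t) u = (\<Sum>n<N. integral {x n..x (Suc n)} (\<lambda>t. - f'' t * cnj (u t)))"
    by (rule L2_inner_gaps[OF L(2,3) negligible_empty]) (simp add: supp)
  moreover have "L2_inner M f0 v = (\<Sum>n<N. integral {x n..x (Suc n)} (\<lambda>t. f0 t * cnj (v t)))"
    by (rule L2_inner_gaps[OF L(1,4) negligible_empty]) (simp add: z0)
  ultimately have e: "- (\<Sum>n<N. integral {x n..x (Suc n)} (\<lambda>t. f'' t * cnj (u t))) = (\<Sum>n<N. integral {x n..x (Suc n)} (\<lambda>t. f t * cnj (v t)))"
    by (simp add: fg integral_neg sum_negf)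
  have "(\<Sum>n<N. integral {x n..x (Suc n)} (\<lambda>t. f'' t * cnj (u t) + f t * cnj (v t))) =
    (\<Sum>n<N. integral {x n..x (Suc n)} (\<lambda>t. f'' t * cnj (u t))) + (\<Sum>n<N. integral {x n..x (Suc n)} (\<lambda>t. f t * cnj (v t)))"
    by (simp only: integral_add[OF i1 i2] sum.distrib)
  then show ?thesis unfolding e[symmetric] by simp
qed

text \<open>
  Inside the gaps this is \<open>weak_solution_regular\<close>; the boundary and jump conditions come from test
  functions with prescribed values and one-sided derivatives at a single grid point.
\<close>

lemma adjoint_regular:
  assumes uv: "(u, v) \<in> op_adjoint M (H_pre b x \<alpha>)"
  obtains w w' R R' L L' Z where "delta_dom \<alpha> w w' (\<lambda>t. - v t) R R' L L'"
    "negligible Z" "\<forall>t\<in>I - Z. w t = u t"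
proof -
  have L: "u \<in> L2 M" "v \<in> L2 M" using uv by (auto simp: op_adjoint_def)
  have "\<exists>w w'. W22_gap (x n) (x (Suc n)) w w' (\<lambda>t. - v t) \<and> negligible {t \<in> {x n<..<x (Suc n)}. w t \<noteq> u t}" for n
  proof (rule weak_solution_regular[OF x_less L2_gap[OF L(1)] L2_gap[OF L(2)]])
    fix f f' f''
    assume f: "W22_gap (x n) (x (Suc n)) f f' f''" "(f \<longlongrightarrow> 0) (at_right (x n))" "(f' \<longlongrightarrow> 0) (at_right (x n))"
      "(f \<longlongrightarrow> 0) (at_left (x (Suc n)))" "(f' \<longlongrightarrow> 0) (at_left (x (Suc n)))"
    \<comment> \<open>A test function with zero end data, extended by 0 to all other gaps, satisfies
      every boundary and jump condition trivially, so the adjoint relation localises to gap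
      \<open>n\<close>.\<close>
    let ?P = "\<lambda>f k. if k = n then f else (\<lambda>_. 0)"
    have dd: "delta_dom \<alpha> (glue (?P f)) (glue (?P f')) (glue (?P f'')) (\<lambda>_. 0) (\<lambda>_. 0) (\<lambda>_. 0) (\<lambda>_. 0)"
      by (rule delta_dom_glue) (use f in \<open>auto intro!: W22_gap_C2\<close>)
    have s: "(\<Sum>k<Suc n. integral {x k..x (Suc k)} (\<lambda>t. glue (?P f'') t * cnj (u t) + glue (?P f) t * cnj (v t))) = 0"
      by (rule adjoint_test[OF uv dd]; rule glue_vanish[of "Suc n"]; simp)
    have "integral {x k..x (Suc k)} (\<lambda>t. glue (?P f'') t * cnj (u t) + glue (?P f) t * cnj (v t)) =
      integral {x k..x (Suc k)} (\<lambda>t. ?P f'' k t * cnj (u t) + ?P f k t * cnj (v t))" for k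
      by (rule integral_spike[of "{x (Suc k)}"]) (auto simp: glue_eq[of _ k])
    then have "integral {x n..x (Suc n)} (\<lambda>t. f'' t * cnj (u t) + f t * cnj (v t)) = 0"
      using s by simp
    moreover have "(\<lambda>t. f'' t * cnj (u t)) integrable_on {x n..x (Suc n)}"
      by (intro L2_prod_integrable_on L2_cnj L2_gap L W22_gapD(4)[OF f(1)])
    moreover have "(\<lambda>t. f t * cnj (v t)) integrable_on {x n..x (Suc n)}"
      by (intro L2_prod_integrable_on L2_cnj L2_gap L W22_gap_L2[OF x_less f(1)])
    ultimately show "integral {x n..x (Suc n)} (\<lambda>t. - f'' t * cnj (u t)) = integral {x n..x (Suc n)} (\<lambda>t. f t * cnj (v t))"
      by (simp add: integral_add integral_neg) (metis add_eq_0_iff)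
  qed blast
  then obtain W W' where W: "\<And>n. W22_gap (x n) (x (Suc n)) (W n) (W' n) (\<lambda>t. - v t)"
    "\<And>n. negligible {t \<in> {x n<..<x (Suc n)}. W n t \<noteq> u t}" by metis
  have "\<exists>A A' B B'. (W n \<longlongrightarrow> A) (at_right (x n)) \<and> (W' n \<longlongrightarrow> A') (at_right (x n)) \<and>
    (W n \<longlongrightarrow> B) (at_left (x (Suc n))) \<and> (W' n \<longlongrightarrow> B') (at_left (x (Suc n)))" for n
    using W22_gap_limits[OF x_less W(1)[of n]] by metis
  then obtain R R' L L' where l: "\<And>n. (W n \<longlongrightarrow> R n) (at_right (x n))" "\<And>n. (W' n \<longlongrightarrow> R' n) (at_right (x n))"
    "\<And>n. (W n \<longlongrightarrow> L n) (at_left (x (Suc n)))" "\<And>n. (W' n \<longlongrightarrow> L' n) (at_left (x (Suc n)))"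
    by metis
  \<comment> \<open>\<open>V\<close> prescribes values at the grid points, \<open>C\<close> the
    slopes on their right, and \<open>B n\<close> the slope on the left of \<open>x (Suc n)\<close>.
    Data that obey the jump conditions and vanish from \<open>N\<close> on are interpolated by
    cubics to a test function. Since \<open>W n\<close> solves the equation in its gap, Green's
    formula leaves only boundary terms.\<close>
  have test: "(\<Sum>n<N. (B n * cnj (L n) - V (Suc n) * cnj (L' n)) - (C n * cnj (R n) - V n * cnj (R' n))) = 0"
    if z: "\<And>n. n \<ge> N \<Longrightarrow> V n = 0 \<and> B n = 0 \<and> C n = 0" and C0: "C 0 = 0"
      and j: "\<And>n. C (Suc n) - B n = complex_of_real (\<alpha> (Suc n)) * V (Suc n)" for N V B C
  proof -
    have "\<exists>p p' p''. (\<forall>t. (p has_vector_derivative p' t) (at t)) \<and> (\<forall>t. (p' has_vector_derivative p'' t) (at t)) \<and>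
      continuous_on UNIV p'' \<and> p (x n) = V n \<and> p' (x n) = C n \<and> p (x (Suc n)) = V (Suc n) \<and> p' (x (Suc n)) = B n" for n
      using hermite_interpolation[OF x_less[of n], of "V n" "C n" "V (Suc n)" "B n"] by metis
    then obtain p p' p'' where p: "\<And>n t. (p n has_vector_derivative p' n t) (at t)"
      "\<And>n t. (p' n has_vector_derivative p'' n t) (at t)" "\<And>n. continuous_on UNIV (p'' n)"
      "\<And>n. p n (x n) = V n" "\<And>n. p' n (x n) = C n" "\<And>n. p n (x (Suc n)) = V (Suc n)" "\<And>n. p' n (x (Suc n)) = B n"
      by metis
    define P where "P n = (if n < N then p n else (\<lambda>_. 0))" for n
    define P' where "P' n = (if n < N then p' n else (\<lambda>_. 0))" for n
    define P'' where "P'' n = (if n < N then p'' n else (\<lambda>_. 0))" for n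
    have P: "(P n has_vector_derivative P' n t) (at t)" "(P' n has_vector_derivative P'' n t) (at t)" "continuous_on UNIV (P'' n)" for n t
      by (auto simp: P_def P'_def P''_def p)
    have cP: "continuous_on S (P n)" "continuous_on S (P' n)" for S n
      using P(1,2) by (meson has_vector_derivative_continuous continuous_at_imp_continuous_on)+
    have gap: "W22_gap (x n) (x (Suc n)) (P n) (P' n) (P'' n)" for n by (rule W22_gap_C2) (rule P)+
    have ev: "P n (x n) = V n" "P' n (x n) = C n" "P n (x (Suc n)) = V (Suc n)" "P' n (x (Suc n)) = B n" for n
      using z by (auto simp: P_def P'_def p)
    have lP: "(P n \<longlongrightarrow> V n) (at_right (x n))" "(P' n \<longlongrightarrow> C n) (at_right (x n))"
      "(P n \<longlongrightarrow> V (Suc n)) (at_left (x (Suc n)))" "(P' n \<longlongrightarrow> B n) (at_left (x (Suc n)))" for n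
      using continuous_on_Icc_tendsto_ends[OF x_less[of n] cP(1)[of _ n] refl] continuous_on_Icc_tendsto_ends[OF x_less[of n] cP(2)[of _ n] refl]
      by (simp_all add: ev)
    have dd: "delta_dom \<alpha> (glue P) (glue P') (glue P'') V C (\<lambda>n. V (Suc n)) B"
      by (rule delta_dom_glue[OF gap lP]) (simp_all add: j C0)
    have s: "(\<Sum>k<N. integral {x k..x (Suc k)} (\<lambda>t. glue P'' t * cnj (u t) + glue P t * cnj (v t))) = 0"
      by (rule adjoint_test[OF uv dd]; rule glue_vanish[of N]; simp add: P_def P''_def)
    have "integral {x k..x (Suc k)} (\<lambda>t. glue P'' t * cnj (u t) + glue P t * cnj (v t)) =
      (B k * cnj (L k) - V (Suc k) * cnj (L' k)) - (C k * cnj (R k) - V k * cnj (R' k))" for k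
    proof -
      have "integral {x k..x (Suc k)} (\<lambda>t. glue P'' t * cnj (u t) + glue P t * cnj (v t)) =
        integral {x k..x (Suc k)} (\<lambda>t. P'' k t * cnj (W k t) - P k t * cnj (- v t))"
      proof (rule integral_spike)
        show "negligible ({t \<in> {x k<..<x (Suc k)}. W k t \<noteq> u t} \<union> {x k, x (Suc k)})" using W(2)[of k] by simp
      qed (auto simp: glue_eq[of _ k])
      also have "\<dots> = (B k * cnj (L k) - V (Suc k) * cnj (L' k)) - (C k * cnj (R k) - V k * cnj (R' k))"
        by (rule integral_unique[OF green_gap[OF x_less gap W(1) lP l]])
      finally show ?thesis .
    qed
    then show ?thesis using s by simp
  qed
  \<comment> \<open>The test function has value 1 at 0 and zero data otherwise.\<close>
  have R'0: "R' 0 = 0"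
    using test[of 1 "\<lambda>n. if n = 0 then 1 else 0" "\<lambda>_. 0" "\<lambda>_. 0"] by simp
  have site: "B * cnj (L m) - V * cnj (L' m) - (C * cnj (R (Suc m)) - V * cnj (R' (Suc m))) = 0"
    if "C - B = complex_of_real (\<alpha> (Suc m)) * V" for m V B C
    using test[of "Suc (Suc m)" "\<lambda>n. if n = Suc m then V else 0" "\<lambda>n. if n = m then B else 0" "\<lambda>n. if n = Suc m then C else 0"] that
    by (simp add: algebra_simps)
  \<comment> \<open>Value 0 with equal slopes 1 on both sides detects continuity. Next, value 1 with
    left slope 0 and right slope \<open>\<alpha> (Suc m)\<close> detects the jump of the derivative;
    real \<alpha> is unaffected by the conjugation.\<close>
  have 1: "R (Suc m) = L m" for m
    using site[of 1 1 m 0] by simp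
  have 2: "R' (Suc m) - L' m = complex_of_real (\<alpha> (Suc m)) * L m" for m
  proof -
    have "cnj (R' (Suc m) - L' m) = cnj (complex_of_real (\<alpha> (Suc m)) * L m)"
      using site[of "complex_of_real (\<alpha> (Suc m))" 0 m 1] 1 by (simp add: algebra_simps)
    then show ?thesis by (simp only: complex_cnj_cancel_iff)
  qed
  have "delta_dom \<alpha> (glue W) (glue W') (glue (\<lambda>_ t. - v t)) R R' L L'"
    by (rule delta_dom_glue[OF W(1) l 1 2 R'0])
  then have dd: "delta_dom \<alpha> (glue W) (glue W') (\<lambda>t. - v t) R R' L L'" by (simp add: glue_def[abs_def])
  define Z where "Z = range x \<union> (\<Union>n. {t \<in> {x n<..<x (Suc n)}. W n t \<noteq> u t})"
  have "negligible (\<Union>n. {t \<in> {x n<..<x (Suc n)}. W n t \<noteq> u t})" by (rule negligible_countable_Union) (use W(2) in auto)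
  then have "negligible Z" using negligible_range_x by (simp add: Z_def)
  moreover have "glue W t = u t" if t: "t \<in> I - Z" for t
  proof -
    have "t \<in> I - range x" using t by (auto simp: Z_def)
    then obtain n where n: "t \<in> {x n<..<x (Suc n)}" by (rule I_minus_cases)
    then show ?thesis using t glue_eq[of t n W] by (auto simp: Z_def)
  qed
  ultimately show thesis using that[OF dd] by blast
qed

end

section \<open>Cutoff approximation\<close>

text \<open>The cutoff must have vanishing derivative at the end points of a gap, so that it preserves the jump conditions.\<close>

definition smoothstep :: "real \<Rightarrow> real" where "smoothstep y = 10 * y ^ 3 - 15 * y ^ 4 + 6 * y ^ 5"
definition smoothstep' :: "real \<Rightarrow> real" where "smoothstep' y = 30 * y\<^sup>2 - 60 * y ^ 3 + 30 * y ^ 4"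
definition smoothstep'' :: "real \<Rightarrow> real" where "smoothstep'' y = 60 * y - 180 * y\<^sup>2 + 120 * y ^ 3"

lemma smoothstep_ends: "smoothstep 0 = 0" "smoothstep 1 = 1" "smoothstep' 0 = 0" "smoothstep' 1 = 0"
  by (simp_all add: smoothstep_def smoothstep'_def)

text \<open>The factorisations make the signs visible; the second one reflects the symmetry
  \<open>1 - smoothstep y = smoothstep (1 - y)\<close>. The constants 30 and 60 are the leading
  factors of the factored derivatives, whose remaining factors are at most 1 in modulus.\<close>

lemma smoothstep_bounds:
  assumes "0 \<le> y" "y \<le> 1"
  shows "0 \<le> smoothstep y" "smoothstep y \<le> 1" "\<bar>smoothstep' y\<bar> \<le> 30" "\<bar>smoothstep'' y\<bar> \<le> 60"
proof -
  have "smoothstep y = y ^ 3 * (6 * (y - 5 / 4)\<^sup>2 + 5 / 8)"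
    by (simp add: smoothstep_def power2_eq_square algebra_simps eval_nat_numeral)
  then show "0 \<le> smoothstep y" using assms by simp
  have "1 - smoothstep y = (1 - y) ^ 3 * (6 * y\<^sup>2 + 3 * y + 1)"
    by (simp add: smoothstep_def power2_eq_square algebra_simps eval_nat_numeral)
  moreover have "0 \<le> (1 - y) ^ 3 * (6 * y\<^sup>2 + 3 * y + 1)" using assms by simp
  ultimately show "smoothstep y \<le> 1" by linarith
  have "smoothstep' y = 30 * (y * (1 - y))\<^sup>2"
    by (simp add: smoothstep'_def power2_eq_square algebra_simps eval_nat_numeral)
  moreover have y: "0 \<le> y * (1 - y)" "y * (1 - y) \<le> 1" using assms by (auto intro: mult_le_one)
  moreover have "(y * (1 - y))\<^sup>2 \<le> 1" using y by (simp add: power_le_one)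
  ultimately show "\<bar>smoothstep' y\<bar> \<le> 30" by simp
  have "smoothstep'' y = 60 * ((y * (1 - y)) * (1 - 2 * y))"
    by (simp add: smoothstep''_def power2_eq_square algebra_simps eval_nat_numeral)
  moreover have "\<bar>(y * (1 - y)) * (1 - 2 * y)\<bar> \<le> 1 * 1"
    unfolding abs_mult[of "y * (1 - y)"] using y assms by (intro mult_mono) auto
  ultimately show "\<bar>smoothstep'' y\<bar> \<le> 60" by simp
qed

lemma DERIV_smoothstep:
  "(smoothstep has_real_derivative smoothstep' y) (at y)"
  "(smoothstep' has_real_derivative smoothstep'' y) (at y)"
  unfolding smoothstep_def[abs_def] smoothstep'_def[abs_def] smoothstep''_def
  by (auto intro!: derivative_eq_intros simp: algebra_simps)

lemma continuous_on_smoothstep: "continuous_on S smoothstep''" "continuous_on S smoothstep'" "continuous_on S smoothstep"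
  unfolding smoothstep_def[abs_def] smoothstep'_def[abs_def] smoothstep''_def[abs_def]
  by (intro continuous_intros)+

context point_grid
begin

lemma AE_M:
  assumes "negligible Z" "\<And>t. t \<in> I - Z \<Longrightarrow> P t"
  shows "AE t in M. P t"
proof -
  have "AE t in lebesgue. t \<in> I \<longrightarrow> P t"
    by (rule AE_I'[of Z]) (use assms in \<open>auto simp: negligible_iff_null_sets\<close>)
  then show ?thesis by (simp add: AE_restrict_space_iff)
qed

lemma L2_dist_cong:
  assumes "F \<in> L2 M" "u \<in> L2 M" "w \<in> L2 M" "negligible Z" "\<And>t. t \<in> I - Z \<Longrightarrow> w t = u t"
  shows "L2_dist M F u = L2_dist M F w"
proof -
  have "(\<integral>t. (cmod (F t - u t))\<^sup>2 \<partial>M) = (\<integral>t. (cmod (F t - w t))\<^sup>2 \<partial>M)"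
  proof (rule integral_cong_AE)
    show "AE t in M. (cmod (F t - u t))\<^sup>2 = (cmod (F t - w t))\<^sup>2"
      by (rule AE_M[OF assms(4)]) (simp add: assms(5))
  qed (use L2_integrable_square[OF L2_diff[OF assms(1,2)]] L2_integrable_square[OF L2_diff[OF assms(1,3)]] in auto)
  then show ?thesis by (simp add: L2_dist_def)
qed

lemma L2_dominated_convergence:
  assumes F: "\<And>k. F k \<in> L2 M" and f: "f \<in> L2 M" and h: "h \<in> L2 M" and Z: "negligible Z"
    and b: "\<And>k t. t \<in> I - Z \<Longrightarrow> cmod (F k t - f t) \<le> cmod (h t)"
    and l: "\<And>t. t \<in> I - Z \<Longrightarrow> (\<lambda>k. F k t) \<longlonglongrightarrow> f t"
  shows "(\<lambda>k. L2_dist M (F k) f) \<longlonglongrightarrow> 0"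
proof -
  have "(\<lambda>k. \<integral>t. (cmod (F k t - f t))\<^sup>2 \<partial>M) \<longlonglongrightarrow> (\<integral>t. 0 \<partial>M)"
  proof (rule integral_dominated_convergence[of _ _ _ "\<lambda>t. (cmod (h t))\<^sup>2"])
    show "AE t in M. (\<lambda>k. (cmod (F k t - f t))\<^sup>2) \<longlonglongrightarrow> 0"
    proof (rule AE_M[OF Z])
      fix t assume "t \<in> I - Z"
      from l[OF this] have "(\<lambda>k. (cmod (F k t - f t))\<^sup>2) \<longlonglongrightarrow> (cmod (f t - f t))\<^sup>2" by (intro tendsto_intros)
      then show "(\<lambda>k. (cmod (F k t - f t))\<^sup>2) \<longlonglongrightarrow> 0" by simp
    qed
    show "AE t in M. norm ((cmod (F k t - f t))\<^sup>2) \<le> (cmod (h t))\<^sup>2" for k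
      by (rule AE_M[OF Z]) (use b in \<open>auto intro: power_mono\<close>)
  qed (use L2_integrable_square[OF h] L2_integrable_square[OF L2_diff[OF F f]] in auto)
  then have "(\<lambda>k. sqrt (\<integral>t. (cmod (F k t - f t))\<^sup>2 \<partial>M)) \<longlonglongrightarrow> sqrt 0" by (intro tendsto_intros) simp
  then show ?thesis by (simp add: L2_dist_def)
qed

lemma sum_gaps_le:
  assumes R: "R integrable_on I" and pos: "\<And>t. t \<in> I \<Longrightarrow> 0 \<le> (R t :: real)"
  shows "(\<Sum>n<k. integral {x n..x (Suc n)} R) \<le> integral I R"
proof -
  have Rg: "R integrable_on {x n..x (Suc n)}" for n
  proof -
    have "R absolutely_integrable_on I" using R pos by (simp add: absolutely_integrable_on_iff_nonneg)
    then have "R absolutely_integrable_on {x n..x (Suc n)}"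
      by (rule set_integrable_subset) (use gap_subset_I in auto)
    then show ?thesis using set_lebesgue_integral_eq_integral(1) by blast
  qed
  have "((\<lambda>t. if t \<le> x k then R t else 0) has_integral (\<Sum>n<k. integral {x n..x (Suc n)} R)) I"
  proof (rule has_integral_gaps[OF _ negligible_empty])
    fix n assume "n < k"
    then have "x (Suc n) \<le> x k" by (intro x_mono) simp
    then show "((\<lambda>t. if t \<le> x k then R t else 0) has_integral integral {x n..x (Suc n)} R) {x n..x (Suc n)}"
      by (intro has_integral_eq[OF _ integrable_integral[OF Rg]]) auto
  qed auto
  then show ?thesis
    by (rule has_integral_le[OF _ integrable_integral[OF R]]) (use pos in auto)
qed

section \<open>The cutoff functions and their values at the grid points\<close>

definition sq_sum :: "nat \<Rightarrow> real" where "sq_sum n = (\<Sum>j<n. (x (Suc j) - x j)\<^sup>2)"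

lemma sq_sum_mono: "m \<le> n \<Longrightarrow> sq_sum m \<le> sq_sum n"
  unfolding sq_sum_def by (intro sum_mono2) auto

lemma sq_sum_nonneg: "0 \<le> sq_sum n"
  unfolding sq_sum_def by (intro sum_nonneg) simp

lemma sq_sum_pos: "0 < k \<Longrightarrow> 0 < sq_sum k"
proof -
  assume "0 < k"
  have "0 < (x (Suc 0) - x 0)\<^sup>2" using x_less[of 0] by (intro zero_less_power) simp
  also have "\<dots> = sq_sum 1" by (simp add: sq_sum_def)
  also have "sq_sum 1 \<le> sq_sum k" using \<open>0 < k\<close> by (intro sq_sum_mono) simp
  finally show "0 < sq_sum k" .
qed

lemma sq_sum_at_top:
  assumes "\<not> summable (\<lambda>n. (x (Suc n) - x n)\<^sup>2)"
  shows "filterlim sq_sum at_top sequentially"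
  unfolding filterlim_at_top eventually_sequentially
proof
  fix B
  have "\<exists>n. B \<le> sq_sum n"
  proof (rule ccontr)
    assume "\<not> (\<exists>n. B \<le> sq_sum n)"
    then have "summable (\<lambda>n. (x (Suc n) - x n)\<^sup>2)"
      by (intro summableI_nonneg_bounded[of _ B]) (auto simp: sq_sum_def not_le intro: less_imp_le)
    then show False using assms by simp
  qed
  then obtain N where "B \<le> sq_sum N" ..
  then show "\<exists>N. \<forall>n\<ge>N. B \<le> sq_sum n" using sq_sum_mono order_trans by blast
qed

definition gap_arg :: "nat \<Rightarrow> real \<Rightarrow> real" where "gap_arg n t = (t - x n) / (x (Suc n) - x n)"

text \<open>
  On gap \<open>n < k\<close> the cutoff descends by \<open>(x (Suc n) - x n)\<^sup>2 / sq_sum k\<close>: with this choice its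
  second derivative is \<open>O(1 / sq_sum k)\<close> uniformly in \<open>n\<close>, which is where the divergence of the
  sum of squares enters.
\<close>

definition cut :: "nat \<Rightarrow> nat \<Rightarrow> real \<Rightarrow> real" where
  "cut k n t = (if n < k then 1 - (sq_sum n + (x (Suc n) - x n)\<^sup>2 * smoothstep (gap_arg n t)) / sq_sum k else 0)"
definition cut' :: "nat \<Rightarrow> nat \<Rightarrow> real \<Rightarrow> real" where
  "cut' k n t = (if n < k then - ((x (Suc n) - x n) * smoothstep' (gap_arg n t)) / sq_sum k else 0)"
definition cut'' :: "nat \<Rightarrow> nat \<Rightarrow> real \<Rightarrow> real" where
  "cut'' k n t = (if n < k then - smoothstep'' (gap_arg n t) / sq_sum k else 0)"

lemma DERIV_gap_arg: "(gap_arg n has_real_derivative 1 / (x (Suc n) - x n)) (at t)"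
  unfolding gap_arg_def[abs_def] using x_less[of n] by (auto intro!: derivative_eq_intros)

lemma continuous_on_gap_arg: "continuous_on T (gap_arg n)"
  by (intro continuous_at_imp_continuous_on ballI DERIV_isCont[OF DERIV_gap_arg])

lemma DERIV_cut: "(cut k n has_real_derivative cut' k n t) (at t)"
proof -
  have d: "x (Suc n) - x n \<noteq> 0" using x_less[of n] by simp
  have "((\<lambda>t. smoothstep (gap_arg n t)) has_real_derivative smoothstep' (gap_arg n t) * (1 / (x (Suc n) - x n))) (at t)"
    by (rule DERIV_chain2[OF DERIV_smoothstep(1) DERIV_gap_arg])
  then have "((\<lambda>t. 1 - (sq_sum n + (x (Suc n) - x n)\<^sup>2 * smoothstep (gap_arg n t)) / sq_sum k) has_real_derivative
     0 - (0 + (x (Suc n) - x n)\<^sup>2 * (smoothstep' (gap_arg n t) * (1 / (x (Suc n) - x n)))) / sq_sum k) (at t)"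
    by (intro DERIV_diff DERIV_add DERIV_const DERIV_cdivide DERIV_cmult)
  then show ?thesis using d by (simp add: cut_def[abs_def] cut'_def power2_eq_square)
qed

lemma DERIV_cut': "(cut' k n has_real_derivative cut'' k n t) (at t)"
proof -
  have d: "x (Suc n) - x n \<noteq> 0" using x_less[of n] by simp
  have "((\<lambda>t. smoothstep' (gap_arg n t)) has_real_derivative smoothstep'' (gap_arg n t) * (1 / (x (Suc n) - x n))) (at t)"
    by (rule DERIV_chain2[OF DERIV_smoothstep(2) DERIV_gap_arg])
  then have "((\<lambda>t. - ((x (Suc n) - x n) * smoothstep' (gap_arg n t)) / sq_sum k) has_real_derivative
     - ((x (Suc n) - x n) * (smoothstep'' (gap_arg n t) * (1 / (x (Suc n) - x n)))) / sq_sum k) (at t)"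
    by (intro DERIV_minus DERIV_cdivide DERIV_cmult)
  then show ?thesis using d by (simp add: cut'_def[abs_def] cut''_def)
qed

lemma continuous_on_cut: "continuous_on T (cut k n)" "continuous_on T (cut' k n)" "continuous_on T (cut'' k n)"
proof -
  show "continuous_on T (cut k n)" "continuous_on T (cut' k n)"
    by (intro continuous_at_imp_continuous_on ballI DERIV_isCont[OF DERIV_cut] DERIV_isCont[OF DERIV_cut'])+
  have "continuous_on T (\<lambda>t. smoothstep'' (gap_arg n t))"
    by (rule continuous_on_compose2[OF continuous_on_smoothstep(1)[of UNIV] continuous_on_gap_arg]) simp
  then show "continuous_on T (cut'' k n)" unfolding cut''_def by (cases "n < k") (auto intro!: continuous_intros simp: divide_inverse)
qed

lemma gap_arg_bounds: "t \<in> {x n..x (Suc n)} \<Longrightarrow> 0 \<le> gap_arg n t \<and> gap_arg n t \<le> 1"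
  unfolding gap_arg_def using x_less[of n] by auto

lemma cut_bounds:
  assumes "t \<in> {x n..x (Suc n)}"
  shows "0 \<le> cut k n t" "cut k n t \<le> 1" "\<bar>cut'' k n t\<bar> \<le> 60 / sq_sum k"
proof -
  note b = smoothstep_bounds[of "gap_arg n t"]
  have a: "0 \<le> gap_arg n t" "gap_arg n t \<le> 1" using gap_arg_bounds[OF assms] by auto
  have "(sq_sum n + (x (Suc n) - x n)\<^sup>2 * smoothstep (gap_arg n t)) \<le> sq_sum k" if "n < k"
  proof -
    have "(x (Suc n) - x n)\<^sup>2 * smoothstep (gap_arg n t) \<le> (x (Suc n) - x n)\<^sup>2 * 1"
      by (intro mult_left_mono b a) auto
    then have "(sq_sum n + (x (Suc n) - x n)\<^sup>2 * smoothstep (gap_arg n t)) \<le> sq_sum (Suc n)" by (simp add: sq_sum_def)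
    then show ?thesis using sq_sum_mono[of "Suc n" k] that by simp
  qed
  then show "0 \<le> cut k n t" unfolding cut_def using sq_sum_pos[of k] by auto
  have "0 \<le> sq_sum n + (x (Suc n) - x n)\<^sup>2 * smoothstep (gap_arg n t)" using sq_sum_nonneg b(1)[OF a] by simp
  then show "cut k n t \<le> 1" unfolding cut_def using sq_sum_nonneg[of k] by auto
  show "\<bar>cut'' k n t\<bar> \<le> 60 / sq_sum k"
    unfolding cut''_def using b(4)[OF a] sq_sum_nonneg[of k] by (auto intro: divide_right_mono)
qed

text \<open>Adjacent pieces fit together because the drops accumulate to partial sums of squares.
  The last nonzero piece, \<open>Suc n = k\<close>, ends with total drop 1, hence at 0, which is why
  the condition at the right end reads \<open>Suc n < k\<close>.\<close>

lemma cut_ends: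
  "cut k n (x n) = (if n < k then 1 - sq_sum n / sq_sum k else 0)"
  "cut k n (x (Suc n)) = (if Suc n < k then 1 - sq_sum (Suc n) / sq_sum k else 0)"
  "cut' k n (x n) = 0" "cut' k n (x (Suc n)) = 0"
proof -
  have a: "gap_arg n (x n) = 0" "gap_arg n (x (Suc n)) = 1" using x_less[of n] by (auto simp: gap_arg_def)
  show "cut k n (x n) = (if n < k then 1 - sq_sum n / sq_sum k else 0)" "cut' k n (x n) = 0" "cut' k n (x (Suc n)) = 0"
    by (auto simp: cut_def cut'_def a smoothstep_ends)
  have "sq_sum (Suc n) = sq_sum n + (x (Suc n) - x n)\<^sup>2" by (simp add: sq_sum_def)
  moreover have "sq_sum k \<noteq> 0" if "n < k" using sq_sum_pos[of k] that by simp
  moreover have "sq_sum k = sq_sum (Suc n)" if "n < k" "\<not> Suc n < k" using that by (metis Suc_lessI)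
  ultimately show "cut k n (x (Suc n)) = (if Suc n < k then 1 - sq_sum (Suc n) / sq_sum k else 0)"
    by (cases "n < k"; cases "Suc n < k") (simp_all add: cut_def a smoothstep_ends)
qed

lemma measurable_glue:
  assumes "\<And>n. continuous_on {x n..x (Suc n)} (P n)"
  shows "glue P \<in> borel_measurable M"
proof (rule measurable_gaps)
  fix n
  have "P n \<in> borel_measurable (lebesgue_on {x n<..<x (Suc n)})"
    by (rule L2_measurable[OF L2_continuous[OF assms]])
  moreover have "glue P t = P n t" if "t \<in> space (lebesgue_on {x n<..<x (Suc n)})" for t
    using that by (intro glue_eq) auto
  then have "glue P \<in> borel_measurable (lebesgue_on {x n<..<x (Suc n)}) \<longleftrightarrow> P n \<in> borel_measurable (lebesgue_on {x n<..<x (Suc n)})"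
    by (rule measurable_cong)
  ultimately show "glue P \<in> borel_measurable (lebesgue_on {x n<..<x (Suc n)})" by simp
qed

text \<open>The second derivative of the product consists of \<open>\<Phi> * w''\<close>, which
  converges by dominated convergence, of \<open>\<Phi>'' * w\<close>, which is small by the uniform
  bound on \<open>cut''\<close>, and of \<open>2 * \<Phi>' * w'\<close>, for which only the weighted
  bound on each gap is available. The assumption \<open>w 0 = R 0\<close> makes the product take at
  0 the value that \<open>H_preI\<close> prescribes.\<close>

lemma cutoff_in_closure:
  assumes dd: "delta_dom \<alpha> w w' w'' R R' L L'" and w0: "w 0 = R 0" and wL: "w \<in> L2 M" "w'' \<in> L2 M"
    and D: "\<And>n. x (Suc n) - x n \<le> D" and div: "\<not> summable (\<lambda>n. (x (Suc n) - x n)\<^sup>2)"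
  shows "(w, \<lambda>t. - w'' t) \<in> op_closure M (H_pre b x \<alpha>)"
proof -
  note W = delta_domD[OF dd]
  define \<Phi> where "\<Phi> k = glue (\<lambda>n t. complex_of_real (cut k n t))" for k
  define \<Phi>' where "\<Phi>' k = glue (\<lambda>n t. complex_of_real (cut' k n t))" for k
  define \<Phi>'' where "\<Phi>'' k = glue (\<lambda>n t. complex_of_real (cut'' k n t))" for k
  have meas: "\<Phi> k \<in> borel_measurable M" "\<Phi>' k \<in> borel_measurable M" "\<Phi>'' k \<in> borel_measurable M" for k
    unfolding \<Phi>_def \<Phi>'_def \<Phi>''_def by (intro measurable_glue continuous_intros continuous_on_cut)+
  have mem: "t \<in> {x (idx t)..x (Suc (idx t))}" if "t \<in> I" for t using exists_gap[OF that] by simp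
  have cgap: "W22_gap (x n) (x (Suc n)) (\<lambda>t. complex_of_real (cut k n t)) (\<lambda>t. complex_of_real (cut' k n t)) (\<lambda>t. complex_of_real (cut'' k n t))" for k n
    by (intro W22_gap_C2 has_vector_derivative_of_real continuous_intros continuous_on_cut)
      (use DERIV_cut DERIV_cut' in \<open>simp_all add: has_real_derivative_iff_has_vector_derivative\<close>)
  have \<Phi>gap: "W22_gap (x n) (x (Suc n)) (\<Phi> k) (\<Phi>' k) (\<Phi>'' k)" for k n
    by (rule W22_gap_cong[OF cgap]) (simp_all add: \<Phi>_def \<Phi>'_def \<Phi>''_def glue_eq[of _ n])
  define c where "c k n = complex_of_real (if n < k then 1 - sq_sum n / sq_sum k else 0)" for k n
  have lim\<Phi>: "(\<Phi> k \<longlongrightarrow> c k n) (at_right (x n))" "(\<Phi>' k \<longlongrightarrow> 0) (at_right (x n))"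
    "(\<Phi> k \<longlongrightarrow> c k (Suc n)) (at_left (x (Suc n)))" "(\<Phi>' k \<longlongrightarrow> 0) (at_left (x (Suc n)))" for k n
  proof -
    have cc: "continuous_on {x n..x (Suc n)} (\<lambda>t. complex_of_real (cut k n t))"
      "continuous_on {x n..x (Suc n)} (\<lambda>t. complex_of_real (cut' k n t))"
      by (intro continuous_intros continuous_on_cut)+
    show "(\<Phi> k \<longlongrightarrow> c k n) (at_right (x n))" "(\<Phi>' k \<longlongrightarrow> 0) (at_right (x n))"
      "(\<Phi> k \<longlongrightarrow> c k (Suc n)) (at_left (x (Suc n)))" "(\<Phi>' k \<longlongrightarrow> 0) (at_left (x (Suc n)))"
      unfolding \<Phi>_def \<Phi>'_def c_def
      using continuous_on_Icc_tendsto_ends[OF x_less cc(1) refl] continuous_on_Icc_tendsto_ends[OF x_less cc(2) refl]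
      by (auto intro!: glue_tendsto simp: cut_ends simp del: of_real_diff)
  qed
  have bd: "cmod (\<Phi> k t - 1) \<le> 1" "cmod (\<Phi>'' k t) \<le> 60 / sq_sum k" if "t \<in> I" for k t
  proof -
    have "\<Phi> k t - 1 = complex_of_real (cut k (idx t) t - 1)" by (simp add: \<Phi>_def glue_def)
    then have "cmod (\<Phi> k t - 1) = \<bar>cut k (idx t) t - 1\<bar>" by (simp only: norm_of_real)
    then show "cmod (\<Phi> k t - 1) \<le> 1" using cut_bounds(1,2)[OF mem[OF that], of k] by simp
    show "cmod (\<Phi>'' k t) \<le> 60 / sq_sum k" using cut_bounds(3)[OF mem[OF that], of k] by (simp add: \<Phi>''_def glue_def)
  qed
  have bd\<Phi>: "cmod (\<Phi> k t) \<le> 1" if "t \<in> I" for k t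
    using cut_bounds(1,2)[OF mem[OF that], of k] by (simp add: \<Phi>_def glue_def)
  \<comment> \<open>The index is shifted because \<open>sq_sum 0 = 0\<close>: only positive indices
    give genuine cutoffs.\<close>
  have \<Phi>1: "(\<lambda>k. \<Phi> (Suc k) t) \<longlonglongrightarrow> 1" if "t \<in> I" for t
  proof -
    let ?n = "idx t"
    have sq_sum: "filterlim (\<lambda>k. sq_sum (Suc k)) at_top sequentially"
      using sq_sum_at_top[OF div] by (simp add: filterlim_sequentially_Suc)
    have "(\<lambda>k. 1 - (sq_sum ?n + (x (Suc ?n) - x ?n)\<^sup>2 * smoothstep (gap_arg ?n t)) / sq_sum (Suc k)) \<longlonglongrightarrow> 1 - 0"
      by (intro tendsto_intros real_tendsto_divide_at_top[OF tendsto_const sq_sum])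
    moreover have "\<forall>\<^sub>F k in sequentially. 1 - (sq_sum ?n + (x (Suc ?n) - x ?n)\<^sup>2 * smoothstep (gap_arg ?n t)) / sq_sum (Suc k) = cut (Suc k) ?n t"
      using eventually_ge_at_top[of ?n] by eventually_elim (simp add: cut_def)
    ultimately have "(\<lambda>k. cut (Suc k) ?n t) \<longlonglongrightarrow> 1" by (simp add: tendsto_cong)
    then have "(\<lambda>k. complex_of_real (cut (Suc k) ?n t)) \<longlonglongrightarrow> complex_of_real 1" by (intro tendsto_of_real)
    then show ?thesis by (simp add: \<Phi>_def glue_def)
  qed
  define F where "F k t = \<Phi> k t * w t" for k t
  define F' where "F' k t = \<Phi> k t * w' t + \<Phi>' k t * w t" for k t
  define F'' where "F'' k t = \<Phi> k t * w'' t + 2 * (\<Phi>' k t * w' t) + \<Phi>'' k t * w t" for k t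
  \<comment> \<open>At a grid point the cutoff has slope 0, so the product has the limits of
    \<open>w\<close> and \<open>w'\<close> multiplied by the common value \<open>c\<close>, and the
    jump conditions survive. The summands \<open>0 * R n\<close> and \<open>0 * L n\<close> keep the
    shape of the product rule.\<close>
  have ddF: "delta_dom \<alpha> (F k) (F' k) (F'' k) (\<lambda>n. c k n * R n) (\<lambda>n. c k n * R' n + 0 * R n)
      (\<lambda>n. c k (Suc n) * L n) (\<lambda>n. c k (Suc n) * L' n + 0 * L n)" for k
    unfolding delta_dom_def F_def[abs_def] F'_def[abs_def] F''_def[abs_def]
    by (intro conjI allI W22_gap_mult[OF x_less \<Phi>gap W(1)] tendsto_intros lim\<Phi> W)
      (simp_all add: W(6,7,8) algebra_simps)
  have van: "\<Phi> k t = 0" "\<Phi>' k t = 0" "\<Phi>'' k t = 0" if "t \<in> I" "x k < t" for k t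
    unfolding \<Phi>_def \<Phi>'_def \<Phi>''_def by (rule glue_vanish[OF _ that]; simp add: cut_def cut'_def cut''_def)+
  have T: "(F k, \<lambda>t. - F'' k t) \<in> H_pre b x \<alpha>" if "k > 0" for k
  proof -
    have "idx 0 = 0" by (rule idx_eqI) (use x_less[of 0] x0 in auto)
    then have "F k 0 = c k 0 * R 0"
      using cut_ends(1)[of k 0] that x0 by (simp add: F_def \<Phi>_def glue_def c_def w0 sq_sum_def)
    moreover have "((F k)(0 := c k 0 * R 0), \<lambda>t. - F'' k t) \<in> H_pre b x \<alpha>"
      by (rule H_preI[OF ddF, of k k]) (auto simp: F_def F''_def van)
    ultimately show ?thesis by (metis fun_upd_triv)
  qed
  have \<Phi>L: "(\<lambda>t. \<Phi> k t * h t) \<in> L2 M" if "h \<in> L2 M" for h k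
    by (rule L2_mult_bounded[OF that meas(1), of _ 1]) (simp add: bd\<Phi>)
  have \<Phi>lim: "(\<lambda>k. L2_dist M (\<lambda>t. \<Phi> (Suc k) t * h t) h) \<longlonglongrightarrow> 0" if h: "h \<in> L2 M" for h
  proof (rule L2_dominated_convergence[OF \<Phi>L[OF h] h h negligible_empty])
    fix k t assume t: "t \<in> I - {}"
    have "\<Phi> (Suc k) t * h t - h t = (\<Phi> (Suc k) t - 1) * h t" by (simp add: algebra_simps)
    then have "cmod (\<Phi> (Suc k) t * h t - h t) = cmod (\<Phi> (Suc k) t - 1) * cmod (h t)" by (simp add: norm_mult)
    then show "cmod (\<Phi> (Suc k) t * h t - h t) \<le> cmod (h t)"
      using bd(1)[of t "Suc k"] t by (simp add: mult_left_le_one_le)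
  next
    fix t assume "t \<in> I - {}"
    then have "(\<lambda>k. \<Phi> (Suc k) t * h t) \<longlonglongrightarrow> 1 * h t" by (intro tendsto_intros \<Phi>1) auto
    then show "(\<lambda>k. \<Phi> (Suc k) t * h t) \<longlonglongrightarrow> h t" by simp
  qed
  have 1: "(\<lambda>k. L2_dist M (F (Suc k)) w) \<longlonglongrightarrow> 0"
    using \<Phi>lim[OF wL(1)] by (simp add: F_def[abs_def])
  define A where "A k t = \<Phi> k t * w'' t" for k t
  define B where "B k t = 2 * (\<Phi>' k t * w' t)" for k t
  define C where "C k t = \<Phi>'' k t * w t" for k t
  have AL: "A k \<in> L2 M" for k unfolding A_def by (rule \<Phi>L[OF wL(2)])
  have CL: "C k \<in> L2 M" for k unfolding C_def
    by (rule L2_mult_bounded[OF wL(1) meas(3), of _ "60 / sq_sum k"]) (simp add: bd)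
  have BL: "B k \<in> L2 M" for k
  proof (rule L2_gaps[of _ k])
    show "B k \<in> L2 (lebesgue_on {x n<..<x (Suc n)})" for n unfolding B_def
      by (intro L2_cmult L2_gap_mult(2)[OF x_less \<Phi>gap] W22_gap_L2(2)[OF x_less W(1)])
  qed (simp add: B_def van)
  have a: "(\<lambda>k. L2_dist M (A (Suc k)) w'') \<longlonglongrightarrow> 0"
    using \<Phi>lim[OF wL(2)] by (simp add: A_def[abs_def])
  have inv0: "(\<lambda>k. K / sq_sum (Suc k)) \<longlonglongrightarrow> 0" for K
    using sq_sum_at_top[OF div] by (intro real_tendsto_divide_at_top[OF tendsto_const]) (simp add: filterlim_sequentially_Suc)
  have c0: "(\<lambda>k. L2_dist M (C (Suc k)) (\<lambda>_. 0)) \<longlonglongrightarrow> 0"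
  proof -
    have le: "L2_dist M (C k) (\<lambda>_. 0) \<le> 60 / sq_sum k * L2_dist M w (\<lambda>_. 0)" if "k > 0" for k
    proof -
      have "(\<integral>t. (cmod (C k t))\<^sup>2 \<partial>M) \<le> (\<integral>t. (60 / sq_sum k)\<^sup>2 * (cmod (w t))\<^sup>2 \<partial>M)"
      proof (rule integral_mono)
        show "(cmod (C k t))\<^sup>2 \<le> (60 / sq_sum k)\<^sup>2 * (cmod (w t))\<^sup>2" if "t \<in> space M" for t
          unfolding C_def norm_mult power_mult_distrib
          using bd(2)[of t k] that by (intro mult_right_mono power_mono) auto
      qed (use L2_integrable_square[OF CL] L2_integrable_square[OF wL(1)] in auto)
      then have "sqrt (\<integral>t. (cmod (C k t))\<^sup>2 \<partial>M) \<le> sqrt ((60 / sq_sum k)\<^sup>2 * (\<integral>t. (cmod (w t))\<^sup>2 \<partial>M))" by simp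
      also have "\<dots> = 60 / sq_sum k * sqrt (\<integral>t. (cmod (w t))\<^sup>2 \<partial>M)"
        using sq_sum_pos[OF that] by (simp add: real_sqrt_mult)
      finally show ?thesis by (simp add: L2_dist_def)
    qed
    have "(\<lambda>k. 60 / sq_sum (Suc k) * L2_dist M w (\<lambda>_. 0)) \<longlonglongrightarrow> 0 * L2_dist M w (\<lambda>_. 0)"
      by (intro tendsto_intros inv0)
    then have "(\<lambda>k. 60 / sq_sum (Suc k) * L2_dist M w (\<lambda>_. 0)) \<longlonglongrightarrow> 0" by simp
    then show ?thesis
      by (rule Lim_null_comparison[OF always_eventually, rotated]) (use le in \<open>auto simp: abs_of_nonneg L2_dist_nonneg\<close>)
  qed
  \<comment> \<open>\<open>P\<close> and 60 bound the weight \<open>\<psi>\<close> chosen below and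
    its derivative on every gap, so \<open>Rh\<close> is the right-hand side of
    \<open>weighted_derivative_bound\<close> with constants independent of the gap and of
    \<open>k\<close>. Here the bound \<open>D\<close> on the gap lengths enters.\<close>
  define P where "P = 30 * D"
  define Rh where "Rh t = (4 * 60\<^sup>2 + 1) * (cmod (w t))\<^sup>2 + P ^ 4 * (cmod (w'' t))\<^sup>2" for t
  define J where "J = integral I Rh"
  have Rh: "integrable M Rh" unfolding Rh_def using L2_integrable_square[OF wL(1)] L2_integrable_square[OF wL(2)] by simp
  have Rhi: "Rh integrable_on I" by (rule integrable_on_lebesgue_on[OF Rh]) simp
  have P0: "0 \<le> P" using D[of 0] x_less[of 0] by (simp add: P_def)
  have b0: "(\<lambda>k. L2_dist M (B (Suc k)) (\<lambda>_. 0)) \<longlonglongrightarrow> 0"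
  proof -
    have le: "L2_dist M (B k) (\<lambda>_. 0) \<le> 2 * sqrt J / sq_sum k" if k: "k > 0" for k
    proof -
      have gapint: "((\<lambda>t. (cmod (B k t))\<^sup>2) has_integral integral {x n..x (Suc n)} (\<lambda>t. (cmod (B k t))\<^sup>2)) {x n..x (Suc n)} \<and>
          integral {x n..x (Suc n)} (\<lambda>t. (cmod (B k t))\<^sup>2) \<le> 4 / (sq_sum k)\<^sup>2 * integral {x n..x (Suc n)} Rh" if n: "n < k" for n
      proof -
        \<comment> \<open>Up to the sign and the factor \<open>sq_sum k\<close> this is
          \<open>cut' k n\<close>. The gap length in front cancels the inner derivative of
          \<open>gap_arg\<close>, so the derivative of \<open>\<psi>\<close> is bounded uniformly in
          the gap.\<close>
        define \<psi> where "\<psi> t = (x (Suc n) - x n) * smoothstep' (gap_arg n t)" for t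
        have d: "0 < x (Suc n) - x n" using x_less[of n] by simp
        have d\<psi>: "(\<psi> has_real_derivative smoothstep'' (gap_arg n t)) (at t)" for t
        proof -
          have "((\<lambda>t. smoothstep' (gap_arg n t)) has_real_derivative smoothstep'' (gap_arg n t) * (1 / (x (Suc n) - x n))) (at t)"
            by (rule DERIV_chain2[OF DERIV_smoothstep(2) DERIV_gap_arg])
          from DERIV_cmult[OF this, of "x (Suc n) - x n"] show ?thesis using d by (simp add: \<psi>_def[abs_def])
        qed
        have c\<psi>': "continuous_on UNIV (\<lambda>t. smoothstep'' (gap_arg n t))"
          by (rule continuous_on_compose2[OF continuous_on_smoothstep(1)[of UNIV] continuous_on_gap_arg]) simp
        have e\<psi>: "\<psi> (x n) = 0" "\<psi> (x (Suc n)) = 0"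
          using d by (simp_all add: \<psi>_def gap_arg_def smoothstep_ends)
        have b\<psi>: "\<bar>\<psi> t\<bar> \<le> P" "\<bar>smoothstep'' (gap_arg n t)\<bar> \<le> 60" if "t \<in> {x n..x (Suc n)}" for t
        proof -
          have ab: "0 \<le> gap_arg n t" "gap_arg n t \<le> 1" using gap_arg_bounds[OF that] by auto
          show "\<bar>smoothstep'' (gap_arg n t)\<bar> \<le> 60" by (rule smoothstep_bounds[OF ab])
          have "\<bar>\<psi> t\<bar> = (x (Suc n) - x n) * \<bar>smoothstep' (gap_arg n t)\<bar>" using d by (simp add: \<psi>_def abs_mult)
          also have "\<dots> \<le> D * 30" using d D[of n] smoothstep_bounds(3)[OF ab] by (intro mult_mono) auto
          finally show "\<bar>\<psi> t\<bar> \<le> P" by (simp add: P_def)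
        qed
        note wd = weighted_derivative_bound[OF x_less W(1) d\<psi> c\<psi>' e\<psi> b\<psi>]
        have "((\<lambda>t. 4 / (sq_sum k)\<^sup>2 * ((\<psi> t)\<^sup>2 * (cmod (w' t))\<^sup>2)) has_integral
            4 / (sq_sum k)\<^sup>2 * integral {x n..x (Suc n)} (\<lambda>t. (\<psi> t)\<^sup>2 * (cmod (w' t))\<^sup>2)) {x n..x (Suc n)}"
          by (intro has_integral_mult_right integrable_integral wd(1))
        then have hi: "((\<lambda>t. (cmod (B k t))\<^sup>2) has_integral
            4 / (sq_sum k)\<^sup>2 * integral {x n..x (Suc n)} (\<lambda>t. (\<psi> t)\<^sup>2 * (cmod (w' t))\<^sup>2)) {x n..x (Suc n)}"
        \<comment> \<open>The right end is excluded because \<open>glue\<close> already uses the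
          next piece there.\<close>
        proof (rule has_integral_spike[of "{x (Suc n)}", rotated 2])
          fix t assume "t \<in> {x n..x (Suc n)} - {x (Suc n)}"
          then have "\<Phi>' k t = complex_of_real (cut' k n t)" unfolding \<Phi>'_def by (intro glue_eq) auto
          then have "cmod (B k t) = 2 * (\<bar>cut' k n t\<bar> * cmod (w' t))"
            by (simp add: B_def norm_mult)
          then have "(cmod (B k t))\<^sup>2 = 4 * ((cut' k n t)\<^sup>2 * (cmod (w' t))\<^sup>2)"
            by (simp add: power_mult_distrib)
          moreover have "cut' k n t = - \<psi> t / sq_sum k" using n by (simp add: cut'_def \<psi>_def)
          ultimately show "(cmod (B k t))\<^sup>2 = 4 / (sq_sum k)\<^sup>2 * ((\<psi> t)\<^sup>2 * (cmod (w' t))\<^sup>2)"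
            by (simp add: power_divide)
        qed simp
        have "4 / (sq_sum k)\<^sup>2 * integral {x n..x (Suc n)} (\<lambda>t. (\<psi> t)\<^sup>2 * (cmod (w' t))\<^sup>2) \<le> 4 / (sq_sum k)\<^sup>2 * integral {x n..x (Suc n)} Rh"
          using wd(2) unfolding Rh_def by (intro mult_left_mono) auto
        then show ?thesis using hi integral_unique[OF hi] by simp
      qed
      have "((\<lambda>t. (cmod (B k t))\<^sup>2) has_integral (\<Sum>n<k. integral {x n..x (Suc n)} (\<lambda>t. (cmod (B k t))\<^sup>2))) I"
        by (rule has_integral_gaps[OF _ negligible_empty]) (use gapint van in \<open>auto simp: B_def\<close>)
      then have "(\<integral>t. (cmod (B k t))\<^sup>2 \<partial>M) = (\<Sum>n<k. integral {x n..x (Suc n)} (\<lambda>t. (cmod (B k t))\<^sup>2))"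
        using lebesgue_integral_eq_integral[OF L2_integrable_square[OF BL[of k]]] by (simp add: integral_unique)
      also have "\<dots> \<le> (\<Sum>n<k. 4 / (sq_sum k)\<^sup>2 * integral {x n..x (Suc n)} Rh)"
        by (rule sum_mono) (use gapint in auto)
      also have "\<dots> = 4 / (sq_sum k)\<^sup>2 * (\<Sum>n<k. integral {x n..x (Suc n)} Rh)" by (simp only: sum_distrib_left)
      also have "\<dots> \<le> 4 / (sq_sum k)\<^sup>2 * J"
        unfolding J_def using P0 by (intro mult_left_mono sum_gaps_le Rhi) (auto simp: Rh_def)
      finally have "L2_dist M (B k) (\<lambda>_. 0) \<le> sqrt (4 / (sq_sum k)\<^sup>2 * J)" by (simp add: L2_dist_def)
      also have "\<dots> = 2 * sqrt J / sq_sum k"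
        using sq_sum_pos[OF k] by (simp add: real_sqrt_mult real_sqrt_divide)
      finally show ?thesis .
    qed
    show ?thesis
      by (rule Lim_null_comparison[OF always_eventually inv0[of "2 * sqrt J"]]) (use le in \<open>auto simp: abs_of_nonneg L2_dist_nonneg\<close>)
  qed
  have 2: "(\<lambda>k. L2_dist M (\<lambda>t. - F'' (Suc k) t) (\<lambda>t. - w'' t)) \<longlonglongrightarrow> 0"
  proof (rule Lim_null_comparison[OF always_eventually])
    show "(\<lambda>k. L2_dist M (A (Suc k)) w'' + (L2_dist M (B (Suc k)) (\<lambda>_. 0) + L2_dist M (C (Suc k)) (\<lambda>_. 0))) \<longlonglongrightarrow> 0"
      using tendsto_add[OF a tendsto_add[OF b0 c0]] by simp
    show "\<forall>k. norm (L2_dist M (\<lambda>t. - F'' (Suc k) t) (\<lambda>t. - w'' t)) \<le>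
      L2_dist M (A (Suc k)) w'' + (L2_dist M (B (Suc k)) (\<lambda>_. 0) + L2_dist M (C (Suc k)) (\<lambda>_. 0))"
    proof
      fix k
      have "L2_dist M (\<lambda>t. - F'' (Suc k) t) (\<lambda>t. - w'' t) = L2_dist M (\<lambda>t. (A (Suc k) t - w'' t) + (B (Suc k) t + C (Suc k) t)) (\<lambda>_. 0)"
        unfolding L2_dist_def by (simp add: F''_def A_def B_def C_def norm_minus_commute add.assoc algebra_simps)
      also have "\<dots> \<le> L2_dist M (\<lambda>t. A (Suc k) t - w'' t) (\<lambda>_. 0) + L2_dist M (\<lambda>t. B (Suc k) t + C (Suc k) t) (\<lambda>_. 0)"
        by (intro L2_norm_add L2_diff L2_add AL BL CL wL)
      also have "\<dots> \<le> L2_dist M (A (Suc k)) w'' + (L2_dist M (B (Suc k)) (\<lambda>_. 0) + L2_dist M (C (Suc k)) (\<lambda>_. 0))"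
        using L2_norm_add[OF BL CL, of "Suc k" "Suc k"] by (simp add: L2_dist_diff[of M "A (Suc k)" w''])
      finally show "norm (L2_dist M (\<lambda>t. - F'' (Suc k) t) (\<lambda>t. - w'' t)) \<le>
        L2_dist M (A (Suc k)) w'' + (L2_dist M (B (Suc k)) (\<lambda>_. 0) + L2_dist M (C (Suc k)) (\<lambda>_. 0))"
        by (simp add: abs_of_nonneg L2_dist_nonneg)
    qed
  qed
  have "\<exists>U V. (\<forall>k::nat. (U k, V k) \<in> H_pre b x \<alpha>) \<and> (\<lambda>k. L2_dist M (U k) w) \<longlonglongrightarrow> 0 \<and>
      (\<lambda>k. L2_dist M (V k) (\<lambda>t. - w'' t)) \<longlonglongrightarrow> 0"
    by (rule exI[of _ "\<lambda>k. F (Suc k)"], rule exI[of _ "\<lambda>k t. - F'' (Suc k) t"]) (use T 1 2 in simp)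
  then show ?thesis using wL(1) L2_uminus[OF wL(2)] by (simp add: op_closure_def)
qed

end

section \<open>Density of the domain\<close>

text \<open>The radial retraction onto the closed ball of radius \<open>B\<close>. It bounds values
  while preserving continuity; the \<open>max\<close> avoids a quotient by \<open>cmod z\<close> at
  0.\<close>

definition clamp_norm :: "real \<Rightarrow> complex \<Rightarrow> complex" where
  "clamp_norm B z = complex_of_real (B / max B (cmod z)) * z"

lemma clamp_norm_eq: "cmod z \<le> B \<Longrightarrow> 0 < B \<Longrightarrow> clamp_norm B z = z"
  by (simp add: clamp_norm_def max_absorb1)

lemma cmod_clamp_norm_le: "0 < B \<Longrightarrow> cmod (clamp_norm B z) \<le> B" "0 < B \<Longrightarrow> cmod (clamp_norm B z - z) \<le> cmod z"
proof -
  assume B: "0 < B"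
  define r where "r = B / max B (cmod z)"
  have m: "0 < max B (cmod z)" using B by simp
  have r: "0 \<le> r" "r \<le> 1" using B m by (simp_all add: r_def)
  have "B * cmod z \<le> B * max B (cmod z)" using B by (intro mult_left_mono) auto
  then have rB: "r * cmod z \<le> B" using m by (simp add: r_def divide_le_eq)
  show "cmod (clamp_norm B z) \<le> B" using r rB by (simp add: clamp_norm_def norm_mult flip: r_def)
  have "clamp_norm B z - z = complex_of_real (r - 1) * z" by (simp add: clamp_norm_def r_def algebra_simps)
  then have "cmod (clamp_norm B z - z) = \<bar>r - 1\<bar> * cmod z" by (simp only: norm_mult norm_of_real)
  also have "\<dots> \<le> 1 * cmod z" using r by (intro mult_right_mono) auto
  finally show "cmod (clamp_norm B z - z) \<le> cmod z" by simp
qed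

lemma continuous_on_clamp_norm: "0 < B \<Longrightarrow> continuous_on S (clamp_norm B)"
  unfolding clamp_norm_def[abs_def] by (intro continuous_intros) (auto simp: max_def)

context point_grid
begin

abbreviation trunc :: "nat \<Rightarrow> (real \<Rightarrow> complex) \<Rightarrow> real \<Rightarrow> complex" where
  "trunc N g \<equiv> \<lambda>t. if t \<le> x N then g t else 0"

lemma trunc_L2:
  assumes "continuous_on UNIV g"
  shows "trunc N g \<in> L2 M"
proof (rule L2_gaps[of _ N])
  show "trunc N g \<in> L2 (lebesgue_on {x n<..<x (Suc n)})" for n
  proof (cases "n < N")
    case True
    then have "x (Suc n) \<le> x N" by (intro x_mono) simp
    then show ?thesis
      by (intro L2_cong_space[OF L2_continuous[OF continuous_on_subset[OF assms]]]) auto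
  next
    case False
    then have "x N \<le> x n" by (intro x_mono) simp
    then show ?thesis
      by (intro L2_cong_space[OF L2_continuous[of "x n" "x (Suc n)" "\<lambda>_. 0"]]) auto
  qed
qed simp

text \<open>On each gap \<open>p\<close> is multiplied by a polynomial \<open>\<kappa>\<close>,
  where \<open>s n\<close> is the parabola that vanishes at both ends of the gap and has maximum 1.
  Because \<open>s\<close> enters squared, \<open>\<kappa>\<close> has zeros of order at least two
  at the ends, so the product meets every boundary and jump condition with zero data, whatever
  \<alpha> is. Inside the gap \<open>\<kappa>\<close> stays between 0 and 1 and tends to 1, so
  dominated convergence applies.\<close>

lemma trunc_polynomial_approx:
  assumes p: "polynomial_function p" and e: "0 < e"
  obtains g h where "(g, h) \<in> H_pre b x \<alpha>" "L2_dist M g (trunc N p) < e"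
proof -
  define s where "s n t = 4 * (t - x n) * (x (Suc n) - t) / (x (Suc n) - x n)\<^sup>2" for n t
  define \<kappa> where "\<kappa> k n t = 1 - (1 - (s n t)\<^sup>2) ^ k" for k n t
  have rs: "real_polynomial_function (s n)" for n
  proof -
    have "s n = (\<lambda>t. (4 / (x (Suc n) - x n)\<^sup>2) * ((t - x n) * (x (Suc n) - t)))" by (simp add: s_def fun_eq_iff)
    moreover have "real_polynomial_function (\<lambda>t::real. t)"
      by (rule real_polynomial_function.intros(1)[OF bounded_linear_ident])
    ultimately show ?thesis
      by (simp only:) (intro real_polynomial_function.intros(4) real_polynomial_function_diff real_polynomial_function.intros(2))
  qed
  have "polynomial_function (\<kappa> k n)" for k n
    unfolding \<kappa>_def real_polynomial_function_eq[symmetric]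
    by (intro real_polynomial_function_diff real_polynomial_function_power real_polynomial_function.intros rs)
  then have P: "polynomial_function (\<lambda>t. \<kappa> k n t *\<^sub>R p t)" for k n by (intro polynomial_function_mult p)
  have "\<exists>q' q''. (\<forall>t. ((\<lambda>t. \<kappa> k n t *\<^sub>R p t) has_vector_derivative q' t) (at t)) \<and>
     (\<forall>t. (q' has_vector_derivative q'' t) (at t)) \<and> continuous_on UNIV q''" for k n
  proof -
    obtain q' where q': "polynomial_function q'" "\<And>t. ((\<lambda>t. \<kappa> k n t *\<^sub>R p t) has_vector_derivative q' t) (at t)"
      by (rule has_vector_derivative_polynomial_function[OF P]) (rule that)
    obtain q'' where "polynomial_function q''" "\<And>t. (q' has_vector_derivative q'' t) (at t)"
      by (rule has_vector_derivative_polynomial_function[OF q'(1)]) (rule that)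
    then show ?thesis using q'(2) continuous_on_polymonial_function by blast
  qed
  then obtain q' q'' where q: "\<And>k n t. ((\<lambda>t. \<kappa> k n t *\<^sub>R p t) has_vector_derivative q' k n t) (at t)"
     "\<And>k n t. (q' k n has_vector_derivative q'' k n t) (at t)" "\<And>k n. continuous_on UNIV (q'' k n)" by metis
  obtain p' where p': "\<And>t. (p has_vector_derivative p' t) (at t)"
    using has_vector_derivative_polynomial_function[OF p] by metis
  have s0: "s n (x n) = 0" "s n (x (Suc n)) = 0" for n by (simp_all add: s_def)
  have sb: "0 \<le> s n t" "s n t \<le> 1" if "t \<in> {x n..x (Suc n)}" for n t
  proof -
    have d: "0 < x (Suc n) - x n" using x_less[of n] by simp
    show "0 \<le> s n t" using that by (simp add: s_def)
    have "0 \<le> ((t - x n) - (x (Suc n) - t))\<^sup>2" by simp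
    also have "\<dots> = (x (Suc n) - x n)\<^sup>2 - 4 * (t - x n) * (x (Suc n) - t)" by (simp add: power2_eq_square algebra_simps)
    finally show "s n t \<le> 1" using d by (simp add: s_def divide_le_eq)
  qed
  have D\<kappa>: "(\<kappa> k n has_real_derivative 0) (at t)" and \<kappa>0: "k > 0 \<Longrightarrow> \<kappa> k n t = 0" if "s n t = 0" for k n t
  proof -
    obtain s' where s': "(s n has_vector_derivative s') (at t)"
      using has_vector_derivative_polynomial_function[of "s n"] rs[of n] real_polynomial_function_eq by metis
    have "(\<kappa> k n has_real_derivative 0 - real k * ((1 - (s n t)\<^sup>2) ^ (k - 1)) * (0 - real 2 * (s n t) ^ (2 - 1) * s')) (at t)"
      unfolding \<kappa>_def
      by (intro DERIV_diff DERIV_const DERIV_power[THEN DERIV_cong] s'[folded has_real_derivative_iff_has_vector_derivative])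
        (auto simp: algebra_simps intro!: DERIV_diff DERIV_const DERIV_power[THEN DERIV_cong] s'[folded has_real_derivative_iff_has_vector_derivative])
    then show "(\<kappa> k n has_real_derivative 0) (at t)" using that by simp
    show "k > 0 \<Longrightarrow> \<kappa> k n t = 0" using that by (simp add: \<kappa>_def)
  qed
  have q0: "q' k n t = 0" if z: "s n t = 0" and k: "k > 0" for k n t
  proof -
    have "((\<lambda>t. \<kappa> k n t *\<^sub>R p t) has_vector_derivative \<kappa> k n t *\<^sub>R p' t + 0 *\<^sub>R p t) (at t)"
      by (intro has_vector_derivative_scaleR D\<kappa> p' z)
    then have "((\<lambda>t. \<kappa> k n t *\<^sub>R p t) has_vector_derivative 0) (at t)" by (simp add: \<kappa>0[OF z k])
    then show ?thesis using q(1) vector_derivative_unique_at by blast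
  qed
  define F where "F k = glue (\<lambda>n t. if n < N then \<kappa> k n t *\<^sub>R p t else 0)" for k
  define F' where "F' k = glue (\<lambda>n t. if n < N then q' k n t else 0)" for k
  define F'' where "F'' k = glue (\<lambda>n t. if n < N then q'' k n t else 0)" for k
  have dd: "delta_dom \<alpha> (F k) (F' k) (F'' k) (\<lambda>_. 0) (\<lambda>_. 0) (\<lambda>_. 0) (\<lambda>_. 0)" if k: "k > 0" for k
    unfolding F_def F'_def F''_def
  proof (rule delta_dom_glue)
    fix n
    let ?P = "\<lambda>t. if n < N then \<kappa> k n t *\<^sub>R p t else 0" and ?P' = "\<lambda>t. if n < N then q' k n t else 0"
      and ?P'' = "\<lambda>t. if n < N then q'' k n t else 0"
    have d: "(?P has_vector_derivative ?P' t) (at t)" "(?P' has_vector_derivative ?P'' t) (at t)" "continuous_on UNIV ?P''" for t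
      by (cases "n < N"; simp add: q)+
    show "W22_gap (x n) (x (Suc n)) ?P ?P' ?P''" by (rule W22_gap_C2[OF d])
    have c: "continuous_on {x n..x (Suc n)} ?P" "continuous_on {x n..x (Suc n)} ?P'"
      by (intro continuous_at_imp_continuous_on ballI has_vector_derivative_continuous[OF d(1)] has_vector_derivative_continuous[OF d(2)])+
    have e: "?P (x n) = 0" "?P (x (Suc n)) = 0" "?P' (x n) = 0" "?P' (x (Suc n)) = 0"
      using \<kappa>0[OF s0(1) k] \<kappa>0[OF s0(2) k] q0[OF s0(1) k] q0[OF s0(2) k] by simp_all
    show "(?P \<longlongrightarrow> 0) (at_right (x n))" "(?P \<longlongrightarrow> 0) (at_left (x (Suc n)))"
      using continuous_on_Icc_tendsto_ends[OF x_less c(1) refl] unfolding e .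
    show "(?P' \<longlongrightarrow> 0) (at_right (x n))" "(?P' \<longlongrightarrow> 0) (at_left (x (Suc n)))"
      using continuous_on_Icc_tendsto_ends[OF x_less c(2) refl] unfolding e .
  qed simp_all
  have T: "((F k)(0 := 0), \<lambda>t. - F'' k t) \<in> H_pre b x \<alpha>" if k: "k > 0" for k
    by (rule H_preI[OF dd[OF k], of N]) (unfold F_def F''_def, rule glue_vanish[of N]; simp)+
  have cp: "continuous_on UNIV p" by (rule continuous_on_polymonial_function[OF p])
  have "(\<lambda>k. L2_dist M ((F (Suc k))(0 := 0)) (trunc N p)) \<longlonglongrightarrow> 0"
  proof (rule L2_dominated_convergence[OF _ trunc_L2[OF cp] trunc_L2[OF cp] negligible_range_x])
    show "(F (Suc k))(0 := 0) \<in> L2 M" for k using H_pre_L2[OF T] by blast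
    fix t assume t: "t \<in> I - range x"
    then obtain n where n: "t \<in> {x n<..<x (Suc n)}" by (rule I_minus_cases)
    then have tn: "t \<in> {x n..x (Suc n)}" by simp
    have t0: "t \<noteq> 0" using n x_nonneg[of n] by auto
    have F: "F k t = (if n < N then \<kappa> k n t *\<^sub>R p t else 0)" for k
      unfolding F_def using n by (intro glue_eq) auto
    have tr: "trunc N p t = (if n < N then p t else 0)"
      using n x_mono[of "Suc n" N] x_mono[of N n] by auto
    have "0 \<le> (s n t)\<^sup>2" "(s n t)\<^sup>2 \<le> 1" using sb[OF tn] by (auto simp: power_le_one)
    then have c01: "0 \<le> (1 - (s n t)\<^sup>2) ^ k" "(1 - (s n t)\<^sup>2) ^ k \<le> 1" for k by (auto intro: power_le_one)
    show "cmod (((F (Suc k))(0 := 0)) t - trunc N p t) \<le> cmod (trunc N p t)" for k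
    proof (cases "n < N")
      case True
      have "F (Suc k) t - p t = (- ((1 - (s n t)\<^sup>2) ^ Suc k)) *\<^sub>R p t"
        using True by (simp add: F \<kappa>_def algebra_simps)
      then have "cmod (F (Suc k) t - p t) = (1 - (s n t)\<^sup>2) ^ Suc k * cmod (p t)"
        using c01(1)[of "Suc k"] by (simp only: norm_scaleR abs_minus_cancel abs_of_nonneg)
      also have "\<dots> \<le> 1 * cmod (p t)" using c01(2)[of "Suc k"] by (intro mult_right_mono) auto
      finally show ?thesis using True t0 unfolding tr by simp
    next
      case False then show ?thesis using t0 F unfolding tr by simp
    qed
    have "0 < s n t" using n x_less[of n] by (simp add: s_def)
    then have "0 < (s n t)\<^sup>2" by simp
    then have pow: "(\<lambda>k. (1 - (s n t)\<^sup>2) ^ k) \<longlonglongrightarrow> 0"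
      using \<open>(s n t)\<^sup>2 \<le> 1\<close> by (intro LIMSEQ_realpow_zero) auto
    have "(\<lambda>k. \<kappa> k n t *\<^sub>R p t) \<longlonglongrightarrow> (1 - 0) *\<^sub>R p t"
      unfolding \<kappa>_def by (rule tendsto_scaleR[OF tendsto_diff[OF tendsto_const pow] tendsto_const])
    from LIMSEQ_Suc[OF this] have "(\<lambda>k. \<kappa> (Suc k) n t *\<^sub>R p t) \<longlonglongrightarrow> p t" by simp
    then show "(\<lambda>k. ((F (Suc k))(0 := 0)) t) \<longlonglongrightarrow> trunc N p t" using t0 unfolding tr by (simp add: F)
  qed
  then have "\<forall>\<^sub>F k in sequentially. L2_dist M ((F (Suc k))(0 := 0)) (trunc N p) < e"
    by (rule order_tendstoD(2)) (rule e)
  then obtain k where "L2_dist M ((F (Suc k))(0 := 0)) (trunc N p) < e"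
    unfolding eventually_sequentially by blast
  then show thesis by (rule that[OF T, rotated]) simp
qed

text \<open>Four approximations with error \<open>e / 4\<close> each: cut off and clamp
  \<open>f\<close>, replace it by a continuous function, replace that by a polynomial on
  \<open>{0..x N}\<close>, and bend the polynomial to 0 at the grid points. Clamping comes first
  because the continuous functions obtained from measurability converge only pointwise almost
  everywhere; once they are clamped too, \<open>2 * B\<close> on \<open>{0..x N}\<close> is a
  majorant.\<close>

lemma H_pre_dense: "densely_defined M (H_pre b x \<alpha>)"
  unfolding densely_defined_def
proof (intro ballI allI impI)
  fix f and e :: real assume f: "f \<in> L2 M" and e: "e > 0"
  have e4: "e / 4 > 0" using e by simp
  have ex: "\<exists>k::nat. d k < e / 4" if "d \<longlonglongrightarrow> 0" for d :: "nat \<Rightarrow> real"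
    using order_tendstoD(2)[OF that e4] unfolding eventually_sequentially by blast
  define f1 where "f1 k t = trunc (Suc k) (\<lambda>t. clamp_norm (real (Suc k)) (f t)) t" for k t
  have f1L: "f1 k \<in> L2 M" for k
  proof (rule L2_cong_space[OF L2_mult_bounded[OF f]])
    have [measurable]: "f \<in> borel_measurable M" by (rule L2_measurable[OF f])
    have [measurable]: "(\<lambda>t::real. t) \<in> borel_measurable M"
      by (intro continuous_imp_measurable_on_sets_lebesgue continuous_intros) simp
    show "(\<lambda>t. complex_of_real (if t \<le> x (Suc k) then real (Suc k) / max (real (Suc k)) (cmod (f t)) else 0)) \<in> borel_measurable M"
      by measurable
    show "cmod (complex_of_real (if t \<le> x (Suc k) then real (Suc k) / max (real (Suc k)) (cmod (f t)) else 0)) \<le> 1" for t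
      by (auto simp: max_def divide_le_eq simp del: of_nat_Suc)
    show "f1 k t = complex_of_real (if t \<le> x (Suc k) then real (Suc k) / max (real (Suc k)) (cmod (f t)) else 0) * f t" for t
      by (simp add: f1_def clamp_norm_def)
  qed
  have "(\<lambda>k. L2_dist M (f1 k) f) \<longlonglongrightarrow> 0"
  proof (rule L2_dominated_convergence[OF f1L f f negligible_empty])
    show "cmod (f1 k t - f t) \<le> cmod (f t)" for k t
      unfolding f1_def using cmod_clamp_norm_le(2)[of "real (Suc k)" "f t"] by (auto simp del: of_nat_Suc)
    fix t assume t: "t \<in> I - {}"
    have "f1 k t = f t" if "k \<ge> max (idx t) (nat \<lceil>cmod (f t)\<rceil>)" for k
    proof -
      have "x (Suc (idx t)) \<le> x (Suc k)" using that by (intro x_mono) simp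
      then have "t \<le> x (Suc k)" using exists_gap(2)[of t] t by simp
      moreover have "cmod (f t) \<le> real (Suc k)" using that by (simp add: nat_le_iff ceiling_le_iff)
      ultimately show ?thesis by (simp add: f1_def clamp_norm_eq del: of_nat_Suc)
    qed
    then show "(\<lambda>k. f1 k t) \<longlonglongrightarrow> f t"
      by (intro tendsto_eventually) (auto simp: eventually_sequentially simp del: max.bounded_iff)
  qed
  then obtain k where k: "L2_dist M (f1 k) f < e / 4" using ex by blast
  define N where "N = Suc k"
  define B where "B = real N"
  have B: "0 < B" by (simp add: B_def N_def)
  have f1: "f1 k = trunc N (\<lambda>t. clamp_norm B (f t))" unfolding f1_def[abs_def] N_def B_def ..
  have "f measurable_on I"
    using L2_measurable[OF f] measurable_on_iff_borel_measurable[OF I_sets] by blast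
  then obtain Z g where Z: "negligible Z" and g: "\<And>n. continuous_on UNIV (g n)"
    "\<And>t. t \<notin> Z \<Longrightarrow> (\<lambda>n. g n t) \<longlonglongrightarrow> (if t \<in> I then f t else 0)"
    unfolding measurable_on_def by blast
  have cg: "continuous_on UNIV (\<lambda>t. clamp_norm B (g n t))" for n
    by (rule continuous_on_compose2[OF continuous_on_clamp_norm[OF B, of UNIV] g(1)]) simp
  have "(\<lambda>n. L2_dist M (trunc N (\<lambda>t. clamp_norm B (g n t))) (f1 k)) \<longlonglongrightarrow> 0"
  proof (rule L2_dominated_convergence[OF trunc_L2[OF cg] f1L trunc_L2[of "\<lambda>_. of_real (2 * B)" N] Z])
    show "cmod (trunc N (\<lambda>t. clamp_norm B (g n t)) t - f1 k t) \<le> cmod (trunc N (\<lambda>_. of_real (2 * B)) t)" for n t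
    proof -
      have "cmod (clamp_norm B (g n t) - clamp_norm B (f t)) \<le> cmod (clamp_norm B (g n t)) + cmod (clamp_norm B (f t))"
        by (rule norm_triangle_ineq4)
      also have "\<dots> \<le> 2 * B" using cmod_clamp_norm_le(1)[OF B, of "g n t"] cmod_clamp_norm_le(1)[OF B, of "f t"] by simp
      finally show ?thesis unfolding f1 using B by (simp del: of_real_mult)
    qed
    fix t assume "t \<in> I - Z"
    then have "(\<lambda>n. g n t) \<longlonglongrightarrow> f t" using g(2)[of t] by simp
    then have "(\<lambda>n. clamp_norm B (g n t)) \<longlonglongrightarrow> clamp_norm B (f t)"
      using continuous_on_tendsto_compose[OF continuous_on_clamp_norm[OF B, of UNIV]] by simp
    then show "(\<lambda>n. trunc N (\<lambda>t. clamp_norm B (g n t)) t) \<longlonglongrightarrow> f1 k t" unfolding f1 by simp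
  qed simp
  then obtain n where n: "L2_dist M (trunc N (\<lambda>t. clamp_norm B (g n t))) (f1 k) < e / 4" using ex by blast
  define G where "G t = clamp_norm B (g n t)" for t
  have cG: "continuous_on UNIV G" using cg by (simp add: G_def[abs_def])
  have "\<exists>p. polynomial_function p \<and> (\<forall>t\<in>{0..x N}. norm (G t - p t) < inverse (real (Suc j)))" for j
    by (rule Stone_Weierstrass_polynomial_function[OF _ continuous_on_subset[OF cG]]) auto
  then obtain p where p: "\<And>j. polynomial_function (p j)" "\<And>j t. t \<in> {0..x N} \<Longrightarrow> norm (G t - p j t) < inverse (real (Suc j))"
    by metis
  have pc: "continuous_on UNIV (p j)" for j by (rule continuous_on_polymonial_function[OF p(1)])
  have "(\<lambda>j. L2_dist M (trunc N (p j)) (trunc N G)) \<longlonglongrightarrow> 0"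
  proof (rule L2_dominated_convergence[OF trunc_L2[OF pc] trunc_L2[OF cG] trunc_L2[of "\<lambda>_. 1" N] negligible_empty])
    fix t assume t: "t \<in> I - {}"
    show le: "cmod (trunc N (p j) t - trunc N G t) \<le> cmod (trunc N (\<lambda>_. 1) t)" for j
    proof (cases "t \<le> x N")
      case True
      then have "norm (G t - p j t) < inverse (real (Suc j))" using p(2)[of t j] I_nonneg t by simp
      also have "\<dots> \<le> 1" by (simp add: inverse_le_1_iff)
      finally show ?thesis using True by (simp add: norm_minus_commute)
    qed simp
    have lim: "(\<lambda>j. inverse (real (Suc j))) \<longlonglongrightarrow> 0" by (rule LIMSEQ_inverse_real_of_nat)
    have "(\<lambda>j. trunc N (p j) t - trunc N G t) \<longlonglongrightarrow> 0"
    proof (rule Lim_null_comparison[OF always_eventually lim], rule allI)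
      show "norm (trunc N (p j) t - trunc N G t) \<le> inverse (real (Suc j))" for j
        using p(2)[of t j] I_nonneg t by (cases "t \<le> x N") (auto simp: norm_minus_commute intro: less_imp_le)
    qed
    then show "(\<lambda>j. trunc N (p j) t) \<longlonglongrightarrow> trunc N G t" by (simp only: LIM_zero_iff)
  qed simp
  then obtain j where j: "L2_dist M (trunc N (p j)) (trunc N G) < e / 4" using ex by blast
  obtain u v where uv: "(u, v) \<in> H_pre b x \<alpha>" "L2_dist M u (trunc N (p j)) < e / 4"
    by (rule trunc_polynomial_approx[OF p(1) e4])
  have uL: "u \<in> L2 M" using H_pre_L2[OF uv(1)] by simp
  note L = trunc_L2[OF pc[of j], of N] trunc_L2[OF cG, of N] f1L[of k]
  have "L2_dist M u f \<le> L2_dist M u (trunc N (p j)) + L2_dist M (trunc N (p j)) f"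
    by (rule L2_dist_triangle[OF uL L(1) f])
  also have "L2_dist M (trunc N (p j)) f \<le> L2_dist M (trunc N (p j)) (trunc N G) + L2_dist M (trunc N G) f"
    by (rule L2_dist_triangle[OF L(1,2) f])
  also have "L2_dist M (trunc N G) f \<le> L2_dist M (trunc N G) (f1 k) + L2_dist M (f1 k) f"
    by (rule L2_dist_triangle[OF L(2,3) f])
  finally have "L2_dist M u f < e" using uv(2) j n[folded G_def] k by linarith
  then show "\<exists>(g, h)\<in>H_pre b x \<alpha>. g \<in> L2 M \<and> L2_dist M g f < e" using uv(1) uL by blast
qed

text \<open>The regular representative from \<open>adjoint_regular\<close>, corrected at 0, lies in
  the closure by cutoff approximation. It differs from \<open>u\<close> on a null set only, so the
  same approximating sequence converges to \<open>u\<close>.\<close>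

lemma adjoint_subset_closure:
  assumes D: "\<And>n. x (Suc n) - x n \<le> D" and div: "\<not> summable (\<lambda>n. (x (Suc n) - x n)\<^sup>2)"
  shows "op_adjoint M (H_pre b x \<alpha>) \<subseteq> op_closure M (H_pre b x \<alpha>)"
proof clarify
  fix u v assume uv: "(u, v) \<in> op_adjoint M (H_pre b x \<alpha>)"
  have L: "u \<in> L2 M" "v \<in> L2 M" using uv by (auto simp: op_adjoint_def)
  obtain w w' R R' L' L'' Z where w: "delta_dom \<alpha> w w' (\<lambda>t. - v t) R R' L' L''" "negligible Z" "\<forall>t\<in>I - Z. w t = u t"
    by (rule adjoint_regular[OF uv]) (rule that)
  define w0 where "w0 = w(0 := R 0)"
  have dd: "delta_dom \<alpha> w0 (w'(0 := 0)) (\<lambda>t. - v t) R R' L' L''"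
    unfolding w0_def by (rule delta_dom_upd_0[OF w(1)])
  have Z: "negligible (insert 0 Z)" and eq: "w0 t = u t" if "t \<in> I - insert 0 Z" for t
    using w(2,3) that by (auto simp: w0_def)
  have w0m: "w0 \<in> borel_measurable M"
    by (intro measurable_gaps L2_measurable W22_gap_L2(1)[OF x_less delta_domD(1)[OF dd]])
  have w0L: "w0 \<in> L2 M" unfolding L2_def mem_Collect_eq
  proof
    show "integrable M (\<lambda>t. (cmod (w0 t))\<^sup>2)"
    proof (rule integrable_cong_AE_imp[OF L2_integrable_square[OF L(1)]])
      show "(\<lambda>t. (cmod (w0 t))\<^sup>2) \<in> borel_measurable M" using w0m by measurable
      show "AE t in M. (cmod (u t))\<^sup>2 = (cmod (w0 t))\<^sup>2"
        by (rule AE_M[of "insert 0 Z"]) (use w(2) eq in auto)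
    qed
  qed (rule w0m)
  have "(w0, \<lambda>t. - (- v t)) \<in> op_closure M (H_pre b x \<alpha>)"
    by (rule cutoff_in_closure[OF dd _ w0L L2_uminus[OF L(2)] D div]) (simp add: w0_def)
  then obtain F G where FG: "\<And>k::nat. (F k, G k) \<in> H_pre b x \<alpha>" "(\<lambda>k. L2_dist M (F k) w0) \<longlonglongrightarrow> 0"
    "(\<lambda>k. L2_dist M (G k) v) \<longlonglongrightarrow> 0" by (auto simp: op_closure_def)
  have "L2_dist M (F k) u = L2_dist M (F k) w0" for k
    by (rule L2_dist_cong[of _ _ _ "insert 0 Z"]) (use H_pre_L2[OF FG(1)] L w0L w(2) eq in auto)
  then have "(\<lambda>k. L2_dist M (F k) u) \<longlonglongrightarrow> 0" using FG(2) by simp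
  then show "(u, v) \<in> op_closure M (H_pre b x \<alpha>)" using FG(1,3) L by (auto simp: op_closure_def)
qed

lemma H_op_self_adjoint:
  assumes "\<And>n. x (Suc n) - x n \<le> D" "\<not> summable (\<lambda>n. (x (Suc n) - x n)\<^sup>2)"
  shows "self_adjoint M (H_op b x \<alpha>)"
  unfolding H_op_def
  by (rule self_adjoint_op_closureI[OF _ H_pre_dense H_pre_symmetric adjoint_subset_closure[OF assms]])
    (use H_pre_L2 in auto)

end

theorem proposition5p7:
  fixes b :: ereal and x \<alpha> d :: "nat \<Rightarrow> real"
  assumes "0 < b"
    and "x 0 = 0" and "strict_mono x" and "\<And>n. ereal (x n) < b"
    and "(\<lambda>n. ereal (x n)) \<longlonglongrightarrow> b"
    and "\<And>n. n \<ge> 1 \<Longrightarrow> d n = x n - x (n - 1)"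
    and "bdd_above (d ` {1..})"
    and "\<not> summable (\<lambda>n. (d (Suc n))\<^sup>2)"
  shows "self_adjoint (lebesgue_on (half_open b)) (H_op b x \<alpha>)"
proof -
  interpret point_grid b x by unfold_locales (use assms in auto)
  \<comment> \<open>Gap \<open>n\<close> starts at \<open>x n\<close>, so its length carries the
    index \<open>Suc n\<close>.\<close>
  have d: "d (Suc n) = x (Suc n) - x n" for n using assms(6)[of "Suc n"] by simp
  obtain D where D: "\<And>y. y \<in> d ` {1..} \<Longrightarrow> y \<le> D" using assms(7) by (auto simp: bdd_above_def)
  have "x (Suc n) - x n \<le> D" for n using D[OF imageI, of "Suc n"] by (simp add: d)
  then show ?thesis by (rule H_op_self_adjoint) (use assms(8) in \<open>simp add: d\<close>)
qed

end
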